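(* Let $1<p<\infty$, let $\Omega_1,\Omega_2\subset\mathbb{C}$ be bounded Dini-smooth domains, let $\nu\in W^{1,\infty}(\Omega_2)$ be real-valued with $\|\nu\|_{L^\infty(\Omega_2)}\le\kappa$ for some $\kappa\in(0,1)$, and let $\phi:\Omega_1\to\Omega_2$ be analytic with $\phi\in W^{1,\infty}(\Omega_1)$. Then the composition operator $C_\phi:H^p_\nu(\Omega_2)\to H^p_{\nu\circ\phi}(\Omega_1)$, $C_\phi(f)=f\circ\phi$, is continuous (in particular well defined).
   Context: A domain is a connected open subset of $\mathbb{C}$. A bounded domain is Dini-smooth if its boundary is a finite union of pairwise disjoint Jordan curves, each with a non-singular parametrization whose derivative is Dini-continuous, i.e. has modulus of continuity $\omega$ with $\int_0^\varepsilon \omega(t)\,dt/t<\infty$ for some $\varepsilon>0$. For a bounded Dini-smooth domain $\Omega$ and $\nu\in W^{1,\infty}(\Omega)$ real-valued with $\|\nu\|_{L^\infty(\Omega)}\le\kappa<1$, $H^p_\nu(\Omega)$ is the real Banach space of measurable $f:\Omega\to\mathbb{C}$ solving $\overline\partial f=\nu\,\overline{\partial f}$ in the sense of distributions on $\Omega$ with $\|f\|_{H^p_\nu(\Omega)}:=\sup_n\|f\|_{L^p(\partial\Delta_n)}<\infty$. Here $(\Delta_n)_n$ is a fixed sequence of domains with $\overline{\Delta_n}\subset\Omega$, $\partial\Delta_n$ a finite union of rectifiable Jordan curves of uniformly bounded length, and each compact subset of $\Omega$ contained in $\Delta_n$ for $n$ large. Recalled facts: the functions in $H^p_\nu(\Omega)$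 are continuous in $\Omega$ (after modification on a null set); equivalently (with equivalent norms) $H^p_\nu(\Omega)$ is the space of solutions $f$ for which $|f|^p\le u$ a.e. for some harmonic $u:\Omega\to[0,\infty)$, normed by $\inf u(z_0)^{1/p}$ over such $u$, for a fixed $z_0\in\Omega$. Note that $\nu\circ\phi$ is real-valued, Lipschitz on $\Omega_1$ and bounded by $\kappa$, so $H^p_{\nu\circ\phi}(\Omega_1)$ is defined. *)

theory Defs
  imports "HOL-Complex_Analysis.Complex_Analysis"
begin

section \<open>Arc length\<close>

text \<open>Arc length on a finite union of rectifiable Jordan curves is one-dimensional Hausdorff
  measure. On a simple curve it agrees with the length obtained from inscribed polygons, and it does
  not depend on a choice of parametrizations.\<close>

definition hausdorff1_premeasure :: "real \<Rightarrow> complex set \<Rightarrow> ennreal" where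
  "hausdorff1_premeasure \<delta> A =
     (INF U \<in> {U :: nat \<Rightarrow> complex set.
                 A \<subseteq> (\<Union>i. U i) \<and> (\<forall>i. bounded (U i) \<and> diameter (U i) \<le> \<delta>)}.
        \<Sum>i. ennreal (diameter (U i)))"

definition hausdorff1 :: "complex set \<Rightarrow> ennreal" where
  "hausdorff1 A = (SUP \<delta> \<in> {0<..}. hausdorff1_premeasure \<delta> A)"

definition arclength :: "complex measure" where
  "arclength = measure_of UNIV (sets borel) hausdorff1"

text \<open>The constant measure_of returns the zero measure unless it is given a measure, so
  \<open>emeasure_arclength\<close> below shows that this does not happen here.\<close>

lemma hausdorff1_premeasure_antimono:
  assumes "\<delta> \<le> \<delta>'" shows "hausdorff1_premeasure \<delta>' A \<le> hausdorff1_premeasure \<delta> A"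
  unfolding hausdorff1_premeasure_def
  by (rule INF_superset_mono) (use assms in \<open>auto intro: order_trans\<close>)

lemma hausdorff1_premeasure_le:
  "0 < \<delta> \<Longrightarrow> hausdorff1_premeasure \<delta> A \<le> hausdorff1 A"
  unfolding hausdorff1_def by (rule SUP_upper) auto

lemma hausdorff1_premeasure_mono:
  "A \<subseteq> B \<Longrightarrow> hausdorff1_premeasure \<delta> A \<le> hausdorff1_premeasure \<delta> B"
  unfolding hausdorff1_premeasure_def
  by (rule INF_superset_mono) auto

lemma hausdorff1_mono: "A \<subseteq> B \<Longrightarrow> hausdorff1 A \<le> hausdorff1 B"
  unfolding hausdorff1_def by (rule SUP_mono) (use hausdorff1_premeasure_mono in blast)

lemma hausdorff1_empty: "hausdorff1 {} = 0"
proof -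
  have "hausdorff1_premeasure \<delta> {} \<le> 0" if "0 < \<delta>" for \<delta>
    unfolding hausdorff1_premeasure_def
    by (rule INF_lower2[of "\<lambda>_. {}"]) (use that in auto)
  then show ?thesis
    unfolding hausdorff1_def by (metis SUP_least bot.extremum_uniqueI bot_ennreal greaterThan_iff)
qed

lemma hausdorff1_premeasure_subadditive:
  fixes A :: "nat \<Rightarrow> complex set"
  assumes "0 < \<delta>"
  shows "hausdorff1_premeasure \<delta> (\<Union>i. A i) \<le> (\<Sum>i. hausdorff1_premeasure \<delta> (A i))"
proof (rule ennreal_le_epsilon)
  let ?O = "hausdorff1_premeasure \<delta>"
  fix b and e :: real assume e: "0 < e" "(\<Sum>n. ?O (A n)) < top"
  then have *: "?O (A n) < ?O (A n) + e * (1/2)^Suc n" for n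
    by (auto simp add: less_top dest!: ennreal_suminf_lessD)
  have "\<exists>U. A n \<subseteq> (\<Union>i. U i) \<and> (\<forall>i. bounded (U i) \<and> diameter (U i) \<le> \<delta>) \<and>
            (\<Sum>i::nat. ennreal (diameter (U i))) \<le> ?O (A n) + e * (1/2)^Suc n" for n
    using *[of n] unfolding hausdorff1_premeasure_def[of \<delta> "A n"] INF_less_iff
    by (auto intro: less_imp_le)
  then obtain B where B: "\<And>n. A n \<subseteq> (\<Union>i. B n i)"
    "\<And>n i. bounded (B n i)" "\<And>n i. diameter (B n i) \<le> \<delta>"
    "\<And>n. (\<Sum>i::nat. ennreal (diameter (B n i))) \<le> ?O (A n) + e * (1/2)^Suc n"
    by metis
  define C where "C = case_prod B o prod_decode"
  have "(\<Union>i. A i) \<subseteq> (\<Union>i. C i)"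
    using B(1) by (auto simp add: C_def subset_eq) (metis prod.case prod_encode_inverse)
  then have "?O (\<Union>i. A i) \<le> (\<Sum>i. ennreal (diameter (C i)))"
    unfolding hausdorff1_premeasure_def
    by (intro INF_lower) (auto simp: C_def split_def B)
  also have "\<dots> = (\<Sum>n. \<Sum>i. ennreal (diameter (B n i)))"
    using suminf_ennreal_2dimen[of "\<lambda>n. \<Sum>i. ennreal (diameter (B n i))"
        "\<lambda>(n, i). ennreal (diameter (B n i))"]
    by (simp add: C_def comp_def split_def)
  also have "\<dots> \<le> (\<Sum>n. ?O (A n) + e * (1/2) ^ Suc n)"
    by (intro suminf_le allI B(4)) auto
  also have "... = (\<Sum>n. ?O (A n)) + (\<Sum>n. ennreal e * ennreal ((1/2) ^ Suc n))"
    using \<open>0 < e\<close> by (subst suminf_add[symmetric])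
                     (auto simp del: ennreal_suminf_cmult simp add: ennreal_mult[symmetric])
  also have "\<dots> = (\<Sum>n. ?O (A n)) + e"
    unfolding ennreal_suminf_cmult
    by (subst suminf_ennreal_eq[OF zero_le_power power_half_series]) auto
  finally show "?O (\<Union>i. A i) \<le> (\<Sum>n. ?O (A n)) + e" .
qed

lemma hausdorff1_subadditive: "hausdorff1 (\<Union>i. A i) \<le> (\<Sum>i. hausdorff1 (A i))"
proof -
  have "hausdorff1_premeasure \<delta> (\<Union>i. A i) \<le> (\<Sum>i. hausdorff1 (A i))" if "0 < \<delta>" for \<delta>
    using hausdorff1_premeasure_subadditive[OF that, of A]
    by (rule order_trans) (intro suminf_le hausdorff1_premeasure_le that; simp)
  then show ?thesis unfolding hausdorff1_def[of "\<Union>i. A i"] by (intro SUP_least) auto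
qed

lemma outer_measure_space_hausdorff1: "outer_measure_space (Pow UNIV) hausdorff1"
  unfolding outer_measure_space_def positive_def increasing_def countably_subadditive_def
  by (auto simp: hausdorff1_empty hausdorff1_mono hausdorff1_subadditive)

lemma hausdorff1_subadditive2: "hausdorff1 (A \<union> B) \<le> hausdorff1 A + hausdorff1 B"
proof -
  define F where "F i = (if i = 0 then A else if i = 1 then B else {})" for i :: nat
  have "(\<Union>i. F i) = A \<union> B" unfolding F_def by (auto split: if_splits)
  then have "hausdorff1 (A \<union> B) \<le> (\<Sum>i. hausdorff1 (F i))"
    using hausdorff1_subadditive[of F] by simp
  also have "\<dots> = (\<Sum>i\<in>{0,1}. hausdorff1 (F i))"
    by (rule suminf_finite) (auto simp: F_def hausdorff1_empty)
  also have "\<dots> = hausdorff1 A + hausdorff1 B"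
    by (simp add: F_def)
  finally show ?thesis .
qed

lemma hausdorff1_metric:
  assumes d: "0 < d" "\<And>x y. x \<in> P \<Longrightarrow> y \<in> Q \<Longrightarrow> d \<le> dist x y"
  shows "hausdorff1 P + hausdorff1 Q \<le> hausdorff1 (P \<union> Q)"
proof -
  let ?O = hausdorff1_premeasure
  have small: "?O \<delta> P + ?O \<delta> Q \<le> ?O \<delta> (P \<union> Q)" if \<delta>: "0 < \<delta>" "\<delta> < d" for \<delta>
    unfolding hausdorff1_premeasure_def[of \<delta> "P \<union> Q"]
  proof (rule INF_greatest, clarsimp)
    fix U :: "nat \<Rightarrow> complex set"
    assume U: "P \<subseteq> (\<Union>i. U i)" "Q \<subseteq> (\<Union>i. U i)" "\<forall>i. bounded (U i) \<and> diameter (U i) \<le> \<delta>"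
    define V where "V i = (if U i \<inter> P = {} then {} else U i)" for i
    define W where "W i = (if U i \<inter> Q = {} then {} else U i)" for i
    have "?O \<delta> P \<le> (\<Sum>i. ennreal (diameter (V i)))"
      unfolding hausdorff1_premeasure_def
      by (rule INF_lower) (use U \<delta> in \<open>auto simp: V_def subset_eq; blast\<close>)
    moreover have "?O \<delta> Q \<le> (\<Sum>i. ennreal (diameter (W i)))"
      unfolding hausdorff1_premeasure_def
      by (rule INF_lower) (use U \<delta> in \<open>auto simp: W_def subset_eq; blast\<close>)
    moreover have "V i = {} \<or> W i = {}" for i
    proof (rule ccontr)
      assume "\<not> ?thesis"
      then obtain x y where xy: "x \<in> U i" "x \<in> P" "y \<in> U i" "y \<in> Q"
        by (auto simp: V_def W_def split: if_splits)
      then have "dist x y \<le> diameter (U i)" using U(3) diameter_bounded_bound by blast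
      then show False using d(2)[OF xy(2,4)] U(3) \<delta>(2) by (smt (verit))
    qed
    then have "ennreal (diameter (V i)) + ennreal (diameter (W i)) \<le> ennreal (diameter (U i))" for i
      by (smt (verit) V_def W_def add.commute add_0 diameter_empty ennreal_0 order_refl zero_le)
    then have "(\<Sum>i. ennreal (diameter (V i))) + (\<Sum>i. ennreal (diameter (W i)))
                 \<le> (\<Sum>i. ennreal (diameter (U i)))"
      by (subst suminf_add) (auto intro!: suminf_le)
    ultimately show "?O \<delta> P + ?O \<delta> Q \<le> (\<Sum>i. ennreal (diameter (U i)))"
      by (meson add_mono order_trans)
  qed
  have "?O \<delta> P + ?O \<delta>' Q \<le> hausdorff1 (P \<union> Q)" if "0 < \<delta>" "0 < \<delta>'" for \<delta> \<delta>'
  proof -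
    define \<eta> where "\<eta> = min (min \<delta> \<delta>') (d / 2)"
    have \<eta>: "0 < \<eta>" "\<eta> < d" "\<eta> \<le> \<delta>" "\<eta> \<le> \<delta>'" using that d(1) by (auto simp: \<eta>_def min_def)
    have "?O \<delta> P + ?O \<delta>' Q \<le> ?O \<eta> P + ?O \<eta> Q"
      by (intro add_mono hausdorff1_premeasure_antimono \<eta>)
    also have "\<dots> \<le> ?O \<eta> (P \<union> Q)" by (rule small) (use \<eta> in auto)
    also have "\<dots> \<le> hausdorff1 (P \<union> Q)" by (rule hausdorff1_premeasure_le) (use \<eta> in auto)
    finally show ?thesis .
  qed
  then have "?O \<delta> P + hausdorff1 Q \<le> hausdorff1 (P \<union> Q)" if "0 < \<delta>" for \<delta>
    unfolding hausdorff1_def[of Q] using that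
    by (subst ennreal_SUP_add_right) (auto intro!: SUP_least)
  then have "hausdorff1 Q + hausdorff1 P \<le> hausdorff1 (P \<union> Q)"
    unfolding hausdorff1_def[of P]
    by (subst ennreal_SUP_add_right) (auto intro!: SUP_least simp: add.commute)
  then show ?thesis by (simp add: add.commute)
qed

lemma closed_in_lambda_system_hausdorff1:
  assumes "closed C"
  shows "C \<in> lambda_system UNIV (Pow UNIV) hausdorff1"
proof -
  have "hausdorff1 (X \<inter> C) + hausdorff1 (X - C) \<le> hausdorff1 X" for X
  proof (cases "C = {} \<or> hausdorff1 X = top")
    case True then show ?thesis by (auto simp: hausdorff1_empty)
  next
    case False
    then have ne: "C \<noteq> {}" and fin: "hausdorff1 X \<noteq> top" by auto
    define D where "D n = {x \<in> X. infdist x C \<ge> 1 / real (Suc n)}" for n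
    define R where "R n = {x \<in> X. 1 / real (Suc (Suc n)) \<le> infdist x C \<and> infdist x C < 1 / real (Suc n)}" for n
    have Dbound: "hausdorff1 (X \<inter> C) + hausdorff1 (D n) \<le> hausdorff1 X" for n
    proof -
      have "hausdorff1 (X \<inter> C) + hausdorff1 (D n) \<le> hausdorff1 ((X \<inter> C) \<union> D n)"
      proof (rule hausdorff1_metric[of "1 / real (Suc n)"])
        fix x y assume "x \<in> X \<inter> C" "y \<in> D n"
        then have "1 / real (Suc n) \<le> infdist y C" "infdist y C \<le> dist y x"
          by (auto simp: D_def intro: infdist_le)
        then show "1 / real (Suc n) \<le> dist x y" by (simp add: dist_commute)
      qed auto
      also have "\<dots> \<le> hausdorff1 X" by (rule hausdorff1_mono) (auto simp: D_def)
      finally show ?thesis .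
    qed
    have sep: "1 / real (Suc (Suc m)) - 1 / real (Suc n) \<le> dist x y"
      if "x \<in> R m" "y \<in> R n" for m n x y
    proof -
      have "infdist x C \<le> infdist y C + dist x y" by (rule infdist_triangle)
      then show ?thesis using that by (auto simp: R_def)
    qed
    have fsum: "(\<Sum>k<n. hausdorff1 (R (2*k + j))) \<le> hausdorff1 (\<Union>k<n. R (2*k+j))" for n j
    proof (induction n)
      case (Suc n)
      have "(\<Sum>k<Suc n. hausdorff1 (R (2*k + j)))
          \<le> hausdorff1 (\<Union>k<n. R (2*k+j)) + hausdorff1 (R (2*n+j))"
        using Suc by (simp add: add_right_mono)
      also have "\<dots> \<le> hausdorff1 ((\<Union>k<n. R (2*k+j)) \<union> R (2*n+j))"
      proof (cases "n = 0")
        case True then show ?thesis by (simp add: hausdorff1_empty)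
      next
        case False
        define e where "e = 1 / real (2*n+j) - 1 / real (Suc (2*n+j))"
        have e: "0 < e"
          using False unfolding e_def by (simp add: divide_strict_left_mono)
        show ?thesis
        proof (rule hausdorff1_metric[OF e])
          fix x y assume xy: "x \<in> (\<Union>k<n. R (2*k+j))" "y \<in> R (2*n+j)"
          then obtain k where k: "k < n" "x \<in> R (2*k+j)" by auto
          have "1 / real (2*n+j) \<le> 1 / real (Suc (Suc (2*k+j)))"
            using k(1) by (intro divide_left_mono) auto
          then show "e \<le> dist x y"
            using sep[OF k(2) xy(2)] unfolding e_def by linarith
        qed
      qed
      also have "(\<Union>k<n. R (2*k+j)) \<union> R (2*n+j) = (\<Union>k<Suc n. R (2*k+j))"
        by (auto simp: lessThan_Suc)
      finally show ?case .
    qed (simp add: hausdorff1_empty)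
    have fsumX: "(\<Sum>k<n. hausdorff1 (R (2*k + j))) \<le> hausdorff1 X" for n j
      by (rule order_trans[OF fsum], rule hausdorff1_mono) (auto simp: R_def)
    define r where "r k = enn2real (hausdorff1 (R k))" for k
    have Rfin: "hausdorff1 (R k) < top" for k
    proof -
      have "hausdorff1 (R k) \<le> hausdorff1 X" by (rule hausdorff1_mono) (auto simp: R_def)
      then show ?thesis using fin by (metis less_top order_le_less_trans)
    qed
    have r: "hausdorff1 (R k) = ennreal (r k)" "0 \<le> r k" for k
      using Rfin[of k] by (auto simp: r_def)
    have "(\<Sum>k<n. r k) \<le> 2 * enn2real (hausdorff1 X)" for n
    proof -
      have half: "(\<Sum>k<n. r (2*k + j)) \<le> enn2real (hausdorff1 X)" for j
      proof -
        have "ennreal (\<Sum>k<n. r (2*k + j)) \<le> ennreal (enn2real (hausdorff1 X))"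
          using fsumX[where n = n and j = j] fin r by (simp add: sum_ennreal less_top)
        then show ?thesis by (simp add: ennreal_le_iff)
      qed
      have "(\<Sum>k<n. r k) \<le> (\<Sum>k<2*n. r k)"
        by (rule sum_mono2) (auto simp: r)
      also have "\<dots> = (\<Sum>k<n. r (2*k+0)) + (\<Sum>k<n. r (2*k+1))"
        by (induction n) auto
      also have "\<dots> \<le> 2 * enn2real (hausdorff1 X)"
        using half[of 0] half[of 1] by simp
      finally show ?thesis .
    qed
    then have summ: "summable r"
      by (intro bounded_imp_summable[of r "2 * enn2real (hausdorff1 X)"])
         (auto simp: r lessThan_Suc_atMost[symmetric] simp del: sum.lessThan_Suc)
    show ?thesis
    proof (rule ennreal_le_epsilon)
      fix e :: real assume e: "0 < e"
      obtain n where n: "norm (\<Sum>i. r (i + n)) < e"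
        using suminf_exist_split[OF e summ] by blast
      have "X - C \<subseteq> D n \<union> (\<Union>k. R (k + n))"
      proof
        fix x assume x: "x \<in> X - C"
        then have pos: "0 < infdist x C"
          using assms ne in_closed_iff_infdist_zero[of C x] infdist_nonneg[of x C] by auto
        show "x \<in> D n \<union> (\<Union>k. R (k + n))"
        proof (cases "x \<in> D n")
          case False
          then have lt: "infdist x C < 1 / real (Suc n)" using x by (auto simp: D_def)
          obtain m0 where "1 / real (Suc m0) < infdist x C"
            using nat_approx_posE[OF pos] by auto
          then have ex: "\<exists>m. 1 / real (Suc m) \<le> infdist x C" by (auto intro: less_imp_le)
          define m where "m = (LEAST m. 1 / real (Suc m) \<le> infdist x C)"
          have m: "1 / real (Suc m) \<le> infdist x C" unfolding m_def by (rule LeastI_ex[OF ex])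
          have mmin: "infdist x C < 1 / real (Suc k)" if "k < m" for k
            using not_less_Least[of k "\<lambda>m. 1 / real (Suc m) \<le> infdist x C"] that
            unfolding m_def by auto
          have "n < m"
          proof (rule ccontr)
            assume "\<not> n < m"
            then have "1 / real (Suc n) \<le> 1 / real (Suc m)" by (intro divide_left_mono) auto
            then show False using lt m by linarith
          qed
          then obtain k where k: "m = Suc (k + n)"
            by (metis add.commute less_imp_Suc_add)
          have "x \<in> R (k + n)"
            using x m mmin[of "k + n"] k by (auto simp: R_def)
          then show ?thesis by blast
        qed blast
      qed
      then have "hausdorff1 (X - C) \<le> hausdorff1 (D n \<union> (\<Union>k. R (k + n)))"
        by (rule hausdorff1_mono)
      also have "\<dots> \<le> hausdorff1 (D n) + hausdorff1 (\<Union>k. R (k + n))"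
        by (rule hausdorff1_subadditive2)
      also have "\<dots> \<le> hausdorff1 (D n) + (\<Sum>k. hausdorff1 (R (k + n)))"
        by (intro add_left_mono hausdorff1_subadditive)
      also have "(\<Sum>k. hausdorff1 (R (k + n))) = ennreal (\<Sum>k. r (k + n))"
        unfolding r(1) by (rule suminf_ennreal2) (use r summ in \<open>auto simp: summable_iff_shift\<close>)
      also have "\<dots> \<le> ennreal e" using n by (intro ennreal_leI) auto
      finally have "hausdorff1 (X - C) \<le> hausdorff1 (D n) + ennreal e" by (simp add: add_left_mono)
      then have "hausdorff1 (X \<inter> C) + hausdorff1 (X - C)
          \<le> (hausdorff1 (X \<inter> C) + hausdorff1 (D n)) + ennreal e"
        by (simp add: add.assoc add_left_mono)
      also have "\<dots> \<le> hausdorff1 X + ennreal e" by (intro add_right_mono Dbound)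
      finally show "hausdorff1 (X \<inter> C) + hausdorff1 (X - C) \<le> hausdorff1 X + ennreal e" .
    qed
  qed
  moreover have "hausdorff1 X \<le> hausdorff1 (X \<inter> C) + hausdorff1 (X - C)" for X
    using hausdorff1_subadditive2[of "X \<inter> C" "X - C"] by (simp add: Int_Diff_Un)
  ultimately show ?thesis
    unfolding algebra.lambda_system_eq[OF algebra_Pow] by (auto intro!: antisym)
qed

lemma emeasure_arclength:
  assumes "A \<in> sets borel"
  shows "emeasure arclength A = hausdorff1 A"
proof -
  interpret sigma_algebra UNIV "Pow UNIV :: complex set set" by (rule sigma_algebra_Pow)
  let ?L = "lambda_system UNIV (Pow UNIV) hausdorff1"
  have L: "measure_space UNIV ?L hausdorff1"
    by (rule caratheodory_lemma[OF outer_measure_space_hausdorff1])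
  then interpret L: sigma_algebra UNIV ?L by (simp add: measure_space_def)
  have sub: "sets borel \<subseteq> ?L"
    unfolding borel_eq_closed
    by (subst sets_measure_of; (intro L.sigma_sets_subset)?)
       (auto intro: closed_in_lambda_system_hausdorff1[simplified])
  have "measure_space UNIV (sets borel) hausdorff1"
    using L sub sets.sigma_algebra_axioms[of "borel :: complex measure"]
    by (auto simp: measure_space_def positive_def countably_additive_def subset_eq)
  then show ?thesis
    unfolding arclength_def
    by (intro emeasure_measure_of_sigma)
       (use assms in \<open>auto simp: measure_space_def sets.sigma_algebra_axioms\<close>)
qed

lemma sets_arclength: "sets arclength = sets borel"
  using sets.sigma_sets_eq[of "borel :: complex measure"] unfolding arclength_def by simp

section \<open>Domains and curves\<close>

definition domain_in_plane :: "complex set \<Rightarrow> bool" where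
  "domain_in_plane \<Omega> \<longleftrightarrow> open \<Omega> \<and> connected \<Omega>"

definition jordan_curve :: "(real \<Rightarrow> complex) \<Rightarrow> bool" where
  "jordan_curve \<gamma> \<longleftrightarrow> simple_path \<gamma> \<and> pathfinish \<gamma> = pathstart \<gamma>"

definition rectifiable :: "(real \<Rightarrow> complex) \<Rightarrow> bool" where
  "rectifiable \<gamma> \<longleftrightarrow>
     (\<exists>L. \<forall>ts. sorted ts \<and> set ts \<subseteq> {0..1} \<longrightarrow>
        (\<Sum>i<length ts - 1. dist (\<gamma> (ts ! i)) (\<gamma> (ts ! Suc i))) \<le> L)"

definition modulus_of_continuity :: "real set \<Rightarrow> (real \<Rightarrow> complex) \<Rightarrow> real \<Rightarrow> ennreal" where
  "modulus_of_continuity S g t =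
     (SUP (x, y) \<in> {(x, y). x \<in> S \<and> y \<in> S \<and> \<bar>x - y\<bar> \<le> t}. ennreal (dist (g x) (g y)))"

definition Dini_continuous_on :: "real set \<Rightarrow> (real \<Rightarrow> complex) \<Rightarrow> bool" where
  "Dini_continuous_on S g \<longleftrightarrow>
     (\<exists>\<epsilon>>0. (\<integral>\<^sup>+t\<in>{0<..\<epsilon>}. modulus_of_continuity S g t / ennreal t \<partial>lborel) < \<infinity>)"

text \<open>The condition \<open>\<gamma>' 0 = \<gamma>' 1\<close> makes the derivative well defined on the circle obtained by
  identifying the endpoints of the parameter interval; without it the curve could have a corner.\<close>

definition Dini_smooth_param :: "(real \<Rightarrow> complex) \<Rightarrow> bool" where
  "Dini_smooth_param \<gamma> \<longleftrightarrow>
     (\<exists>\<gamma>'. (\<forall>t\<in>{0..1}. (\<gamma> has_vector_derivative \<gamma>' t) (at t within {0..1}) \<and> \<gamma>' t \<noteq> 0) \<and>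
           \<gamma>' 0 = \<gamma>' 1 \<and> Dini_continuous_on {0..1} \<gamma>')"

definition bounded_Dini_smooth_domain :: "complex set \<Rightarrow> bool" where
  "bounded_Dini_smooth_domain \<Omega> \<longleftrightarrow>
     domain_in_plane \<Omega> \<and> bounded \<Omega> \<and>
     (\<exists>G. finite G \<and> (\<forall>\<gamma>\<in>G. jordan_curve \<gamma> \<and> Dini_smooth_param \<gamma>) \<and>
          disjoint_family_on path_image G \<and> frontier \<Omega> = (\<Union>\<gamma>\<in>G. path_image \<gamma>))"

section \<open>Distributions and Sobolev functions\<close>

definition dir_deriv :: "complex \<Rightarrow> (complex \<Rightarrow> 'b::real_normed_vector) \<Rightarrow> complex \<Rightarrow> 'b" where
  "dir_deriv e f z = frechet_derivative f (at z) e"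

primrec C_k_on :: "nat \<Rightarrow> complex set \<Rightarrow> (complex \<Rightarrow> 'b::real_normed_vector) \<Rightarrow> bool" where
  "C_k_on 0 S f \<longleftrightarrow> continuous_on S f"
| "C_k_on (Suc k) S f \<longleftrightarrow>
     (\<forall>z\<in>S. f differentiable (at z)) \<and> C_k_on k S (dir_deriv 1 f) \<and> C_k_on k S (dir_deriv \<i> f)"

definition test_functions :: "complex set \<Rightarrow> (complex \<Rightarrow> complex) set" where
  "test_functions \<Omega> =
     {\<psi>. (\<forall>k. C_k_on k UNIV \<psi>) \<and>
          compact (closure {z. \<psi> z \<noteq> 0}) \<and> closure {z. \<psi> z \<noteq> 0} \<subseteq> \<Omega>}"

definition dbar :: "(complex \<Rightarrow> complex) \<Rightarrow> complex \<Rightarrow> complex" where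
  "dbar \<psi> z = (dir_deriv 1 \<psi> z + \<i> * dir_deriv \<i> \<psi> z) / 2"

definition L_infinity :: "complex set \<Rightarrow> (complex \<Rightarrow> complex) set" where
  "L_infinity \<Omega> =
     {f. f \<in> borel_measurable (lebesgue_on \<Omega>) \<and> (\<exists>M. AE z in lebesgue_on \<Omega>. cmod (f z) \<le> M)}"

definition weak_dir_deriv ::
    "complex set \<Rightarrow> complex \<Rightarrow> (complex \<Rightarrow> complex) \<Rightarrow> (complex \<Rightarrow> complex) \<Rightarrow> bool" where
  "weak_dir_deriv \<Omega> e f g \<longleftrightarrow>
     (\<forall>\<psi>\<in>test_functions \<Omega>.
        (LINT z|lebesgue_on \<Omega>. f z * dir_deriv e \<psi> z) = - (LINT z|lebesgue_on \<Omega>. g z * \<psi> z))"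

definition W_1_infinity :: "complex set \<Rightarrow> (complex \<Rightarrow> complex) set" where
  "W_1_infinity \<Omega> =
     {f \<in> L_infinity \<Omega>. \<forall>e\<in>{1, \<i>}. \<exists>g\<in>L_infinity \<Omega>. weak_dir_deriv \<Omega> e f g}"

definition weak_dbar :: "complex set \<Rightarrow> (complex \<Rightarrow> complex) \<Rightarrow> (complex \<Rightarrow> complex) \<Rightarrow> bool" where
  "weak_dbar \<Omega> f g \<longleftrightarrow>
     (\<forall>\<psi>\<in>test_functions \<Omega>.
        (LINT z|lebesgue_on \<Omega>. f z * dbar \<psi> z) = - (LINT z|lebesgue_on \<Omega>. g z * \<psi> z))"

section \<open>The conjugate Beltrami equation\<close>

text \<open>The equation is \<open>dbar f = \<nu> * cnj (d f)\<close>, where \<open>cnj (d f) = dbar (cnj f)\<close>. With \<open>N\<close> the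
  distributional derivative \<open>dbar \<nu>\<close>, the product of \<open>\<nu>\<close> with the distribution \<open>dbar (cnj f)\<close> is
  \<open>dbar (\<nu> * cnj f) - N * cnj f\<close>. Testing against \<open>\<psi>\<close> gives the identity below.
  Solutions are continuous after modification on a null set; here the continuous representative is
  taken, so that restrictions to curves and compositions with any map are defined pointwise.
  Values outside \<open>\<Omega>\<close> are irrelevant.\<close>

definition CB_solutions :: "complex set \<Rightarrow> (complex \<Rightarrow> real) \<Rightarrow> (complex \<Rightarrow> complex) set" where
  "CB_solutions \<Omega> \<nu> =
     {f. continuous_on \<Omega> f \<and>
         (\<exists>N\<in>L_infinity \<Omega>. weak_dbar \<Omega> (\<lambda>z. of_real (\<nu> z)) N \<and>
            (\<forall>\<psi>\<in>test_functions \<Omega>.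
               (LINT z|lebesgue_on \<Omega>. f z * dbar \<psi> z) =
               (LINT z|lebesgue_on \<Omega>. cnj (f z) * (of_real (\<nu> z) * dbar \<psi> z + N z * \<psi> z))))}"

section \<open>Hardy spaces\<close>

definition exhaustion :: "complex set \<Rightarrow> (nat \<Rightarrow> complex set) \<Rightarrow> bool" where
  "exhaustion \<Omega> \<Delta> \<longleftrightarrow>
     (\<forall>n. domain_in_plane (\<Delta> n) \<and> closure (\<Delta> n) \<subseteq> \<Omega> \<and>
          (\<exists>G. finite G \<and> (\<forall>\<gamma>\<in>G. jordan_curve \<gamma> \<and> rectifiable \<gamma>) \<and>
               frontier (\<Delta> n) = (\<Union>\<gamma>\<in>G. path_image \<gamma>))) \<and>
     (\<exists>L::real. \<forall>n. emeasure arclength (frontier (\<Delta> n)) \<le> ennreal L) \<and>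
     (\<forall>K. compact K \<and> K \<subseteq> \<Omega> \<longrightarrow> (\<forall>\<^sub>F n in sequentially. K \<subseteq> \<Delta> n))"

definition boundary_Lp_norm :: "real \<Rightarrow> complex set \<Rightarrow> (complex \<Rightarrow> complex) \<Rightarrow> real" where
  "boundary_Lp_norm p D f = (LINT z:frontier D|arclength. cmod (f z) powr p) powr (1 / p)"

definition hardy_space ::
    "real \<Rightarrow> complex set \<Rightarrow> (nat \<Rightarrow> complex set) \<Rightarrow> (complex \<Rightarrow> real) \<Rightarrow> (complex \<Rightarrow> complex) set" where
  "hardy_space p \<Omega> \<Delta> \<nu> =
     {f \<in> CB_solutions \<Omega> \<nu>. bdd_above (range (\<lambda>n. boundary_Lp_norm p (\<Delta> n) f))}"

definition hardy_norm :: "real \<Rightarrow> (nat \<Rightarrow> complex set) \<Rightarrow> (complex \<Rightarrow> complex) \<Rightarrow> real" where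
  "hardy_norm p \<Delta> f = (SUP n. boundary_Lp_norm p (\<Delta> n) f)"

definition harmonic_on :: "complex set \<Rightarrow> (complex \<Rightarrow> real) \<Rightarrow> bool" where
  "harmonic_on \<Omega> u \<longleftrightarrow>
     C_k_on 2 \<Omega> u \<and>
     (\<forall>z\<in>\<Omega>. dir_deriv 1 (dir_deriv 1 u) z + dir_deriv \<i> (dir_deriv \<i> u) z = 0)"

definition harmonic_majorants ::
    "real \<Rightarrow> complex set \<Rightarrow> (complex \<Rightarrow> complex) \<Rightarrow> (complex \<Rightarrow> real) set" where
  "harmonic_majorants p \<Omega> f =
     {u. harmonic_on \<Omega> u \<and> (\<forall>z\<in>\<Omega>. 0 \<le> u z) \<and>
         (AE z in lebesgue_on \<Omega>. cmod (f z) powr p \<le> u z)}"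

definition majorant_norm :: "real \<Rightarrow> complex set \<Rightarrow> complex \<Rightarrow> (complex \<Rightarrow> complex) \<Rightarrow> real" where
  "majorant_norm p \<Omega> z0 f = (INF u\<in>harmonic_majorants p \<Omega> f. u z0 powr (1 / p))"

text \<open>The standing fact about the fixed sequence \<open>\<Delta>\<close>: for every coefficient, the space it defines
  is the space of solutions with a harmonic majorant, with equivalent norms. It is a condition on
  \<open>\<Delta>\<close>: curves of bounded length that pile up near a boundary point satisfy \<open>exhaustion\<close> but can
  fail to control a solution with a harmonic majorant.\<close>

definition majorant_characterization ::
    "real \<Rightarrow> complex set \<Rightarrow> (nat \<Rightarrow> complex set) \<Rightarrow> bool" where
  "majorant_characterization p \<Omega> \<Delta> \<longleftrightarrow>
     (\<exists>z0\<in>\<Omega>. \<forall>\<nu> \<kappa>.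
        (\<lambda>z. of_real (\<nu> z)) \<in> W_1_infinity \<Omega> \<and> continuous_on \<Omega> \<nu> \<and>
        \<kappa> < 1 \<and> (AE z in lebesgue_on \<Omega>. \<bar>\<nu> z\<bar> \<le> \<kappa>) \<longrightarrow>
          (\<forall>f\<in>CB_solutions \<Omega> \<nu>. f \<in> hardy_space p \<Omega> \<Delta> \<nu> \<longleftrightarrow> harmonic_majorants p \<Omega> f \<noteq> {}) \<and>
          (\<exists>C>0. \<forall>f\<in>hardy_space p \<Omega> \<Delta> \<nu>.
             hardy_norm p \<Delta> f \<le> C * majorant_norm p \<Omega> z0 f \<and>
             majorant_norm p \<Omega> z0 f \<le> C * hardy_norm p \<Delta> f))"

end

theory Submission
  imports Defs
begin

text \<open>A solution \<open>f\<close> belongs to the Hardy space exactly when \<open>|f|\<^sup>p\<close> has a harmonic majorant \<open>u\<close>, and its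
norm is comparable with the infimum over \<open>u\<close> of \<open>u z0 powr (1 / p)\<close>, where \<open>z0\<close> is a base point; call
it \<open>z1\<close> in \<open>\<Omega>1\<close> and \<open>z2\<close> in \<open>\<Omega>2\<close>. Precomposition with a holomorphic map preserves harmonicity, so
\<open>u \<circ> \<phi>\<close> is a majorant of \<open>|f \<circ> \<phi>|\<^sup>p\<close>. Its value at \<open>z1\<close> is \<open>u (\<phi> z1)\<close>, and Harnack's inequality
(\<open>harnack_two_points\<close>) bounds this by a constant times \<open>u z2\<close>, uniformly in \<open>u\<close>. Applied to the
difference of two elements, this gives a Lipschitz bound for the composition operator
(\<open>majorant_norm_compose_le\<close>).

What remains is that \<open>f \<circ> \<phi>\<close> solves the equation with coefficient \<open>\<nu> \<circ> \<phi>\<close>. If \<open>N\<close> is the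
distributional derivative \<open>dbar \<nu>\<close>, the equation for \<open>f\<close> says that the continuous function
\<open>f - \<nu> * cnj f\<close> has the locally bounded distributional derivative \<open>- N * cnj f\<close>. So both facts to
be transported, the one about \<open>\<nu>\<close> and the one about \<open>f\<close>, have the form \<open>dbar h = g\<close> with \<open>h\<close>
continuous and \<open>g\<close> locally bounded, and both follow from one chain rule,
\<open>dbar (h \<circ> \<phi>) = (g \<circ> \<phi>) * cnj (deriv \<phi>)\<close> (\<open>holomorphic_weak_dbar_compose\<close>).

The chain rule is proved by mollification in the target domain. The mollified functions are
continuously differentiable, satisfy the classical chain rule, and can be integrated by parts
against a test function in the source domain. They and their dbar derivatives stay bounded and
converge to \<open>h\<close> and \<open>g\<close> almost everywhere, by Lebesgue differentiation. A nonconstant holomorphic map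
pulls null sets back to null sets, so dominated convergence applies after composition. No change of
variables occurs, so the critical points of \<open>\<phi>\<close> and its failure to be injective enter only through
this statement about null sets. The hypothesis that \<open>\<phi>\<close> is in \<open>W_1_infinity\<close> makes \<open>deriv \<phi>\<close> bounded,
which keeps the new coefficient Lipschitz.\<close>

section \<open>Directional derivatives and functions of class C-k\<close>

lemma dir_deriv_eq:
  assumes "(f has_derivative f') (at z)" shows "dir_deriv e f z = f' e"
  using frechet_derivative_at[OF assms] by (simp add: dir_deriv_def)

lemma has_derivative_dir_deriv:
  assumes "f differentiable (at z)"
  shows "(f has_derivative (\<lambda>e. dir_deriv e f z)) (at z)"
  using assms by (simp add: dir_deriv_def frechet_derivative_works)

lemma dir_deriv_decompose:
  assumes "f differentiable (at z)"
  shows "dir_deriv e f z = Re e *\<^sub>R dir_deriv 1 f z + Im e *\<^sub>R dir_deriv \<i> f z"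
proof -
  interpret bounded_linear "\<lambda>e. dir_deriv e f z"
    using has_derivative_dir_deriv[OF assms] has_derivative_bounded_linear by blast
  have "e = Re e *\<^sub>R 1 + Im e *\<^sub>R \<i>" by (simp add: complex_eq_iff)
  then show ?thesis by (metis add scaleR)
qed

lemma has_derivative_compose_holomorphic:
  fixes F :: "complex \<Rightarrow> 'b::real_normed_vector"
  assumes \<phi>: "(\<phi> has_field_derivative \<phi>') (at z)" and F: "F differentiable (at (\<phi> z))"
  shows "((\<lambda>z. F (\<phi> z)) has_derivative
      (\<lambda>e. Re (\<phi>' * e) *\<^sub>R dir_deriv 1 F (\<phi> z) + Im (\<phi>' * e) *\<^sub>R dir_deriv \<i> F (\<phi> z))) (at z)"
proof -
  have "((\<lambda>z. F (\<phi> z)) has_derivative (\<lambda>e. dir_deriv (\<phi>' * e) F (\<phi> z))) (at z)"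
    using diff_chain_at[OF has_field_derivative_imp_has_derivative[OF \<phi>] has_derivative_dir_deriv[OF F]]
    by (simp add: o_def)
  also have "(\<lambda>e. dir_deriv (\<phi>' * e) F (\<phi> z)) =
      (\<lambda>e. Re (\<phi>' * e) *\<^sub>R dir_deriv 1 F (\<phi> z) + Im (\<phi>' * e) *\<^sub>R dir_deriv \<i> F (\<phi> z))"
    by (rule ext) (rule dir_deriv_decompose[OF F])
  finally show ?thesis .
qed

lemma dir_deriv_cong_open:
  assumes "open S" "z \<in> S" "\<And>w. w \<in> S \<Longrightarrow> f w = g w" "(f has_derivative D) (at z)"
  shows "g differentiable (at z)" "dir_deriv e g z = D e"
proof -
  have "(g has_derivative D) (at z)"
    by (rule has_derivative_transform_within_open[OF assms(4,1,2)]) (rule assms(3))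
  then show "g differentiable (at z)" "dir_deriv e g z = D e"
    by (rule differentiableI, rule dir_deriv_eq)
qed

lemma dir_deriv_scale:
  assumes "f differentiable (at z)"
  shows "dir_deriv (of_real t * e) f z = t *\<^sub>R dir_deriv e f z"
proof -
  interpret bounded_linear "\<lambda>e. dir_deriv e f z"
    using has_derivative_dir_deriv[OF assms] has_derivative_bounded_linear by blast
  show ?thesis using scaleR[of t e] by (simp add: scaleR_conv_of_real)
qed

lemma has_derivative_zero_off_closed:
  fixes f :: "complex \<Rightarrow> 'b::real_normed_vector"
  assumes "closed K" "\<And>w. w \<notin> K \<Longrightarrow> f w = 0" "z \<notin> K"
  shows "(f has_derivative (\<lambda>_. 0)) (at z)"
proof (rule has_derivative_transform_within_open)
  show "((\<lambda>_. 0) has_derivative (\<lambda>_. 0)) (at z)" by (rule has_derivative_const)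
  show "open (- K)" using assms(1) by (rule open_Compl)
  show "z \<in> - K" using assms(3) by simp
  show "0 = f w" if "w \<in> - K" for w using assms(2)[of w] that by simp
qed

lemma C_k_on_const: "C_k_on k UNIV (\<lambda>z. c)"
proof (induction k arbitrary: c)
  case (Suc k)
  have "dir_deriv e (\<lambda>z. c) = (\<lambda>z. 0)" for e :: complex
    by (rule ext) (simp add: dir_deriv_eq[OF has_derivative_const])
  then show ?case using Suc by simp
qed simp

lemma C_k_on_SucD: "C_k_on (Suc k) S f \<Longrightarrow> C_k_on k S f"
proof (induction k arbitrary: f)
  case 0
  then show ?case
    by (auto intro!: continuous_at_imp_continuous_on differentiable_imp_continuous_within)
next
  case (Suc k)
  then show ?case by (metis C_k_on.simps(2))
qed

lemma C_k_on_add: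
  assumes "C_k_on k UNIV f" "C_k_on k UNIV g"
  shows "C_k_on k UNIV (\<lambda>z. f z + g z)"
  using assms
proof (induction k arbitrary: f g)
  case 0 then show ?case by (auto intro: continuous_on_add)
next
  case (Suc k)
  have "dir_deriv e (\<lambda>z. f z + g z) = (\<lambda>z. dir_deriv e f z + dir_deriv e g z)" for e
    by (rule ext, rule dir_deriv_eq)
       (use Suc.prems in \<open>auto intro!: has_derivative_add has_derivative_dir_deriv\<close>)
  then show ?case using Suc by (auto intro: differentiable_add)
qed

lemma C_k_on_mult:
  fixes f g :: "complex \<Rightarrow> 'b::real_normed_algebra"
  assumes "C_k_on k UNIV f" "C_k_on k UNIV g"
  shows "C_k_on k UNIV (\<lambda>z. f z * g z)"
  using assms
proof (induction k arbitrary: f g)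
  case 0 then show ?case by (auto intro: continuous_on_mult)
next
  case (Suc k)
  have "dir_deriv e (\<lambda>z. f z * g z) = (\<lambda>z. f z * dir_deriv e g z + dir_deriv e f z * g z)" for e
    by (rule ext, rule dir_deriv_eq)
       (use Suc.prems in \<open>auto intro!: has_derivative_mult has_derivative_dir_deriv\<close>)
  moreover have "C_k_on k UNIV f" "C_k_on k UNIV g" using Suc.prems C_k_on_SucD by blast+
  ultimately show ?case using Suc by (auto intro!: differentiable_mult C_k_on_add Suc.IH)
qed

lemma C_k_on_bounded_linear:
  assumes "bounded_linear L" "C_k_on k UNIV f"
  shows "C_k_on k UNIV (\<lambda>z. L (f z))"
  using assms(2)
proof (induction k arbitrary: f)
  case 0 then show ?case
    by (auto intro: bounded_linear.continuous_on[OF assms(1)])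
next
  case (Suc k)
  have "dir_deriv e (\<lambda>z. L (f z)) = (\<lambda>z. L (dir_deriv e f z))" for e
    by (rule ext, rule dir_deriv_eq)
       (use Suc.prems in \<open>auto intro!: bounded_linear.has_derivative[OF assms(1)] has_derivative_dir_deriv\<close>)
  then show ?case using Suc
    by (auto intro!: differentiable_compose[OF bounded_linear_imp_differentiable[OF assms(1)]])
qed

section \<open>A smooth bump in a square\<close>

text \<open>The functions \<open>P (1 / x) * exp (- 1 / x)\<close>, extended by zero to \<open>x \<le> 0\<close>: a family that is closed
under differentiation, so that smoothness of its members needs a computation of first derivatives
only.\<close>

definition flat_exp :: "real poly \<Rightarrow> real \<Rightarrow> real" where
  "flat_exp P x = (if 0 < x then poly P (1 / x) * exp (- (1 / x)) else 0)"

lemma tendsto_poly_mult_exp_uminus: "((\<lambda>y. poly P y * exp (- y)) \<longlongrightarrow> (0::real)) at_top"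
proof -
  have "((\<lambda>y. \<Sum>i\<le>degree P. coeff P i * (y ^ i / exp y)) \<longlongrightarrow> (\<Sum>i\<le>degree P. coeff P i * 0)) at_top"
    by (intro tendsto_intros tendsto_power_div_exp_0)
  then show ?thesis
    by (simp add: poly_altdef sum_distrib_right exp_minus divide_inverse mult.assoc)
qed

text \<open>For \<open>x > 0\<close> the derivative of \<open>P (1 / x) * exp (- 1 / x)\<close> is \<open>(P - P') (1 / x) / x\<^sup>2\<close> times the
exponential, which is where the polynomial \<open>X\<^sup>2 * (P - P')\<close> comes from. At the origin every difference
quotient from the right is again of the form polynomial times exponential, and tends to zero.\<close>

lemma flat_exp_has_derivative:
  "(flat_exp P has_real_derivative flat_exp ([:0, 0, 1:] * (P - pderiv P)) x) (at x)"
proof -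
  consider "x < 0" | "x > 0" | "x = 0" by linarith
  then show ?thesis
  proof cases
    case 1
    have "((\<lambda>x. 0) has_real_derivative 0) (at x)" by simp
    then have "(flat_exp P has_real_derivative 0) (at x)"
      by (rule has_field_derivative_transform_within_open[of _ _ _ "{..<0}"])
         (use 1 in \<open>auto simp: flat_exp_def\<close>)
    with 1 show ?thesis by (simp add: flat_exp_def)
  next
    case 2
    have "((\<lambda>x. poly P (1 / x) * exp (- (1 / x))) has_real_derivative
            flat_exp ([:0, 0, 1:] * (P - pderiv P)) x) (at x)"
      using 2 by (auto intro!: derivative_eq_intros DERIV_chain2[OF poly_DERIV]
          simp: flat_exp_def field_simps power2_eq_square)
    then show ?thesis
      by (rule has_field_derivative_transform_within_open[of _ _ _ "{0<..}"])
         (use 2 in \<open>auto simp: flat_exp_def\<close>)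
  next
    case 3
    have "((\<lambda>h. flat_exp P h / h) \<longlongrightarrow> 0) (at_right 0)"
    proof -
      have "((\<lambda>h. poly (pCons 0 P) (inverse h) * exp (- inverse h)) \<longlongrightarrow> 0) (at_right (0::real))"
        by (rule filterlim_compose[OF tendsto_poly_mult_exp_uminus filterlim_inverse_at_top_right])
      then show ?thesis
        by (rule Lim_transform_eventually)
           (auto simp: eventually_at_filter flat_exp_def field_simps)
    qed
    moreover have "((\<lambda>h. flat_exp P h / h) \<longlongrightarrow> 0) (at_left 0)"
      by (rule Lim_transform_eventually[OF tendsto_const])
         (auto simp: eventually_at_filter flat_exp_def)
    ultimately have "((\<lambda>h. flat_exp P h / h) \<longlongrightarrow> 0) (at 0)"
      by (simp add: filterlim_at_split)
    with 3 show ?thesis by (simp add: DERIV_def flat_exp_def)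
  qed
qed

lemma C_k_on_flat_exp: "C_k_on k UNIV (\<lambda>z::complex. complex_of_real (flat_exp P (c \<bullet> z + d)))"
proof (induction k arbitrary: P)
  case 0
  have "continuous_on UNIV (flat_exp P)"
    using flat_exp_has_derivative[of P] DERIV_isCont continuous_at_imp_continuous_on by blast
  then show ?case
    by (auto intro!: continuous_intros continuous_on_compose2[of UNIV "flat_exp P"])
next
  case (Suc k)
  let ?Q = "[:0, 0, 1:] * (P - pderiv P)"
  have D: "((\<lambda>z. complex_of_real (flat_exp P (c \<bullet> z + d))) has_derivative
        (\<lambda>e. complex_of_real ((c \<bullet> e) * flat_exp ?Q (c \<bullet> z + d)))) (at z)" for z
  proof -
    have "((\<lambda>z. c \<bullet> z + d) has_derivative (\<lambda>e. c \<bullet> e)) (at z)"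
      by (auto intro!: derivative_eq_intros)
    from DERIV_compose_FDERIV[OF flat_exp_has_derivative this]
    have "((\<lambda>z. flat_exp P (c \<bullet> z + d)) has_derivative (\<lambda>e. (c \<bullet> e) * flat_exp ?Q (c \<bullet> z + d))) (at z)" .
    from bounded_linear.has_derivative[OF bounded_linear_of_real this] show ?thesis .
  qed
  have "dir_deriv e (\<lambda>z. complex_of_real (flat_exp P (c \<bullet> z + d))) =
      (\<lambda>z. of_real (c \<bullet> e) * complex_of_real (flat_exp ?Q (c \<bullet> z + d)))" for e
    by (rule ext) (simp add: dir_deriv_eq[OF D])
  moreover have "(\<lambda>z. complex_of_real (flat_exp P (c \<bullet> z + d))) differentiable at z" for z
    using D differentiableI by blast
  ultimately show ?case using Suc by (auto intro!: C_k_on_mult C_k_on_const)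
qed

text \<open>Each factor vanishes unless the corresponding coordinate of \<open>z\<close> lies in \<open>(0, h)\<close>. The support has
\<open>0\<close> as a corner because the Lebesgue differentiation theorem used below averages over squares whose
lower left corner is the point in question.\<close>

definition bump :: "real \<Rightarrow> complex \<Rightarrow> real" where
  "bump h z = flat_exp 1 (Re z / h) * flat_exp 1 (1 - Re z / h) *
              (flat_exp 1 (Im z / h) * flat_exp 1 (1 - Im z / h))"

lemma C_k_on_bump: "C_k_on k UNIV (\<lambda>w. complex_of_real (bump h (w - z)))"
proof -
  have eq: "(\<lambda>w. complex_of_real (bump h (w - z))) = (\<lambda>w.
     complex_of_real (flat_exp 1 (of_real (1/h) \<bullet> w + (- Re z / h))) *
     complex_of_real (flat_exp 1 (of_real (-1/h) \<bullet> w + (1 + Re z / h))) *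
     (complex_of_real (flat_exp 1 (Complex 0 (1/h) \<bullet> w + (- Im z / h))) *
      complex_of_real (flat_exp 1 (Complex 0 (-1/h) \<bullet> w + (1 + Im z / h)))))"
    by (rule ext) (simp add: bump_def inner_complex_def diff_divide_distrib algebra_simps)
  show ?thesis unfolding eq
    by (intro C_k_on_mult C_k_on_flat_exp)
qed

lemma flat_exp_1_bounds: "0 \<le> flat_exp 1 x" "flat_exp 1 x \<le> 1"
  by (auto simp: flat_exp_def)

lemma bump_bounds: "0 \<le> bump h z" "bump h z \<le> 1"
  unfolding bump_def by (auto intro!: mult_nonneg_nonneg mult_le_one flat_exp_1_bounds)

lemma bump_eq_0:
  assumes "0 < h" "z \<notin> cbox 0 (h *\<^sub>R One)" shows "bump h z = 0"
proof -
  have "Re z < 0 \<or> Re z > h \<or> Im z < 0 \<or> Im z > h"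
    using assms by (auto simp: in_cbox_complex_iff Basis_complex_def)
  then show ?thesis using assms(1) by (auto simp: bump_def flat_exp_def field_simps)
qed

text \<open>On the concentric square of half the side, all arguments of \<open>flat_exp 1\<close> are at least \<open>1 / 4\<close>. This
bounds the mass of the bump from below, hence the normalized kernel from above by a multiple of
\<open>1 / h\<^sup>2\<close>.\<close>

lemma bump_lower:
  assumes "0 < h" "z \<in> cbox ((h/4) *\<^sub>R One) ((3*h/4) *\<^sub>R One)"
  shows "exp (-16) \<le> bump h z"
proof -
  have *: "exp (-4) \<le> flat_exp 1 t" if "1/4 \<le> t" for t :: real
    using that by (auto simp: flat_exp_def field_simps)
  have b: "h/4 \<le> Re z" "Re z \<le> 3*h/4" "h/4 \<le> Im z" "Im z \<le> 3*h/4"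
    using assms by (auto simp: in_cbox_complex_iff Basis_complex_def)
  have "exp (-16) = (exp (-4) * exp (-4)) * (exp (-4) * exp (-4::real))"
    by (simp add: exp_add[symmetric])
  also have "\<dots> \<le> bump h z"
    unfolding bump_def using b assms(1)
    by (intro mult_mono *) (auto simp: field_simps intro!: mult_nonneg_nonneg flat_exp_1_bounds)
  finally show ?thesis .
qed

section \<open>Lebesgue integrals of functions with bounded support\<close>

lemma integrable_bounded_support:
  fixes F :: "complex \<Rightarrow> 'b::{banach, second_countable_topology}"
  assumes "F \<in> borel_measurable lebesgue" "compact K"
    and "\<And>z. norm (F z) \<le> B" "\<And>z. z \<notin> K \<Longrightarrow> F z = 0"
  shows "integrable lebesgue F"
proof (rule Bochner_Integration.integrable_bound[of lebesgue "\<lambda>z. B * indicator K z"])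
  have "emeasure lebesgue K < \<infinity>" "K \<in> sets lebesgue"
    using assms(2) fmeasurableD2 lmeasurable_compact[OF assms(2)]
    by (auto simp: fmeasurable_def)
  then show "integrable lebesgue (\<lambda>z. B * indicator K z)" by simp
  show "AE z in lebesgue. norm (F z) \<le> norm (B * indicator K z :: real)"
    using assms(3,4) by (intro AE_I2) (auto simp: indicator_def intro: order_trans[OF _ abs_ge_self])
qed fact

lemma continuous_imp_lebesgue_measurable:
  "continuous_on UNIV F \<Longrightarrow> F \<in> borel_measurable lebesgue"
  by (simp add: borel_measurable_continuous_onI measurable_completion)

lemma continuous_support_bounded:
  fixes F :: "complex \<Rightarrow> 'b::real_normed_vector"
  assumes "continuous_on UNIV F" "compact K" "\<And>z. z \<notin> K \<Longrightarrow> F z = 0"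
  obtains B where "\<And>z. norm (F z) \<le> B"
proof -
  have "compact (F ` K)" using assms by (meson compact_continuous_image continuous_on_subset subset_UNIV)
  then obtain B where B: "\<And>z. z \<in> K \<Longrightarrow> norm (F z) \<le> B"
    by (metis bounded_iff compact_imp_bounded imageI)
  have "norm (F z) \<le> max B 0" for z
  proof (cases "z \<in> K")
    case True
    from B[OF this] show ?thesis by linarith
  qed (simp add: assms(3))
  then show thesis using that by blast
qed

lemma integrable_continuous_support:
  fixes F :: "complex \<Rightarrow> 'b::{banach, second_countable_topology}"
  assumes "continuous_on UNIV F" "compact K" "\<And>z. z \<notin> K \<Longrightarrow> F z = 0"
  shows "integrable lebesgue F"
  using continuous_support_bounded[OF assms]
  by (metis assms continuous_imp_lebesgue_measurable integrable_bounded_support)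

text \<open>The measure \<open>lborel\<close> is translation invariant, and continuous functions have the same integral for
it and for its completion.\<close>

lemma integral_lebesgue_translate:
  fixes F :: "complex \<Rightarrow> 'b::{banach, second_countable_topology}"
  assumes "continuous_on UNIV F"
  shows "(LINT w|lebesgue. F (w + c)) = (LINT w|lebesgue. F w)"
proof -
  have m: "F \<in> borel_measurable borel" using assms by (rule borel_measurable_continuous_onI)
  have m': "(\<lambda>w. F (w + c)) \<in> borel_measurable borel"
    using assms by (intro borel_measurable_continuous_onI continuous_on_compose2[OF assms] continuous_intros) auto
  have "(LINT w|lborel. F w) = (LINT w|distr lborel borel ((+) c). F w)"
    by (simp add: lborel_distr_plus)
  also have "\<dots> = (LINT w|lborel. F (c + w))"
    by (rule integral_distr) (use m in auto)
  finally show ?thesis using m m' by (simp add: integral_completion add.commute)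
qed

lemma measurable_if_cbox:
  fixes G :: "complex \<Rightarrow> 'b::{topological_space,zero}"
  assumes "G \<in> borel_measurable lebesgue"
  shows "(\<lambda>w. if w \<in> cbox a b then G w else 0) \<in> borel_measurable lebesgue"
  using assms by (intro measurable_If_set) auto

lemma lebesgue_eq_integral_cbox:
  fixes F :: "complex \<Rightarrow> 'b::euclidean_space"
  assumes "integrable lebesgue F" "\<And>z. z \<notin> cbox a b \<Longrightarrow> F z = 0"
  shows "(LINT w|lebesgue. F w) = integral (cbox a b) F"
proof -
  have "(LINT w|lebesgue. F w) = integral UNIV F"
    using lebesgue_integral_eq_integral[of UNIV F] assms(1) by (simp add: lebesgue_on_UNIV_eq)
  also have "\<dots> = integral UNIV (\<lambda>x. if x \<in> cbox a b then F x else 0)"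
    using assms(2) by (intro arg_cong[where f = "integral UNIV"] ext) auto
  finally show ?thesis by (simp add: integral_restrict_UNIV)
qed

lemma continuous_bump: "continuous_on UNIV (bump h)"
proof -
  have "continuous_on UNIV (\<lambda>w. Re (complex_of_real (bump h (w - 0))))"
    using C_k_on_bump[of 0 h 0] by (auto intro: continuous_on_Re)
  then show ?thesis by simp
qed

section \<open>Mollification\<close>

definition kern :: "real \<Rightarrow> complex \<Rightarrow> real" where
  "kern h z = bump h z / (LINT w|lebesgue. bump h w)"

lemma kern_facts:
  assumes "0 < h"
  shows kern_nonneg: "0 \<le> kern h z"
    and kern_le: "kern h z \<le> 4 * exp 16 / h\<^sup>2"
    and kern_eq_0: "z \<notin> cbox 0 (h *\<^sub>R One) \<Longrightarrow> kern h z = 0"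
    and continuous_kern: "continuous_on UNIV (kern h)"
    and integral_kern: "(LINT w|lebesgue. kern h w) = 1"
    and C_k_on_kern: "C_k_on k UNIV (\<lambda>w. complex_of_real (kern h (w - x)))"
proof -
  let ?I = "LINT w|lebesgue. bump h w"
  let ?S = "cbox ((h/4) *\<^sub>R One) ((3*h/4) *\<^sub>R One) :: complex set"
  have int: "integrable lebesgue (bump h)"
    by (rule integrable_continuous_support[OF continuous_bump compact_cbox bump_eq_0[OF assms]])
  have S: "measure lebesgue ?S = (h/2)\<^sup>2"
    using assms by (simp add: content_cbox_if Basis_complex_def box_eq_empty power2_eq_square)
  have "exp (-16) * (h/2)\<^sup>2 = (LINT w|lebesgue. exp (-16) * indicator ?S w)"
    by (simp add: S)
  also have "\<dots> \<le> ?I"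
  proof (rule integral_mono)
    have "?S \<in> lmeasurable" by simp
    then show "integrable lebesgue (\<lambda>w. exp (-16::real) * indicator ?S w)"
      by (intro integrable_mult_right integrable_real_indicator) (auto simp: fmeasurable_def)
    show "exp (-16) * indicator ?S w \<le> bump h w" for w
      using bump_lower[OF assms, of w] bump_bounds(1)[of h w] by (auto simp: indicator_def)
  qed fact
  finally have I: "exp (-16) * (h/2)\<^sup>2 \<le> ?I" .
  have I0: "0 < exp (-16) * (h/2)\<^sup>2" using assms by simp
  with I have Ipos: "0 < ?I" by linarith
  show "0 \<le> kern h z" using Ipos bump_bounds(1)[of h z] by (simp add: kern_def)
  have "kern h z \<le> 1 / (exp (-16) * (h/2)\<^sup>2)"
    unfolding kern_def by (rule frac_le) (use I I0 bump_bounds in auto)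
  also have "\<dots> = 4 * exp 16 / h\<^sup>2" by (simp add: exp_minus field_simps)
  finally show "kern h z \<le> 4 * exp 16 / h\<^sup>2" .
  show "kern h z = 0" if "z \<notin> cbox 0 (h *\<^sub>R One)"
    using bump_eq_0[OF assms that] by (simp add: kern_def)
  show "continuous_on UNIV (kern h)"
    unfolding kern_def using Ipos by (intro continuous_intros continuous_bump) auto
  show "(LINT w|lebesgue. kern h w) = 1" using Ipos by (simp add: kern_def)
  have "(\<lambda>w. complex_of_real (kern h (w - x))) = (\<lambda>w. of_real (1 / ?I) * complex_of_real (bump h (w - x)))"
    by (rule ext) (simp add: kern_def)
  then show "C_k_on k UNIV (\<lambda>w. complex_of_real (kern h (w - x)))"
    by (simp only:) (intro C_k_on_mult C_k_on_const C_k_on_bump)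
qed

definition mollify :: "real \<Rightarrow> (complex \<Rightarrow> complex) \<Rightarrow> complex \<Rightarrow> complex" where
  "mollify h G x = (LINT w|lebesgue. G w * complex_of_real (kern h (w - x)))"

lemma shift_mem_cbox: "(w::complex) - x \<in> cbox 0 d \<longleftrightarrow> w \<in> cbox x (x + d)"
  by (auto simp: mem_box algebra_simps)

lemma kern_shift:
  assumes "0 < h"
  shows "integrable lebesgue (\<lambda>w. kern h (w - x))" "(LINT w|lebesgue. kern h (w - x)) = 1"
    "(\<lambda>w. kern h (w - x)) \<in> borel_measurable lebesgue"
    "w \<notin> cbox x (x + h *\<^sub>R One) \<Longrightarrow> kern h (w - x) = 0"
proof -
  have c: "continuous_on UNIV (\<lambda>w. kern h (w - x))"
    by (intro continuous_on_compose2[OF continuous_kern[OF assms]] continuous_intros) auto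
  have z: "w \<notin> cbox x (x + h *\<^sub>R One) \<Longrightarrow> kern h (w - x) = 0" for w
    by (rule kern_eq_0[OF assms]) (simp add: shift_mem_cbox)
  then show "w \<notin> cbox x (x + h *\<^sub>R One) \<Longrightarrow> kern h (w - x) = 0" .
  show "integrable lebesgue (\<lambda>w. kern h (w - x))"
    by (rule integrable_continuous_support[OF c compact_cbox z])
  show "(\<lambda>w. kern h (w - x)) \<in> borel_measurable lebesgue"
    by (rule continuous_imp_lebesgue_measurable[OF c])
  show "(LINT w|lebesgue. kern h (w - x)) = 1"
    using integral_lebesgue_translate[OF continuous_kern[OF assms], of "-x"] integral_kern[OF assms]
    by simp
qed

lemma mollify_integrable:
  assumes "0 < h" "G \<in> borel_measurable lebesgue" "\<And>w. cmod (G w) \<le> B"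
  shows "integrable lebesgue (\<lambda>w. G w * complex_of_real (kern h (w - x)))"
proof (rule Bochner_Integration.integrable_bound)
  show "integrable lebesgue (\<lambda>w. B * kern h (w - x))" using kern_shift(1)[OF assms(1)] by simp
  show "(\<lambda>w. G w * complex_of_real (kern h (w - x))) \<in> borel_measurable lebesgue"
    using assms(2) kern_shift(3)[OF assms(1), of x] by measurable
  show "AE w in lebesgue. norm (G w * complex_of_real (kern h (w - x))) \<le> norm (B * kern h (w - x))"
    using assms kern_nonneg[OF assms(1)]
    by (intro AE_I2) (auto simp: norm_mult abs_mult intro!: mult_right_mono order_trans[OF _ abs_ge_self])
qed

lemma mollify_bound:
  assumes "0 < h" "G \<in> borel_measurable lebesgue" "\<And>w. cmod (G w) \<le> B"
  shows "cmod (mollify h G x) \<le> B"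
proof -
  have "cmod (mollify h G x) \<le> (LINT w|lebesgue. B * kern h (w - x))"
    unfolding mollify_def
  proof (rule Bochner_Integration.integral_norm_bound_integral[OF mollify_integrable[OF assms]])
    show "integrable lebesgue (\<lambda>w. B * kern h (w - x))" using kern_shift(1)[OF assms(1)] by simp
  qed (use assms(3) kern_nonneg[OF assms(1)] in \<open>auto simp: norm_mult intro!: mult_right_mono\<close>)
  then show ?thesis using kern_shift(2)[OF assms(1)] by simp
qed

text \<open>The kernel has mass one and is at most a constant times the normalized indicator of the square, so
the error at \<open>x\<close> is at most a constant times the mean oscillation about \<open>G x\<close>.\<close>

lemma mollify_diff_le_average:
  assumes h: "0 < h" and G: "G \<in> borel_measurable lebesgue" "\<And>w. cmod (G w) \<le> B"
  shows "cmod (mollify h G x - G x) \<le>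
     4 * exp 16 * (integral (cbox x (x + h *\<^sub>R One)) (\<lambda>w. cmod (G w - G x)) / h\<^sup>2)"
proof -
  let ?Q = "cbox x (x + h *\<^sub>R One) :: complex set"
  let ?C = "4 * exp 16 / h\<^sup>2 :: real"
  let ?D = "\<lambda>w. if w \<in> ?Q then cmod (G w - G x) else 0"
  have "norm (?D w) \<le> 2 * B" for w
    using norm_triangle_ineq4[of "G w" "G x"] G(2)[of w] G(2)[of x] norm_ge_zero[of "G x"]
    by (smt (verit) norm_ge_zero real_norm_def)
  moreover have "?D \<in> borel_measurable lebesgue"
    by (rule measurable_if_cbox) (use G(1) in measurable)
  ultimately have D: "integrable lebesgue ?D"
    by (intro integrable_bounded_support[of _ ?Q "2 * B"]) auto
  have i: "integrable lebesgue (\<lambda>w. G x * complex_of_real (kern h (w - x)))"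
    using kern_shift(1)[OF h, of x] by (intro integrable_mult_right) simp
  have "mollify h G x - G x = (LINT w|lebesgue. G w * complex_of_real (kern h (w - x)) - G x * complex_of_real (kern h (w - x)))"
    unfolding mollify_def
    by (subst Bochner_Integration.integral_diff[OF mollify_integrable[OF assms] i])
       (simp add: kern_shift[OF h])
  also have "cmod \<dots> \<le> (LINT w|lebesgue. ?C * ?D w)"
  proof (rule Bochner_Integration.integral_norm_bound_integral)
    show "integrable lebesgue (\<lambda>w. G w * complex_of_real (kern h (w - x)) - G x * complex_of_real (kern h (w - x)))"
      by (intro Bochner_Integration.integrable_diff mollify_integrable[OF assms] i)
    show "integrable lebesgue (\<lambda>w. ?C * ?D w)"
      by (rule integrable_mult_right[OF D])
    fix w
    have "norm (G w * complex_of_real (kern h (w - x)) - G x * complex_of_real (kern h (w - x)))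
        = kern h (w - x) * cmod (G w - G x)"
      using kern_nonneg[OF h, of "w - x"]
      by (simp add: left_diff_distrib[symmetric] norm_mult mult.commute del: left_diff_distrib)
    also have "\<dots> \<le> ?C * ?D w"
    proof (cases "w \<in> ?Q")
      case True
      then show ?thesis using kern_le[OF h, of "w - x"] by (simp only: if_True) (rule mult_right_mono, auto)
    next
      case False
      then show ?thesis using kern_shift(4)[OF h False] by simp
    qed
    finally show "norm (G w * complex_of_real (kern h (w - x)) - G x * complex_of_real (kern h (w - x)))
        \<le> ?C * ?D w" .
  qed
  also have "\<dots> = ?C * (LINT w|lebesgue. ?D w)"
    by (rule integral_mult_right_zero)
  also have "(LINT w|lebesgue. ?D w) = integral ?Q ?D"
    by (rule lebesgue_eq_integral_cbox[OF D]) auto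
  also have "\<dots> = integral ?Q (\<lambda>w. cmod (G w - G x))"
    by (rule integral_cong) simp
  finally show ?thesis by simp
qed

lemma bounded_measurable_integrable_on_cbox:
  assumes G: "G \<in> borel_measurable lebesgue" "\<And>w::complex. norm (G w) \<le> B"
  shows "(G :: complex \<Rightarrow> 'b::euclidean_space) integrable_on cbox a b"
proof -
  have "(\<lambda>w. if w \<in> cbox a b then G w else 0) \<in> borel_measurable lebesgue"
    by (rule measurable_if_cbox) (use G(1) in measurable)
  then have "integrable lebesgue (\<lambda>w. if w \<in> cbox a b then G w else 0)"
    by (intro integrable_bounded_support[of _ "cbox a b" B])
       (auto simp: G(2) order_trans[OF norm_ge_zero G(2)])
  then have "(\<lambda>w. if w \<in> cbox a b then G w else 0) integrable_on UNIV"
    by (rule integrable_on_lebesgue)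
  then show ?thesis by (simp add: integrable_restrict_UNIV)
qed

lemma mollify_tendsto_at:
  assumes G: "G \<in> borel_measurable lebesgue" "\<And>w. cmod (G w) \<le> B"
    and avg: "\<And>e. 0 < e \<Longrightarrow> \<exists>d>0. \<forall>h. 0 < h \<and> h < d \<longrightarrow>
          integral (cbox x (x + h *\<^sub>R One)) (\<lambda>w. cmod (G w - G x)) / h\<^sup>2 < e"
  shows "(\<lambda>n. mollify (1 / real (Suc n)) G x) \<longlonglongrightarrow> G x"
proof (rule LIMSEQ_I)
  fix e :: real assume "0 < e"
  then have "0 < e / (4 * exp 16)" by simp
  from avg[OF this] obtain d where d: "d > 0" "\<And>h. 0 < h \<Longrightarrow> h < d \<Longrightarrow>
      integral (cbox x (x + h *\<^sub>R One)) (\<lambda>w. cmod (G w - G x)) / h\<^sup>2 < e / (4 * exp 16)" by blast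
  obtain N where N: "1 / real (Suc N) < d"
    using d(1) by (metis nat_approx_posE)
  show "\<exists>N. \<forall>n\<ge>N. norm (mollify (1 / real (Suc n)) G x - G x) < e"
  proof (intro exI allI impI)
    fix n assume "N \<le> n"
    then have "1 / real (Suc n) \<le> 1 / real (Suc N)" by (intro divide_left_mono) auto
    with N have lt: "1 / real (Suc n) < d" by linarith
    have "4 * exp 16 * (integral (cbox x (x + (1 / real (Suc n)) *\<^sub>R One)) (\<lambda>w. cmod (G w - G x)) / (1 / real (Suc n))\<^sup>2)
        < 4 * exp 16 * (e / (4 * exp 16))"
      using d(2)[OF _ lt] by (intro mult_strict_left_mono) auto
    then show "norm (mollify (1 / real (Suc n)) G x - G x) < e"
      using mollify_diff_le_average[OF _ G, of "1 / real (Suc n)" x] by force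
  qed
qed

lemma integral_const_square:
  fixes x :: complex and c :: real
  assumes "0 < h" shows "integral (cbox x (x + h *\<^sub>R One)) (\<lambda>w. c) = h\<^sup>2 * c"
proof -
  have "measure lborel (cbox x (x + h *\<^sub>R One)) = h\<^sup>2"
    using assms by (simp add: content_cbox_if Basis_complex_def box_eq_empty power2_eq_square inner_add_left)
  then show ?thesis by (simp only: integral_const real_scaleR_def)
qed

text \<open>Almost every point is a Lebesgue point: for each fixed \<open>q\<close> the averages of \<open>|G - q|\<close> converge to
\<open>|G x - q|\<close> off a null set, and it is enough to take \<open>q\<close> from a countable dense set and to choose
it close to \<open>G x\<close>.\<close>

lemma mollify_tendsto_AE:
  assumes G: "G \<in> borel_measurable lebesgue" "\<And>w. cmod (G w) \<le> B"
  obtains N where "negligible N"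
    "\<And>x. x \<notin> N \<Longrightarrow> (\<lambda>n. mollify (1 / real (Suc n)) G x) \<longlonglongrightarrow> G x"
proof -
  obtain D :: "complex set" where D: "countable D" "\<And>X. open X \<Longrightarrow> X \<noteq> {} \<Longrightarrow> \<exists>d\<in>D. d \<in> X"
    by (rule countable_dense_setE) blast
  let ?avg = "\<lambda>q x e h. norm (integral (cbox x (x + h *\<^sub>R One)) (\<lambda>w. cmod (G w - q)) /\<^sub>R h ^ DIM(complex)
      - cmod (G x - q)) < e"
  have "\<forall>q. \<exists>N. negligible N \<and> (\<forall>x e. x \<notin> N \<and> 0 < e \<longrightarrow> (\<exists>d>0. \<forall>h. 0 < h \<and> h < d \<longrightarrow> ?avg q x e h))"
  proof
    fix q
    have "(\<lambda>w. cmod (G w - q)) \<in> borel_measurable lebesgue" using G(1) by measurable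
    moreover have "norm (cmod (G w - q)) \<le> B + cmod q" for w
      using G(2)[of w] norm_triangle_ineq4[of "G w" q] by simp
    ultimately have "(\<lambda>w. cmod (G w - q)) integrable_on cbox a b" for a b
      by (rule bounded_measurable_integrable_on_cbox)
    from integrable_ccontinuous_explicit[OF this]
    show "\<exists>N. negligible N \<and> (\<forall>x e. x \<notin> N \<and> 0 < e \<longrightarrow> (\<exists>d>0. \<forall>h. 0 < h \<and> h < d \<longrightarrow> ?avg q x e h))"
      by metis
  qed
  then obtain N where N: "\<And>q. negligible (N q)"
    "\<And>q x e. x \<notin> N q \<Longrightarrow> 0 < e \<Longrightarrow> \<exists>d>0. \<forall>h. 0 < h \<and> h < d \<longrightarrow> ?avg q x e h"
    by metis
  show thesis
  proof (rule that)
    show "negligible (\<Union>q\<in>D. N q)"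
      using D(1) N(1) by (intro negligible_countable_Union) auto
    fix x assume x: "x \<notin> (\<Union>q\<in>D. N q)"
    show "(\<lambda>n. mollify (1 / real (Suc n)) G x) \<longlonglongrightarrow> G x"
    proof (rule mollify_tendsto_at[OF G])
      fix e :: real assume e: "0 < e"
      obtain q where q: "q \<in> D" "q \<in> ball (G x) (e/3)"
      proof -
        have "open (ball (G x) (e/3))" "ball (G x) (e/3) \<noteq> {}" using e by auto
        from D(2)[OF this] that show thesis by blast
      qed
      then have qx: "cmod (G x - q) < e / 3" by (simp add: dist_norm)
      obtain d where d: "d > 0" "\<And>h. 0 < h \<Longrightarrow> h < d \<Longrightarrow> ?avg q x (e/3) h"
      proof -
        have "x \<notin> N q" "0 < e/3" using x q(1) e by auto
        from N(2)[OF this] that show thesis by blast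
      qed
      show "\<exists>d>0. \<forall>h. 0 < h \<and> h < d \<longrightarrow>
          integral (cbox x (x + h *\<^sub>R One)) (\<lambda>w. cmod (G w - G x)) / h\<^sup>2 < e"
      proof (intro exI[of _ d] conjI allI impI d(1))
        fix h assume h: "0 < h \<and> h < d"
        let ?Q = "cbox x (x + h *\<^sub>R One)"
        have m: "(\<lambda>w. cmod (G w - c)) integrable_on ?Q" for c
        proof (rule bounded_measurable_integrable_on_cbox[where B = "B + cmod c"])
          show "(\<lambda>w. cmod (G w - c)) \<in> borel_measurable lebesgue" using G(1) by measurable
          show "norm (cmod (G w - c)) \<le> B + cmod c" for w
            using G(2)[of w] norm_triangle_ineq4[of "G w" c] by simp
        qed
        have "integral ?Q (\<lambda>w. cmod (G w - G x)) \<le> integral ?Q (\<lambda>w. cmod (G w - q) + cmod (G x - q))"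
        proof (rule integral_le)
          show "cmod (G w - G x) \<le> cmod (G w - q) + cmod (G x - q)" for w
            using norm_triangle_ineq4[of "G w - q" "G x - q"] by simp
          show "(\<lambda>w. cmod (G w - q) + cmod (G x - q)) integrable_on ?Q"
            by (rule integrable_add) (rule m, rule integrable_const)
        qed (rule m)
        also have "\<dots> = integral ?Q (\<lambda>w. cmod (G w - q)) + h\<^sup>2 * cmod (G x - q)"
          
        proof -
          have "integral ?Q (\<lambda>w. cmod (G w - q) + cmod (G x - q)) =
              integral ?Q (\<lambda>w. cmod (G w - q)) + integral ?Q (\<lambda>w. cmod (G x - q))"
            by (rule integral_add) (rule m, rule integrable_const)
          also have "integral ?Q (\<lambda>w. cmod (G x - q)) = h\<^sup>2 * cmod (G x - q)"
            by (rule integral_const_square) (use h in blast)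
          finally show ?thesis .
        qed
        finally have "integral ?Q (\<lambda>w. cmod (G w - G x)) / h\<^sup>2 \<le>
            (integral ?Q (\<lambda>w. cmod (G w - q)) + h\<^sup>2 * cmod (G x - q)) / h\<^sup>2"
          by (rule divide_right_mono) simp
        also have "\<dots> = integral ?Q (\<lambda>w. cmod (G w - q)) / h\<^sup>2 + cmod (G x - q)"
          using h by (simp add: add_divide_distrib)
        finally have "integral ?Q (\<lambda>w. cmod (G w - G x)) / h\<^sup>2 \<le>
            integral ?Q (\<lambda>w. cmod (G w - q)) / h\<^sup>2 + cmod (G x - q)" .
        moreover have "norm (integral ?Q (\<lambda>w. cmod (G w - q)) / h\<^sup>2 - cmod (G x - q)) < e / 3"
          using d(2)[of h] h
          by (simp only: DIM_complex real_scaleR_def divide_inverse mult.commute simp_thms)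
        ultimately show "integral ?Q (\<lambda>w. cmod (G w - G x)) / h\<^sup>2 < e"
          using qx e unfolding real_norm_def by linarith
      qed
    qed
  qed
qed

section \<open>Integration by parts against test functions\<close>

abbreviation supp :: "(complex \<Rightarrow> complex) \<Rightarrow> complex set" where
  "supp \<psi> \<equiv> closure {z. \<psi> z \<noteq> 0}"

lemma test_functionsD:
  assumes "\<psi> \<in> test_functions U"
  shows "compact (supp \<psi>)" "supp \<psi> \<subseteq> U" "z \<notin> supp \<psi> \<Longrightarrow> \<psi> z = 0"
    "z \<notin> supp \<psi> \<Longrightarrow> dir_deriv e \<psi> z = 0" "\<psi> differentiable (at z)"
    "continuous_on UNIV \<psi>" "e \<in> {1, \<i>} \<Longrightarrow> continuous_on UNIV (dir_deriv e \<psi>)"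
proof -
  show "compact (supp \<psi>)" "supp \<psi> \<subseteq> U" using assms unfolding test_functions_def by blast+
  have C: "C_k_on k UNIV \<psi>" for k using assms unfolding test_functions_def by blast
  have z: "\<psi> z = 0" if "z \<notin> supp \<psi>" for z
  proof -
    have "z \<notin> {z. \<psi> z \<noteq> 0}" using that closure_subset[of "{z. \<psi> z \<noteq> 0}"] by (meson subsetD)
    then show ?thesis by (simp only: mem_Collect_eq not_not)
  qed
  then show "z \<notin> supp \<psi> \<Longrightarrow> \<psi> z = 0" .
  show "dir_deriv e \<psi> z = 0" if "z \<notin> supp \<psi>"
  proof -
    have "(\<psi> has_derivative (\<lambda>_. 0)) (at z)"
      by (rule has_derivative_zero_off_closed[OF closed_closure _ that]) (rule z)
    from dir_deriv_eq[OF this] show ?thesis .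
  qed
  show "\<psi> differentiable (at z)" using C[of "Suc 0"] by simp
  show "continuous_on UNIV \<psi>" using C[of 0] by simp
  show "e \<in> {1, \<i>} \<Longrightarrow> continuous_on UNIV (dir_deriv e \<psi>)"
    using C[of "Suc 0"] by auto
qed

lemma continuous_on_mult_support:
  fixes F g :: "complex \<Rightarrow> complex"
  assumes "open U" "continuous_on U F" "closed K" "K \<subseteq> U"
    and "continuous_on U g" "\<And>z. z \<notin> K \<Longrightarrow> g z = 0"
  shows "continuous_on UNIV (\<lambda>z. F z * g z)"
proof -
  have "continuous_on (U \<union> - K) (\<lambda>z. F z * g z)"
  proof (rule continuous_on_open_Un)
    show "continuous_on U (\<lambda>z. F z * g z)"
      by (intro continuous_intros assms)
    have "continuous_on (-K) (\<lambda>z. 0::complex)" by simp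
    then show "continuous_on (-K) (\<lambda>z. F z * g z)"
      by (rule continuous_on_eq) (use assms(6) in auto)
  qed (use assms in auto)
  moreover have "U \<union> - K = UNIV" using assms(4) by auto
  ultimately show ?thesis by simp
qed

lemma integral_lebesgue_on_support:
  fixes f :: "complex \<Rightarrow> complex"
  assumes "open U" "\<And>z. z \<notin> U \<Longrightarrow> f z = 0"
  shows "(LINT z|lebesgue_on U. f z) = (LINT z|lebesgue. f z)"
proof -
  have "(LINT z|lebesgue_on U. f z) = (LINT z|lebesgue. indicator U z *\<^sub>R f z)"
    by (rule integral_restrict_space) (use assms(1) in auto)
  also have "(\<lambda>z. indicator U z *\<^sub>R f z) = f"
    using assms(2) by (auto simp: indicator_def fun_eq_iff)
  finally show ?thesis .
qed

lemma increment_le_dir_deriv: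
  fixes P :: "complex \<Rightarrow> complex"
  assumes diff: "\<And>z. P differentiable (at z)" and B: "\<And>z. cmod (dir_deriv e P z) \<le> B" and "0 \<le> s"
  shows "cmod (P (w + of_real s * e) - P w) \<le> B * s"
proof -
  have "norm (P (w + of_real s * e) - P (w + of_real 0 * e)) \<le> B * norm (s - 0)"
  proof (rule differentiable_bound[of UNIV "\<lambda>s. P (w + of_real s * e)" "\<lambda>s h. dir_deriv (of_real h * e) P (w + of_real s * e)"])
    fix s :: real
    have i: "((\<lambda>s. w + of_real s * e) has_derivative (\<lambda>h. of_real h * e)) (at s)"
      by (auto intro!: derivative_eq_intros)
    show "((\<lambda>s. P (w + of_real s * e)) has_derivative (\<lambda>h. dir_deriv (of_real h * e) P (w + of_real s * e))) (at s within UNIV)"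
      using diff_chain_at[OF i has_derivative_dir_deriv[OF diff]] by (simp add: o_def)
    show "onorm (\<lambda>h. dir_deriv (of_real h * e) P (w + of_real s * e)) \<le> B"
    proof (rule onorm_bound)
      show "norm (dir_deriv (of_real x * e) P (w + of_real s * e)) \<le> B * norm x" for x :: real
        unfolding dir_deriv_scale[OF diff] norm_scaleR real_norm_def
        using mult_right_mono[OF B abs_ge_zero[of x]] by (simp only: mult.commute)
      show "0 \<le> B" using order_trans[OF norm_ge_zero B] .
    qed
  qed auto
  then show ?thesis using \<open>0 \<le> s\<close> by simp
qed

lemma difference_quotient_tendsto:
  fixes P :: "complex \<Rightarrow> complex"
  assumes diff: "P differentiable (at w)" and e: "cmod e = 1" and t: "t \<longlonglongrightarrow> 0" "\<And>n. (0::real) < t n"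
  shows "(\<lambda>n. (P (w + of_real (t n) * e) - P w) / of_real (t n)) \<longlonglongrightarrow> dir_deriv e P w"
proof -
  let ?a = "\<lambda>n. (P (w + of_real (t n) * e) - P w) / of_real (t n)"
  have "(\<lambda>h. norm (P (w + h) - P w - dir_deriv h P w) / norm h) \<midarrow>0\<rightarrow> 0"
    using has_derivative_dir_deriv[OF diff] by (simp add: has_derivative_at)
  moreover have "filterlim (\<lambda>n. of_real (t n) * e) (at 0) sequentially"
  proof (rule filterlim_atI)
    have "(\<lambda>n. of_real (t n) * e) \<longlonglongrightarrow> of_real 0 * e" by (intro tendsto_intros t)
    then show "(\<lambda>n. of_real (t n) * e) \<longlonglongrightarrow> 0" by simp
    have "e \<noteq> 0" using e by auto
    then have "of_real (t n) * e \<noteq> 0" for n using t(2)[of n] by simp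
    then show "\<forall>\<^sub>F n in sequentially. of_real (t n) * e \<noteq> 0" by simp
  qed
  ultimately have "(\<lambda>n. norm (P (w + of_real (t n) * e) - P w - dir_deriv (of_real (t n) * e) P w) / norm (of_real (t n) * e)) \<longlonglongrightarrow> 0"
    by (rule filterlim_compose)
  moreover have "norm (P (w + of_real (t n) * e) - P w - dir_deriv (of_real (t n) * e) P w) / norm (of_real (t n) * e)
      = norm (?a n - dir_deriv e P w)" for n
  proof -
    have "norm (of_real (t n) * e) = cmod (of_real (t n))" using e by (simp add: norm_mult)
    moreover have "?a n - dir_deriv e P w = (P (w + of_real (t n) * e) - P w - of_real (t n) * dir_deriv e P w) / of_real (t n)"
      using t(2)[of n] by (simp add: diff_divide_distrib)
    ultimately show ?thesis by (simp only: dir_deriv_scale[OF diff] norm_divide scaleR_conv_of_real)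
  qed
  ultimately have "(\<lambda>n. norm (?a n - dir_deriv e P w)) \<longlonglongrightarrow> 0" by (simp only:)
  then have "(\<lambda>n. ?a n - dir_deriv e P w) \<longlonglongrightarrow> 0" by (rule tendsto_norm_zero_cancel)
  then show ?thesis by (rule LIM_zero_cancel)
qed

text \<open>Translation invariance makes the integral of each difference quotient vanish, and the difference
quotients converge boundedly to the directional derivative. This replaces the iterated integration
that Fubini's theorem would require.\<close>

lemma integral_dir_deriv_eq_0:
  fixes P :: "complex \<Rightarrow> complex"
  assumes K: "compact K" "\<And>z. z \<notin> K \<Longrightarrow> P z = 0"
    and diff: "\<And>z. P differentiable (at z)" and cont: "continuous_on UNIV (dir_deriv e P)"
    and e: "cmod e = 1"
  shows "(LINT z|lebesgue. dir_deriv e P z) = 0"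
proof -
  have D0: "dir_deriv e P z = 0" if "z \<notin> K" for z
    by (rule dir_deriv_eq[OF has_derivative_zero_off_closed[OF compact_imp_closed[OF K(1)] K(2) that]])
  have Pc: "continuous_on UNIV P"
    using diff by (auto intro!: continuous_at_imp_continuous_on differentiable_imp_continuous_within)
  obtain B where B: "\<And>z. cmod (dir_deriv e P z) \<le> B"
    using continuous_support_bounded[OF cont K(1) D0] by blast
  have Pint: "integrable lebesgue P" by (rule integrable_continuous_support[OF Pc K])
  obtain r where r: "\<And>z. z \<in> K \<Longrightarrow> cmod z \<le> r"
    using compact_imp_bounded[OF K(1)] by (auto simp: bounded_iff)
  define t where "t n = 1 / real (Suc n)" for n
  define a where "a n w = (P (w + of_real (t n) * e) - P w) / of_real (t n)" for n w
  have t: "0 < t n" "t n \<le> 1" for n by (auto simp: t_def)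
  have t0: "t \<longlonglongrightarrow> 0" unfolding t_def by (rule lim_1_over_n[THEN LIMSEQ_Suc])
  have sh: "continuous_on UNIV (\<lambda>w. P (w + of_real (t n) * e))" for n
    by (rule continuous_on_compose2[OF Pc]) (auto intro: continuous_intros)
  have Ia: "(LINT w|lebesgue. a n w) = 0" for n
  proof -
    have "compact ((\<lambda>z. z - of_real (t n) * e) ` K)"
      by (intro compact_continuous_image continuous_intros K)
    moreover have "P (z + of_real (t n) * e) = 0" if z: "z \<notin> (\<lambda>z. z - of_real (t n) * e) ` K" for z
    proof (rule K(2), rule notI)
      assume "z + of_real (t n) * e \<in> K"
      then have "(z + of_real (t n) * e) - of_real (t n) * e \<in> (\<lambda>z. z - of_real (t n) * e) ` K"
        by (rule imageI)
      with z show False by simp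
    qed
    ultimately have "integrable lebesgue (\<lambda>w. P (w + of_real (t n) * e))"
      by (rule integrable_continuous_support[OF sh])
    then have "(LINT w|lebesgue. P (w + of_real (t n) * e) - P w) = 0"
      using integral_lebesgue_translate[OF Pc, of "of_real (t n) * e"] Pint by simp
    then show ?thesis unfolding a_def by simp
  qed
  have "(\<lambda>n. LINT w|lebesgue. a n w) \<longlonglongrightarrow> (LINT z|lebesgue. dir_deriv e P z)"
  proof (rule integral_dominated_convergence)
    show "dir_deriv e P \<in> borel_measurable lebesgue"
      by (rule continuous_imp_lebesgue_measurable[OF cont])
    show "a n \<in> borel_measurable lebesgue" for n
      unfolding a_def using t(1)[of n]
      by (intro continuous_imp_lebesgue_measurable continuous_on_divide continuous_on_diff sh Pc) auto
    have "cball 0 (r + 1) \<in> lmeasurable" for r :: real by simp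
    then show "integrable lebesgue (\<lambda>w::complex. B * indicator (cball 0 (r + 1)) w)"
      by (intro integrable_mult_right integrable_real_indicator) (auto simp: fmeasurable_def)
    show "AE w in lebesgue. norm (a n w) \<le> B * indicator (cball 0 (r + 1)) w" for n
    proof (rule AE_I2)
      fix w
      show "norm (a n w) \<le> B * indicator (cball 0 (r + 1)) w"
      proof (cases "w \<in> cball 0 (r + 1)")
        case True
        have "norm (a n w) = cmod (P (w + of_real (t n) * e) - P w) / t n"
          unfolding a_def using t(1)[of n] by (simp add: norm_divide)
        also have "\<dots> \<le> B"
          using increment_le_dir_deriv[OF diff B, of "t n" w] t(1)[of n] by (simp add: divide_le_eq)
        finally show ?thesis using True by simp
      next
        case False
        then have w: "cmod w > r + 1" by simp
        have "cmod w \<le> cmod (w + of_real (t n) * e) + cmod (of_real (t n) * e)"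
          using norm_triangle_ineq4[of "w + of_real (t n) * e" "of_real (t n) * e"] by simp
        moreover have "cmod (of_real (t n) * e) \<le> 1" using t[of n] e by (simp add: norm_mult)
        ultimately have "cmod (w + of_real (t n) * e) > r" "cmod w > r" using w by linarith+
        then have "P (w + of_real (t n) * e) = 0" "P w = 0"
          using r K(2) by (meson leD)+
        then show ?thesis using False by (simp add: a_def)
      qed
    qed
    show "AE w in lebesgue. (\<lambda>n. a n w) \<longlonglongrightarrow> dir_deriv e P w"
      unfolding a_def by (intro AE_I2 difference_quotient_tendsto diff e t0 t)
  qed
  then show "(LINT z|lebesgue. dir_deriv e P z) = 0"
    using Ia by (simp add: LIMSEQ_const_iff)
qed

text \<open>The product \<open>F * \<psi>\<close> extends by zero to a differentiable function with compact support on the whole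
plane, and its directional derivative has integral zero.\<close>

lemma integral_by_parts_test:
  fixes F :: "complex \<Rightarrow> complex"
  assumes "open U" and diff: "\<And>z. z \<in> U \<Longrightarrow> F differentiable (at z)"
    and e: "e \<in> {1, \<i>}" and cont: "continuous_on U (dir_deriv e F)" and \<psi>: "\<psi> \<in> test_functions U"
  shows "(LINT z|lebesgue_on U. F z * dir_deriv e \<psi> z) = - (LINT z|lebesgue_on U. dir_deriv e F z * \<psi> z)"
proof -
  let ?K = "supp \<psi>"
  note K = test_functionsD[OF \<psi>]
  have K': "closed ?K" by (rule closed_closure)
  have z1: "c * \<psi> w = 0" if "w \<notin> ?K" for c w unfolding K(3)[OF that] by (rule mult_zero_right)
  have z2: "c * dir_deriv e \<psi> w = 0" if "w \<notin> ?K" for c w unfolding K(4)[OF that] by (rule mult_zero_right)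
  have Fc: "continuous_on U F"
    using diff by (meson continuous_at_imp_continuous_on differentiable_imp_continuous_within)
  have c1: "continuous_on UNIV (\<lambda>z. F z * dir_deriv e \<psi> z)"
    by (rule continuous_on_mult_support[OF assms(1) Fc K' K(2)])
       (rule continuous_on_subset[OF K(7)[OF e]], simp, rule K(4))
  have c2: "continuous_on UNIV (\<lambda>z. dir_deriv e F z * \<psi> z)"
    by (rule continuous_on_mult_support[OF assms(1) cont K' K(2)])
       (rule continuous_on_subset[OF K(6)], simp, rule K(3))
  let ?P = "\<lambda>z. F z * \<psi> z"
  let ?D = "\<lambda>z. F z * dir_deriv e \<psi> z + dir_deriv e F z * \<psi> z"
  have D: "?P differentiable (at z) \<and> dir_deriv e ?P z = ?D z" for z
  proof (cases "z \<in> U")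
    case True
    have "(?P has_derivative (\<lambda>e. F z * dir_deriv e \<psi> z + dir_deriv e F z * \<psi> z)) (at z)"
      by (rule has_derivative_mult[OF has_derivative_dir_deriv[OF diff[OF True]] has_derivative_dir_deriv[OF K(5)]])
    from differentiableI[OF this] dir_deriv_eq[OF this] show ?thesis by (rule conjI)
  next
    case False
    then have z: "z \<notin> ?K" using K(2) by auto
    have "(?P has_derivative (\<lambda>_. 0)) (at z)"
      by (rule has_derivative_zero_off_closed[OF K' _ z]) (rule z1)
    from differentiableI[OF this] dir_deriv_eq[OF this] show ?thesis
      by (simp only: K(3)[OF z] K(4)[OF z]) simp
  qed
  have De: "dir_deriv e ?P = ?D" using D by (intro ext) blast
  have diffP: "?P differentiable (at z)" for z using D by blast
  have contP: "continuous_on UNIV (dir_deriv e ?P)" unfolding De by (intro continuous_on_add c1 c2)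
  have "(LINT z|lebesgue. dir_deriv e ?P z) = 0"
    by (rule integral_dir_deriv_eq_0[OF K(1) _ diffP contP]) (rule z1, assumption, use e in auto)
  moreover have "integrable lebesgue (\<lambda>z. F z * dir_deriv e \<psi> z)"
    by (rule integrable_continuous_support[OF c1 K(1)]) (rule z2)
  moreover have "integrable lebesgue (\<lambda>z. dir_deriv e F z * \<psi> z)"
    by (rule integrable_continuous_support[OF c2 K(1)]) (rule z1)
  ultimately have "(LINT z|lebesgue. F z * dir_deriv e \<psi> z) + (LINT z|lebesgue. dir_deriv e F z * \<psi> z) = 0"
    unfolding De by simp
  moreover have "(LINT z|lebesgue_on U. F z * dir_deriv e \<psi> z) = (LINT z|lebesgue. F z * dir_deriv e \<psi> z)"
    by (rule integral_lebesgue_on_support) (rule assms(1), rule z2, use K(2) in blast)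
  moreover have "(LINT z|lebesgue_on U. dir_deriv e F z * \<psi> z) = (LINT z|lebesgue. dir_deriv e F z * \<psi> z)"
    by (rule integral_lebesgue_on_support) (rule assms(1), rule z1, use K(2) in blast)
  ultimately show ?thesis by (simp add: eq_neg_iff_add_eq_0)
qed

section \<open>Differentiable mollifications\<close>

lemma kern_test_function:
  assumes "0 < h" "cbox x (x + h *\<^sub>R One) \<subseteq> U"
  shows "(\<lambda>w. complex_of_real (kern h (w - x))) \<in> test_functions U"
proof -
  let ?S = "closure {w. complex_of_real (kern h (w - x)) \<noteq> 0}"
  have "{w. complex_of_real (kern h (w - x)) \<noteq> 0} \<subseteq> cbox x (x + h *\<^sub>R One)"
    using kern_shift(4)[OF assms(1)] by fastforce
  then have S: "?S \<subseteq> cbox x (x + h *\<^sub>R One)"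
    by (rule closure_minimal) (rule closed_cbox)
  then have "compact ?S"
    unfolding compact_eq_bounded_closed using bounded_subset[OF bounded_cbox] closed_closure by blast
  then show ?thesis unfolding test_functions_def
    using S assms(2) C_k_on_kern[OF assms(1)] by blast
qed

lemma square_subset_ball:
  assumes "0 < h" "2 * h < r" shows "cbox x (x + h *\<^sub>R One) \<subseteq> ball (x::complex) r"
proof
  fix w assume "w \<in> cbox x (x + h *\<^sub>R One)"
  then have "\<bar>Re (w - x)\<bar> \<le> h" "\<bar>Im (w - x)\<bar> \<le> h"
    by (auto simp: in_cbox_complex_iff Basis_complex_def)
  then have "cmod (w - x) < r" using cmod_le[of "w - x"] assms by linarith
  then show "w \<in> ball x r" by (simp add: dist_norm norm_minus_commute)
qed

lemma eventually_square_subset: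
  assumes "0 < r"
  shows "\<forall>\<^sub>F n in sequentially. \<forall>x. cbox x (x + (1 / real (Suc n)) *\<^sub>R One) \<subseteq> ball (x::complex) r"
proof -
  have "(\<lambda>n. 2 * (1 / real (Suc n))) \<longlonglongrightarrow> 2 * 0"
    by (intro tendsto_intros lim_1_over_n[THEN LIMSEQ_Suc])
  then have "\<forall>\<^sub>F n in sequentially. 2 * (1 / real (Suc n)) < r"
    using assms by (intro order_tendstoD(2)) auto
  then show ?thesis
    by eventually_elim (use square_subset_ball in auto)
qed

text \<open>Differentiation under the integral sign needs a domain of integration that does not move with the
parameter: one box serves all parameters near \<open>z0\<close>.\<close>

lemma convolution_eq_integral:
  fixes H :: "complex \<Rightarrow> complex"
  assumes "continuous_on UNIV H"
  shows "\<exists>A B. \<forall>Q z. continuous_on UNIV Q \<longrightarrow> (\<forall>w. w \<notin> cbox a b \<longrightarrow> Q w = 0) \<longrightarrow> z \<in> ball z0 1 \<longrightarrow>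
    (LINT w|lebesgue. H w * Q (w - z)) = integral (cbox A B) (\<lambda>w. H w * Q (w - z))"
proof -
  let ?S = "(\<lambda>(x, y). x + y) ` (cbox a b \<times> ball z0 1)"
  have "bounded ?S" by (intro bounded_plus bounded_cbox bounded_ball)
  then obtain A where A: "?S \<subseteq> cbox (-A) A" by (rule bounded_subset_cbox_symmetric)
  show ?thesis
  proof (intro exI allI impI)
    fix Q :: "complex \<Rightarrow> complex" and z
    assume Q: "continuous_on UNIV Q" "\<forall>w. w \<notin> cbox a b \<longrightarrow> Q w = 0" "z \<in> ball z0 1"
    have 0: "H w * Q (w - z) = 0" if "w \<notin> cbox (-A) A" for w
    proof -
      have "w - z \<notin> cbox a b"
      proof
        assume "w - z \<in> cbox a b"
        then have "(w - z) + z \<in> ?S" using Q(3) by (intro image_eqI[of _ _ "(w - z, z)"]) auto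
        with A that show False by auto
      qed
      then show ?thesis using Q(2) by simp
    qed
    have "continuous_on UNIV (\<lambda>w. H w * Q (w - z))"
      by (intro continuous_intros assms continuous_on_compose2[OF Q(1)]) auto
    from integrable_continuous_support[OF this compact_cbox 0]
    show "(LINT w|lebesgue. H w * Q (w - z)) = integral (cbox (-A) A) (\<lambda>w. H w * Q (w - z))"
      using 0 by (rule lebesgue_eq_integral_cbox)
  qed
qed

lemma continuous_convolution:
  fixes H Q :: "complex \<Rightarrow> complex"
  assumes "continuous_on UNIV H" "continuous_on UNIV Q" "\<And>w. w \<notin> cbox a b \<Longrightarrow> Q w = 0"
  shows "continuous_on UNIV (\<lambda>z. LINT w|lebesgue. H w * Q (w - z))"
proof (rule continuous_at_imp_continuous_on, rule ballI)
  fix z0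
  obtain A B where "\<forall>Q z. continuous_on UNIV Q \<longrightarrow> (\<forall>w. w \<notin> cbox a b \<longrightarrow> Q w = 0) \<longrightarrow> z \<in> ball z0 1 \<longrightarrow>
    (LINT w|lebesgue. H w * Q (w - z)) = integral (cbox A B) (\<lambda>w. H w * Q (w - z))"
    using convolution_eq_integral[OF assms(1), of a b z0] by (elim exE)
  note AB = this[rule_format]
  have "continuous_on (ball z0 1) (\<lambda>z. integral (cbox A B) (\<lambda>w. H w * Q (w - z)))"
    by (rule integral_continuous_on_param, unfold split_beta,
        intro continuous_intros continuous_on_compose2[OF assms(1)] continuous_on_compose2[OF assms(2)]) auto
  then have "continuous_on (ball z0 1) (\<lambda>z. LINT w|lebesgue. H w * Q (w - z))"
    by (rule continuous_on_eq) (simp add: AB[OF assms(2,3)])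
  then show "isCont (\<lambda>z. LINT w|lebesgue. H w * Q (w - z)) z0"
    by (simp add: continuous_on_eq_continuous_at)
qed

text \<open>The derivative falls on the kernel \<open>Q\<close>, which is the smooth factor; \<open>H\<close> is only continuous.\<close>

lemma has_derivative_convolution:
  fixes H Q :: "complex \<Rightarrow> complex"
  assumes H: "continuous_on UNIV H" and Q: "C_k_on (Suc 0) UNIV Q" "\<And>w. w \<notin> cbox a b \<Longrightarrow> Q w = 0"
  shows "\<exists>D. ((\<lambda>z. LINT w|lebesgue. H w * Q (w - z)) has_derivative D) (at z0) \<and>
    (\<forall>e\<in>{1, \<i>}. D e = - (LINT w|lebesgue. H w * dir_deriv e Q (w - z0)))"
proof -
  have diff: "Q differentiable (at w)" and Qc: "continuous_on UNIV Q"
    and Dc: "e \<in> {1, \<i>} \<Longrightarrow> continuous_on UNIV (dir_deriv e Q)" for w e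
    using Q(1) C_k_on_SucD[OF Q(1)] by auto
  have D0: "dir_deriv e Q w = 0" if "w \<notin> cbox a b" for w e
    by (rule dir_deriv_eq[OF has_derivative_zero_off_closed[OF closed_cbox Q(2) that]])
  obtain A B where "\<forall>Q z. continuous_on UNIV Q \<longrightarrow> (\<forall>w. w \<notin> cbox a b \<longrightarrow> Q w = 0) \<longrightarrow> z \<in> ball z0 1 \<longrightarrow>
    (LINT w|lebesgue. H w * Q (w - z)) = integral (cbox A B) (\<lambda>w. H w * Q (w - z))"
    using convolution_eq_integral[OF H, of a b z0] by (elim exE)
  note AB = this[rule_format]
  define L where "L z w e = - (H w * (Re e *\<^sub>R dir_deriv 1 Q (w - z) + Im e *\<^sub>R dir_deriv \<i> Q (w - z)))" for z w e
  define fx where "fx z w = Blinfun (L z w)" for z w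
  have "bounded_linear (L z w)" for z w
    unfolding L_def
    by (intro bounded_linear_minus bounded_linear_const_mult bounded_linear_add
        bounded_linear_scaleR_const bounded_linear_Re bounded_linear_Im)
  then have fx: "blinfun_apply (fx z w) = L z w" for z w
    by (simp add: fx_def bounded_linear_Blinfun_apply)
  have contL: "continuous_on (U \<times> cbox A B) (\<lambda>(z, w). L z w e)" for U e
    unfolding L_def split_beta
    by (intro continuous_intros continuous_on_compose2[OF H] continuous_on_compose2[OF Dc]) auto
  have cont: "continuous_on (U \<times> cbox A B) (\<lambda>(z, w). fx z w)" for U
    unfolding split_beta
    by (rule continuous_on_blinfun_componentwise) (use contL in \<open>simp add: fx split_beta\<close>)
  have der: "((\<lambda>z. integral (cbox A B) (\<lambda>w. H w * Q (w - z))) has_derivative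
      blinfun_apply (integral (cbox A B) (fx z0))) (at z0 within ball z0 1)"
  proof (rule leibniz_rule[where U = "ball z0 1"])
    show "((\<lambda>z. H w * Q (w - z)) has_derivative blinfun_apply (fx z w)) (at z within ball z0 1)" for z w
    proof -
      have "((\<lambda>z. w - z) has_derivative (\<lambda>e. - e)) (at z)" by (auto intro!: derivative_eq_intros)
      from diff_chain_at[OF this has_derivative_dir_deriv[OF diff]]
      have "((\<lambda>z. Q (w - z)) has_derivative (\<lambda>e. dir_deriv (- e) Q (w - z))) (at z)" by (simp add: o_def)
      from has_derivative_mult_right[OF this, of "H w"]
      have "((\<lambda>z. H w * Q (w - z)) has_derivative (\<lambda>e. H w * dir_deriv (- e) Q (w - z))) (at z)" .
      moreover have "(\<lambda>e. H w * dir_deriv (- e) Q (w - z)) = L z w"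
        unfolding L_def by (rule ext) (subst dir_deriv_decompose[OF diff], simp add: algebra_simps)
      ultimately show ?thesis by (simp add: fx has_derivative_at_withinI)
    qed
    show "(\<lambda>w. H w * Q (w - z)) integrable_on cbox A B" for z
      by (intro integrable_continuous continuous_intros continuous_on_compose2[OF H] continuous_on_compose2[OF Qc]) auto
  qed (use cont in auto)
  have "((\<lambda>z. LINT w|lebesgue. H w * Q (w - z)) has_derivative blinfun_apply (integral (cbox A B) (fx z0))) (at z0)"
  proof (rule has_derivative_transform_within_open)
    show "((\<lambda>z. integral (cbox A B) (\<lambda>w. H w * Q (w - z))) has_derivative
      blinfun_apply (integral (cbox A B) (fx z0))) (at z0)"
      using der at_within_open[of z0 "ball z0 1"] by simp
    show "open (ball z0 1)" "z0 \<in> ball z0 1" by auto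
    show "integral (cbox A B) (\<lambda>w. H w * Q (w - z)) = (LINT w|lebesgue. H w * Q (w - z))" if "z \<in> ball z0 1" for z
      using AB[OF Qc Q(2) that] by simp
  qed
  moreover have "blinfun_apply (integral (cbox A B) (fx z0)) e = - (LINT w|lebesgue. H w * dir_deriv e Q (w - z0))"
    if e: "e \<in> {1, \<i>}" for e
  proof -
    have "continuous_on (cbox A B) (fx z0)"
      using continuous_on_compose2[OF cont[of "{z0}"], of "cbox A B" "\<lambda>w. (z0, w)"]
      by (simp add: continuous_on_Pair image_subset_iff)
    then have "fx z0 integrable_on cbox A B" by (rule integrable_continuous)
    from integral_linear[OF this blinfun.bounded_linear_left[of e]]
    have "blinfun_apply (integral (cbox A B) (fx z0)) e = integral (cbox A B) (\<lambda>w. L z0 w e)"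
      by (simp add: o_def fx)
    also have "(\<lambda>w. L z0 w e) = (\<lambda>w. - (H w * dir_deriv e Q (w - z0)))"
      using e by (auto simp: L_def)
    also have "integral (cbox A B) \<dots> = - integral (cbox A B) (\<lambda>w. H w * dir_deriv e Q (w - z0))"
      by (rule integral_neg)
    finally show ?thesis using AB[OF Dc[OF e] D0, of z0] by simp
  qed
  ultimately show ?thesis by blast
qed

lemma dir_deriv_shift:
  assumes "Q differentiable (at (w - x))"
  shows "dir_deriv e (\<lambda>w. Q (w - x)) w = dir_deriv e Q (w - x)"
proof -
  have "((\<lambda>w. w - x) has_derivative (\<lambda>e. e)) (at w)" by (auto intro!: derivative_eq_intros)
  from diff_chain_at[OF this has_derivative_dir_deriv[OF assms]] show ?thesis
    by (simp add: o_def dir_deriv_eq)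
qed

lemma mollify_C1:
  assumes h: "0 < h" and H: "continuous_on UNIV H"
  shows "mollify h H differentiable (at x)"
    and "e \<in> {1, \<i>} \<Longrightarrow> continuous_on UNIV (dir_deriv e (mollify h H))"
    and "e \<in> {1, \<i>} \<Longrightarrow> dir_deriv e (mollify h H) x =
           - (LINT w|lebesgue. H w * dir_deriv e (\<lambda>w. complex_of_real (kern h (w - x))) w)"
proof -
  let ?Q = "\<lambda>w. complex_of_real (kern h w)"
  have Q: "C_k_on k UNIV ?Q" for k using C_k_on_kern[OF h, of k 0] by simp
  have Q0: "w \<notin> cbox 0 (h *\<^sub>R One) \<Longrightarrow> ?Q w = 0" for w using kern_eq_0[OF h] by simp
  have Qd: "?Q differentiable (at w)" for w using Q[of "Suc 0"] by simp
  have m: "mollify h H = (\<lambda>z. LINT w|lebesgue. H w * ?Q (w - z))"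
    by (simp add: mollify_def fun_eq_iff)
  have *: "\<exists>D. (mollify h H has_derivative D) (at x) \<and>
    (\<forall>e\<in>{1, \<i>}. D e = - (LINT w|lebesgue. H w * dir_deriv e ?Q (w - x)))" for x
    unfolding m by (rule has_derivative_convolution[OF H Q Q0])
  then show "mollify h H differentiable (at x)" using differentiableI by blast
  have dd: "dir_deriv e (mollify h H) x = - (LINT w|lebesgue. H w * dir_deriv e ?Q (w - x))"
    if "e \<in> {1, \<i>}" for e x using *[of x] that dir_deriv_eq by metis
  then show "dir_deriv e (mollify h H) x =
           - (LINT w|lebesgue. H w * dir_deriv e (\<lambda>w. complex_of_real (kern h (w - x))) w)"
    if "e \<in> {1, \<i>}"
    using that dir_deriv_shift[of ?Q, OF Qd] by simp
  assume e: "e \<in> {1, \<i>}"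
  have "dir_deriv e (mollify h H) = (\<lambda>x. - (LINT w|lebesgue. H w * dir_deriv e ?Q (w - x)))"
    using dd[OF e] by (rule ext)
  moreover have "continuous_on UNIV (dir_deriv e ?Q)" using Q[of "Suc 0"] e by auto
  moreover have "dir_deriv e ?Q w = 0" if "w \<notin> cbox 0 (h *\<^sub>R One)" for w
    by (rule dir_deriv_eq[OF has_derivative_zero_off_closed[OF closed_cbox Q0 that]])
  ultimately show "continuous_on UNIV (dir_deriv e (mollify h H))"
    by (auto intro!: continuous_intros continuous_convolution[OF H])
qed

section \<open>Almost everywhere statements\<close>

lemma AE_lebesgue_on_negligible:
  assumes "negligible N" "open U" "\<And>z. z \<in> U \<Longrightarrow> z \<notin> N \<Longrightarrow> P z"
  shows "AE z in lebesgue_on U. P z"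
proof -
  have "AE z in lebesgue. z \<in> U \<longrightarrow> P z"
    by (rule AE_I'[of N]) (use assms negligible_iff_null_sets in auto)
  then show ?thesis by (subst AE_restrict_space_iff) (use assms(2) in auto)
qed

text \<open>The translated mollifier kernels are test functions, so the mollifications of \<open>N\<close> vanish at any given
point once the scale is small; but they converge to \<open>N\<close> almost everywhere.\<close>

lemma du_Bois_Reymond:
  fixes N :: "complex \<Rightarrow> complex"
  assumes "open U" "N \<in> borel_measurable (lebesgue_on U)" "\<And>z. z \<in> U \<Longrightarrow> cmod (N z) \<le> B"
    and "\<And>\<psi>. \<psi> \<in> test_functions U \<Longrightarrow> (LINT z|lebesgue_on U. N z * \<psi> z) = 0"
  shows "AE z in lebesgue_on U. N z = 0"
proof -
  define G where "G z = (if z \<in> U then N z else 0)" for z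
  have G: "G \<in> borel_measurable lebesgue" unfolding G_def
    by (rule borel_measurable_if_I[OF assms(2)]) (use assms(1) in auto)
  have Gb: "cmod (G z) \<le> max B 0" for z using assms(3)[of z] by (auto simp: G_def)
  obtain S where S: "negligible S" "\<And>x. x \<notin> S \<Longrightarrow> (\<lambda>n. mollify (1 / real (Suc n)) G x) \<longlonglongrightarrow> G x"
    using mollify_tendsto_AE[OF G Gb] by blast
  show ?thesis
  proof (rule AE_lebesgue_on_negligible[OF S(1) assms(1)])
    fix z assume z: "z \<in> U" "z \<notin> S"
    obtain r where r: "r > 0" "ball z r \<subseteq> U" using assms(1) z(1) open_contains_ball by blast
    have "\<forall>\<^sub>F n in sequentially. mollify (1 / real (Suc n)) G z = 0"
      using eventually_square_subset[OF r(1)]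
    proof eventually_elim
      case (elim n)
      let ?k = "\<lambda>w. complex_of_real (kern (1 / real (Suc n)) (w - z))"
      have "?k \<in> test_functions U" by (rule kern_test_function) (use elim r(2) in auto)
      then have "(LINT w|lebesgue_on U. N w * ?k w) = 0" by (rule assms(4))
      moreover have "(LINT w|lebesgue_on U. N w * ?k w) = (LINT w|lebesgue_on U. G w * ?k w)"
        by (rule Bochner_Integration.integral_cong) (auto simp: G_def)
      moreover have "\<dots> = (LINT w|lebesgue. G w * ?k w)"
        by (rule integral_lebesgue_on_support) (auto simp: G_def assms(1))
      ultimately show ?case by (simp add: mollify_def)
    qed
    then have "(\<lambda>n. mollify (1 / real (Suc n)) G z) \<longlonglongrightarrow> 0" by (rule tendsto_eventually)
    then have "G z = 0" using S(2)[OF z(2)] LIMSEQ_unique by blast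
    then show "N z = 0" using z(1) by (simp add: G_def)
  qed
qed

text \<open>The set where the inequality fails is open, and a nonempty open set is not null.\<close>

lemma continuous_le_of_AE_le:
  fixes f u :: "complex \<Rightarrow> real"
  assumes "open U" "continuous_on U f" "continuous_on U u"
    and ae: "AE z in lebesgue_on U. f z \<le> u z" and "z \<in> U"
  shows "f z \<le> u z"
proof (rule ccontr)
  assume "\<not> f z \<le> u z"
  let ?S = "{w \<in> U. 0 < f w - u w}"
  have "open ?S"
    using continuous_open_preimage[OF continuous_on_diff[OF assms(2,3)] assms(1), of "{0<..}"]
    by (simp add: vimage_def Int_def)
  moreover have "?S \<noteq> {}" using \<open>\<not> f z \<le> u z\<close> assms(5) by auto
  ultimately have "\<not> negligible ?S" by (rule open_not_negligible)
  moreover have "AE z in lebesgue. z \<in> U \<longrightarrow> f z \<le> u z"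
    using ae assms(1) by (subst (asm) AE_restrict_space_iff) auto
  then have "AE z in lebesgue. z \<notin> ?S" by (rule AE_mp) auto
  then have "negligible ?S"
    using AE_iff_null_sets[of ?S lebesgue] \<open>open ?S\<close> negligible_iff_null_sets by auto
  ultimately show False by contradiction
qed

section \<open>Locally bounded functions against test functions\<close>

lemma integrable_mult_support:
  fixes F g :: "complex \<Rightarrow> complex"
  assumes "open U" "F \<in> borel_measurable (lebesgue_on U)" "compact K" "K \<subseteq> U"
    and B: "\<And>z. z \<in> K \<Longrightarrow> cmod (F z) \<le> B"
    and g: "continuous_on UNIV g" "\<And>z. z \<notin> K \<Longrightarrow> g z = 0"
  shows "integrable (lebesgue_on U) (\<lambda>z. F z * g z)"
proof -
  have Kl: "K \<in> sets lebesgue" using assms(3) by (simp add: compact_imp_closed)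
  have KU: "lebesgue_on K = restrict_space (lebesgue_on U) K"
    using restrict_restrict_space[of U lebesgue K] Kl assms(1,4) by (simp add: Int_absorb1)
  have "F \<in> borel_measurable (lebesgue_on K)"
    unfolding KU by (rule measurable_restrict_space1[OF assms(2)])
  then have m: "(\<lambda>z. if z \<in> K then F z else 0) \<in> borel_measurable lebesgue"
    by (rule borel_measurable_if_I[OF _ Kl])
  obtain C where C: "\<And>z. cmod (g z) \<le> C"
    using continuous_support_bounded[OF g(1) assms(3) g(2)] by blast
  have "integrable lebesgue (\<lambda>z. (if z \<in> K then F z else 0) * g z)"
  proof (rule integrable_bounded_support[OF _ assms(3)])
    show "(\<lambda>z. (if z \<in> K then F z else 0) * g z) \<in> borel_measurable lebesgue"
      by (rule borel_measurable_times[OF m continuous_imp_lebesgue_measurable[OF g(1)]])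
    show "norm ((if z \<in> K then F z else 0) * g z) \<le> max B 0 * C" for z
      unfolding norm_mult
    proof (rule mult_mono)
      show "cmod (if z \<in> K then F z else 0) \<le> max B 0" using B[of z] by (auto simp: le_max_iff_disj)
    qed (use C in auto)
  qed simp
  also have "(\<lambda>z. (if z \<in> K then F z else 0) * g z) = (\<lambda>z. indicator U z *\<^sub>R (F z * g z))"
  proof
    fix z show "(if z \<in> K then F z else 0) * g z = indicator U z *\<^sub>R (F z * g z)"
      using assms(4) g(2)[of z] by (cases "z \<in> K") auto
  qed
  finally show ?thesis
    using assms(1) by (simp add: integrable_restrict_space)
qed

lemma continuous_measurable_lebesgue_on:
  "continuous_on UNIV F \<Longrightarrow> (F :: complex \<Rightarrow> complex) \<in> borel_measurable (lebesgue_on U)"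
  by (rule measurable_restrict_space1[OF continuous_imp_lebesgue_measurable])

lemma continuous_on_imp_measurable:
  fixes F :: "complex \<Rightarrow> 'b::euclidean_space"
  assumes "open U" "continuous_on U F"
  shows "F \<in> borel_measurable (lebesgue_on U)"
  by (rule continuous_imp_measurable_on_sets_lebesgue[OF assms(2)]) (use assms(1) in auto)

lemma integrable_continuous_mult_support:
  fixes F g :: "complex \<Rightarrow> complex"
  assumes "open U" "continuous_on U F" "compact K" "K \<subseteq> U"
    and g: "continuous_on UNIV g" "\<And>z. z \<notin> K \<Longrightarrow> g z = 0"
  shows "integrable (lebesgue_on U) (\<lambda>z. F z * g z)"
proof -
  have "bounded (F ` K)"
    using assms by (meson compact_continuous_image compact_imp_bounded continuous_on_subset)
  then obtain B where "\<And>z. z \<in> K \<Longrightarrow> cmod (F z) \<le> B" by (auto simp: bounded_iff)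
  then show ?thesis
    by (rule integrable_mult_support[OF assms(1) continuous_on_imp_measurable[OF assms(1,2)] assms(3,4) _ g])
qed

text \<open>The class of functions that may appear as a distributional derivative here: they can be integrated
against any test function. For convenience the bound holds at every point of a compact set, not just
almost everywhere; bounded representatives are chosen when a function enters from \<open>L_infinity\<close>.\<close>

definition locally_bounded_measurable :: "complex set \<Rightarrow> (complex \<Rightarrow> complex) \<Rightarrow> bool" where
  "locally_bounded_measurable U g \<longleftrightarrow> g \<in> borel_measurable (lebesgue_on U) \<and>
     (\<forall>K. compact K \<and> K \<subseteq> U \<longrightarrow> (\<exists>B. \<forall>z\<in>K. cmod (g z) \<le> B))"

lemma continuous_locally_bounded_measurable:
  assumes "open U" "continuous_on U g"
  shows "locally_bounded_measurable U g"
  unfolding locally_bounded_measurable_def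
proof (intro conjI allI impI)
  show "g \<in> borel_measurable (lebesgue_on U)" by (rule continuous_on_imp_measurable[OF assms])
  fix K assume K: "compact K \<and> K \<subseteq> U"
  have "bounded (g ` K)"
    using K by (intro compact_imp_bounded compact_continuous_image continuous_on_subset[OF assms(2)]) auto
  then show "\<exists>B. \<forall>z\<in>K. cmod (g z) \<le> B" unfolding bounded_iff by simp
qed

lemma bounded_locally_bounded_measurable:
  assumes "g \<in> borel_measurable (lebesgue_on U)" "\<And>z. z \<in> U \<Longrightarrow> cmod (g z) \<le> B"
  shows "locally_bounded_measurable U g"
  unfolding locally_bounded_measurable_def using assms by (intro conjI allI impI exI[of _ B]) auto

lemma locally_bounded_measurable_mult:
  assumes "locally_bounded_measurable U f" "locally_bounded_measurable U g"
  shows "locally_bounded_measurable U (\<lambda>z. f z * g z)"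
  unfolding locally_bounded_measurable_def
proof (intro conjI allI impI)
  show "(\<lambda>z. f z * g z) \<in> borel_measurable (lebesgue_on U)"
    using assms unfolding locally_bounded_measurable_def by (intro borel_measurable_times) auto
  fix K assume K: "compact K \<and> K \<subseteq> U"
  obtain B where B: "\<forall>z\<in>K. cmod (f z) \<le> B" using assms(1) K unfolding locally_bounded_measurable_def by blast
  obtain C where C: "\<forall>z\<in>K. cmod (g z) \<le> C" using assms(2) K unfolding locally_bounded_measurable_def by blast
  have "cmod (f z * g z) \<le> B * C" if "z \<in> K" for z
  proof -
    have "cmod (f z) \<le> B" "cmod (g z) \<le> C" using B C that by auto
    moreover then have "0 \<le> B" using norm_ge_zero order_trans by blast
    ultimately show ?thesis unfolding norm_mult by (intro mult_mono) auto
  qed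
  then show "\<exists>B. \<forall>z\<in>K. cmod (f z * g z) \<le> B" by blast
qed

lemma test_function_dbar:
  assumes "\<psi> \<in> test_functions U"
  shows "continuous_on UNIV (dbar \<psi>)" "z \<notin> supp \<psi> \<Longrightarrow> dbar \<psi> z = 0"
proof -
  have "dbar \<psi> = (\<lambda>z. (dir_deriv 1 \<psi> z + \<i> * dir_deriv \<i> \<psi> z) / 2)" by (rule ext) (rule dbar_def)
  then show "continuous_on UNIV (dbar \<psi>)"
    by (auto intro!: continuous_intros test_functionsD(7)[OF assms])
  show "dbar \<psi> z = 0" if "z \<notin> supp \<psi>"
    unfolding dbar_def test_functionsD(4)[OF assms that] by simp
qed

lemma dbar_by_parts_test:
  fixes F :: "complex \<Rightarrow> complex"
  assumes "open U" and diff: "\<And>z. z \<in> U \<Longrightarrow> F differentiable (at z)"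
    and cont: "\<And>e. e \<in> {1, \<i>} \<Longrightarrow> continuous_on U (dir_deriv e F)" and \<psi>: "\<psi> \<in> test_functions U"
  shows "(LINT z|lebesgue_on U. F z * dbar \<psi> z) = - (LINT z|lebesgue_on U. dbar F z * \<psi> z)"
proof -
  note T = test_functionsD[OF \<psi>]
  have Fc: "continuous_on U F"
    using diff by (meson continuous_at_imp_continuous_on differentiable_imp_continuous_within)
  have i1: "integrable (lebesgue_on U) (\<lambda>z. F z * dir_deriv e \<psi> z)" if "e \<in> {1, \<i>}" for e
    by (rule integrable_continuous_mult_support[OF assms(1) Fc T(1,2) T(7)[OF that]]) (rule T(4))
  have i2: "integrable (lebesgue_on U) (\<lambda>z. dir_deriv e F z * \<psi> z)" if "e \<in> {1, \<i>}" for e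
    by (rule integrable_continuous_mult_support[OF assms(1) cont[OF that] T(1,2) T(6)]) (rule T(3))
  note ibp = integral_by_parts_test[OF assms(1) diff _ cont \<psi>]
  have "(\<lambda>z. F z * dbar \<psi> z) = (\<lambda>z. (F z * dir_deriv 1 \<psi> z + \<i> * (F z * dir_deriv \<i> \<psi> z)) / 2)"
    by (rule ext) (simp add: dbar_def algebra_simps)
  moreover have "(\<lambda>z. dbar F z * \<psi> z) = (\<lambda>z. (dir_deriv 1 F z * \<psi> z + \<i> * (dir_deriv \<i> F z * \<psi> z)) / 2)"
    by (rule ext) (simp add: dbar_def algebra_simps)
  ultimately show ?thesis
    using i1[of 1] i1[of \<i>] i2[of 1] i2[of \<i>] ibp[of 1] ibp[of \<i>] by (simp add: field_simps)
qed

section \<open>Pulling back null sets and weak dbar derivatives\<close>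

text \<open>The zeros of the derivative are countable. Away from them \<open>\<phi>\<close> has local holomorphic inverses, and
differentiable maps of the plane take null sets to null sets.\<close>

lemma negligible_holomorphic_vimage:
  assumes "\<phi> holomorphic_on U" "open U" "connected U" "\<not> \<phi> constant_on U" "negligible N"
  shows "negligible {z \<in> U. \<phi> z \<in> N}"
proof -
  let ?Z = "{z \<in> U. deriv \<phi> z = 0}" and ?S = "{z \<in> U. \<phi> z \<in> N \<and> deriv \<phi> z \<noteq> 0}"
  have hd: "deriv \<phi> holomorphic_on U" using assms by (intro holomorphic_deriv)
  have "countable ?Z"
  proof (cases "deriv \<phi> constant_on U")
    case True
    then obtain c where c: "\<And>z. z \<in> U \<Longrightarrow> deriv \<phi> z = c" unfolding constant_on_def by blast
    have "c \<noteq> 0"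
    proof
      assume "c = 0"
      then have "(\<phi> has_field_derivative 0) (at z)" if "z \<in> U" for z
        using holomorphic_derivI[OF assms(1,2) that] c[OF that] by simp
      then have "\<phi> constant_on U"
        by (rule has_field_derivative_0_imp_constant_on[OF _ assms(3,2)])
      with assms(4) show False by contradiction
    qed
    then have "?Z = {}" using c by auto
    then show ?thesis by (simp only: countable_empty)
  next
    case False
    obtain C :: "nat \<Rightarrow> complex set" where "\<And>n. compact (C n)" "\<Union>(range C) = U"
      by (rule open_Union_compact_subsets[OF assms(2)]) (rule that)
    then have "fsigma U" using fsigma.intros[of C] by (simp add: compact_imp_closed)
    from holomorphic_countable_zeros[OF hd assms(2,3) this False] show ?thesis .
  qed
  then have Z: "negligible ?Z" 
    unfolding negligible_iff_null_sets
    by (intro null_sets_completionI countable_imp_null_set_lborel)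
  have "negligible ?S"
    unfolding locally_negligible_alt[of ?S]
  proof
    fix x assume x: "x \<in> ?S"
    then have "x \<in> U" "deriv \<phi> x \<noteq> 0" by auto
    then obtain r where r: "r > 0" "ball x r \<subseteq> U" "inj_on \<phi> (ball x r)"
      by (rule has_complex_derivative_locally_injective[OF assms(1) _ assms(2)]) (rule that)
    have hb: "\<phi> holomorphic_on ball x r" by (rule holomorphic_on_subset[OF assms(1) r(2)])
    obtain g where g: "g holomorphic_on (\<phi> ` ball x r)" "\<And>z. z \<in> ball x r \<Longrightarrow> g (\<phi> z) = z"
      by (rule holomorphic_has_inverse[OF hb open_ball r(3)]) (rule that)
    have "negligible (g ` (N \<inter> \<phi> ` ball x r))"
    proof (rule negligible_differentiable_image_negligible)
      show "negligible (N \<inter> \<phi> ` ball x r)" using assms(5) by (rule negligible_subset) simp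
      show "g differentiable_on N \<inter> \<phi> ` ball x r"
        by (rule differentiable_on_subset[OF holomorphic_on_imp_differentiable_on[OF g(1)]]) simp
    qed simp
    moreover have "?S \<inter> ball x r \<subseteq> g ` (N \<inter> \<phi> ` ball x r)"
    proof
      fix z assume z: "z \<in> ?S \<inter> ball x r"
      then have "z = g (\<phi> z)" using g(2) by simp
      with z show "z \<in> g ` (N \<inter> \<phi> ` ball x r)" by blast
    qed
    ultimately have "negligible (?S \<inter> ball x r)" by (rule negligible_subset)
    moreover have "openin (top_of_set ?S) (?S \<inter> ball x r)" by (rule openin_open_Int) simp
    ultimately show "\<exists>U. openin (top_of_set ?S) U \<and> x \<in> U \<and> negligible U"
      using x r(1) by (intro exI[of _ "?S \<inter> ball x r"]) simp
  qed
  then have "negligible (?Z \<union> ?S)" using Z by (rule negligible_Un[rotated])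
  then show ?thesis by (rule negligible_subset) auto
qed

text \<open>A Lebesgue measurable set differs from a Borel set by a null set. The preimage of the former part is
Borel by continuity, and that of the latter is null.\<close>

lemma measurable_compose_holomorphic:
  fixes g :: "complex \<Rightarrow> complex"
  assumes \<phi>: "\<phi> holomorphic_on U" "open U" "connected U" "\<not> \<phi> constant_on U"
    and "open V" "\<phi> ` U \<subseteq> V" and g: "g \<in> borel_measurable (lebesgue_on V)"
  shows "(\<lambda>z. g (\<phi> z)) \<in> borel_measurable (lebesgue_on U)"
proof (rule measurableI)
  fix B :: "complex set" assume "B \<in> sets borel"
  then have "g -` B \<inter> space (lebesgue_on V) \<in> sets (lebesgue_on V)"
    by (rule measurable_sets[OF g])
  then have "g -` B \<inter> V \<in> sets lebesgue"
    using assms(5) by (simp add: sets_restrict_space_iff)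
  then obtain S N N' where A: "g -` B \<inter> V = S \<union> N" "N \<subseteq> N'" "N' \<in> null_sets lborel" "S \<in> sets lborel"
    by (rule sets_completionE)
  have "N' \<in> null_sets lebesgue" using A(3) by (rule null_sets_completionI)
  then have "negligible N" using A(2) negligible_iff_null_sets negligible_subset by blast
  then have "{z \<in> U. \<phi> z \<in> N} \<in> sets lebesgue"
    by (intro negligible_imp_sets negligible_holomorphic_vimage \<phi>)
  moreover have "{z \<in> U. \<phi> z \<in> S} \<in> sets lebesgue"
  proof -
    have "\<phi> \<in> borel_measurable (restrict_space borel U)"
      using holomorphic_on_imp_continuous_on[OF \<phi>(1)] by (rule borel_measurable_continuous_on_restrict)
    from measurable_sets[OF this, of S] have "\<phi> -` S \<inter> U \<in> sets (restrict_space borel U)"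
      using A(4) by (simp add: space_restrict_space)
    then have "\<phi> -` S \<inter> U \<in> sets borel"
      using \<phi>(2) by (simp add: sets_restrict_space_iff)
    moreover have "\<phi> -` S \<inter> U = {z \<in> U. \<phi> z \<in> S}" by auto
    ultimately show ?thesis by simp
  qed
  ultimately have "{z \<in> U. \<phi> z \<in> S} \<union> {z \<in> U. \<phi> z \<in> N} \<in> sets lebesgue" by blast
  moreover have "{z \<in> U. \<phi> z \<in> S} \<union> {z \<in> U. \<phi> z \<in> N} = (\<lambda>z. g (\<phi> z)) -` B \<inter> U"
  proof -
    have "\<phi> z \<in> S \<union> N \<longleftrightarrow> g (\<phi> z) \<in> B" if "z \<in> U" for z
      using that assms(6) unfolding A(1)[symmetric] by blast
    then show ?thesis by blast
  qed
  ultimately show "(\<lambda>z. g (\<phi> z)) -` B \<inter> space (lebesgue_on U) \<in> sets (lebesgue_on U)"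
    using \<phi>(2) by (simp add: sets_restrict_space_iff)
qed simp

lemma dbar_compose_holomorphic:
  fixes F :: "complex \<Rightarrow> complex"
  assumes \<phi>: "(\<phi> has_field_derivative \<phi>') (at z)" and F: "F differentiable (at (\<phi> z))"
  shows "(\<lambda>z. F (\<phi> z)) differentiable (at z)"
    and "dir_deriv e (\<lambda>z. F (\<phi> z)) z =
      Re (\<phi>' * e) *\<^sub>R dir_deriv 1 F (\<phi> z) + Im (\<phi>' * e) *\<^sub>R dir_deriv \<i> F (\<phi> z)"
    and "dbar (\<lambda>z. F (\<phi> z)) z = dbar F (\<phi> z) * cnj \<phi>'"
proof -
  note d = has_derivative_compose_holomorphic[OF \<phi> F]
  show "(\<lambda>z. F (\<phi> z)) differentiable (at z)" using d by (rule differentiableI)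
  show *: "dir_deriv e (\<lambda>z. F (\<phi> z)) z =
      Re (\<phi>' * e) *\<^sub>R dir_deriv 1 F (\<phi> z) + Im (\<phi>' * e) *\<^sub>R dir_deriv \<i> F (\<phi> z)" for e
    by (rule dir_deriv_eq[OF d])
  show "dbar (\<lambda>z. F (\<phi> z)) z = dbar F (\<phi> z) * cnj \<phi>'"
    unfolding dbar_def * by (simp add: scaleR_conv_of_real complex_eq_iff algebra_simps)
qed

text \<open>Differentiation of the mollification moves to the kernel, which is a test function near \<open>x\<close>; the weak
equation then moves it to \<open>h\<close>. The functions \<open>H\<close> and \<open>G\<close> stand for extensions of \<open>h\<close> and
\<open>g\<close> to the plane, on which mollification is defined; only their values on the square enter.\<close>

lemma dbar_mollify:
  fixes h g H G :: "complex \<Rightarrow> complex"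
  assumes "open U" and weak: "weak_dbar U h g" and H: "continuous_on UNIV H" and "0 < \<epsilon>"
    and sub: "cbox x (x + \<epsilon> *\<^sub>R One) \<subseteq> U"
    and eq: "\<And>w. w \<in> cbox x (x + \<epsilon> *\<^sub>R One) \<Longrightarrow> H w = h w" "\<And>w. w \<in> cbox x (x + \<epsilon> *\<^sub>R One) \<Longrightarrow> G w = g w"
  shows "dbar (mollify \<epsilon> H) x = mollify \<epsilon> G x"
proof -
  let ?Q = "cbox x (x + \<epsilon> *\<^sub>R One)"
  define k where "k = (\<lambda>w. complex_of_real (kern \<epsilon> (w - x)))"
  have k0: "k w = 0" if "w \<notin> ?Q" for w using kern_shift(4)[OF assms(4) that] by (simp add: k_def)
  have dk0: "dir_deriv e k w = 0" if "w \<notin> ?Q" for w e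
    by (rule dir_deriv_eq[OF has_derivative_zero_off_closed[OF closed_cbox _ that]]) (rule k0)
  have k0': "c * k w = 0" if "w \<notin> ?Q" for c w unfolding k0[OF that] by simp
  have dbk0: "c * dbar k w = 0" if "w \<notin> ?Q" for c w
    by (simp add: dbar_def dk0[OF that])
  have k: "k \<in> test_functions U" unfolding k_def by (rule kern_test_function[OF assms(4) sub])
  have dk: "k differentiable (at w)" "e \<in> {1, \<i>} \<Longrightarrow> continuous_on UNIV (dir_deriv e k)" for w e
    by (rule test_functionsD(5)[OF k], rule test_functionsD(7)[OF k])
  have int: "integrable lebesgue (\<lambda>w. H w * dir_deriv e k w)" if "e \<in> {1, \<i>}" for e
  proof (rule integrable_continuous_support[OF _ compact_cbox])
    show "continuous_on UNIV (\<lambda>w. H w * dir_deriv e k w)" by (intro continuous_intros H dk that)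
    show "w \<notin> ?Q \<Longrightarrow> H w * dir_deriv e k w = 0" for w by (simp add: dk0)
  qed
  have d: "dir_deriv e (mollify \<epsilon> H) x = - (LINT w|lebesgue. H w * dir_deriv e k w)" if "e \<in> {1, \<i>}" for e
    using mollify_C1(3)[OF assms(4) H that] unfolding k_def .
  have "(LINT w|lebesgue. H w * dbar k w) = (LINT w|lebesgue. (H w * dir_deriv 1 k w + \<i> * (H w * dir_deriv \<i> k w)) / 2)"
    by (intro Bochner_Integration.integral_cong) (auto simp: dbar_def algebra_simps)
  also have "\<dots> = - dbar (mollify \<epsilon> H) x"
    unfolding dbar_def using int[of 1] int[of \<i>] d[of 1] d[of \<i>] by (simp add: field_simps)
  finally have "dbar (mollify \<epsilon> H) x = - (LINT w|lebesgue. H w * dbar k w)" by simp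
  also have "(\<lambda>w. H w * dbar k w) = (\<lambda>w. h w * dbar k w)"
  proof
    show "H w * dbar k w = h w * dbar k w" for w
      by (cases "w \<in> ?Q") (simp_all add: eq dbar_def dk0)
  qed
  also have "(LINT w|lebesgue. h w * dbar k w) = (LINT w|lebesgue_on U. h w * dbar k w)"
    by (rule integral_lebesgue_on_support[OF assms(1), symmetric]) (rule dbk0, rule contra_subsetD[OF sub])
  also have "\<dots> = - (LINT w|lebesgue_on U. g w * k w)"
    using weak k unfolding weak_dbar_def by blast
  also have "(LINT w|lebesgue_on U. g w * k w) = (LINT w|lebesgue. g w * k w)"
    by (rule integral_lebesgue_on_support[OF assms(1)]) (rule k0', rule contra_subsetD[OF sub])
  also have "(\<lambda>w. g w * k w) = (\<lambda>w. G w * k w)"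
  proof
    show "g w * k w = G w * k w" for w
      by (cases "w \<in> ?Q") (simp_all add: eq k0)
  qed
  also have "(LINT w|lebesgue. G w * k w) = mollify \<epsilon> G x"
    unfolding mollify_def k_def ..
  finally show ?thesis by simp
qed

lemma weak_dbar_compose_constant:
  assumes "open U" "\<And>z. z \<in> U \<Longrightarrow> F z = c" "\<And>z. z \<in> U \<Longrightarrow> G z = 0"
  shows "weak_dbar U F G"
  unfolding weak_dbar_def
proof
  fix \<psi> assume \<psi>: "\<psi> \<in> test_functions U"
  have d: "dir_deriv e (\<lambda>z. c) = (\<lambda>z. 0)" for e :: complex
    by (rule ext) (rule dir_deriv_eq[OF has_derivative_const])
  have "(LINT z|lebesgue_on U. F z * dbar \<psi> z) = (LINT z|lebesgue_on U. c * dbar \<psi> z)"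
    by (rule Bochner_Integration.integral_cong) (auto simp: assms(2))
  also have "\<dots> = - (LINT z|lebesgue_on U. dbar (\<lambda>z. c) z * \<psi> z)"
    by (rule dbar_by_parts_test[OF assms(1) _ _ \<psi>]) (simp_all add: d)
  also have "(LINT z|lebesgue_on U. dbar (\<lambda>z. c) z * \<psi> z) = (LINT z|lebesgue_on U. G z * \<psi> z)"
    by (rule Bochner_Integration.integral_cong) (auto simp: assms(3) dbar_def d)
  finally show "(LINT z|lebesgue_on U. F z * dbar \<psi> z) = - (LINT z|lebesgue_on U. G z * \<psi> z)" .
qed

text \<open>The approximants are mollifications of a bounded continuous extension \<open>H\<close> of \<open>h\<close> from a compact
neighbourhood of \<open>L\<close> to the plane. On \<open>L\<close> their dbar derivatives are mollifications of \<open>g\<close>, by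
\<open>dbar_mollify\<close>, which gives both the bound and the convergence almost everywhere.\<close>

lemma weak_dbar_smooth_approximation:
  fixes h g :: "complex \<Rightarrow> complex"
  assumes U: "open U" and h: "continuous_on U h" and g: "locally_bounded_measurable U g"
    and weak: "weak_dbar U h g" and L: "compact L" "L \<subseteq> U"
  shows "\<exists>M B S. (\<forall>n w. M n differentiable (at w)) \<and>
    (\<forall>n. \<forall>e\<in>{1, \<i>}. continuous_on UNIV (dir_deriv e (M n))) \<and>
    (\<forall>n. \<forall>w\<in>L. cmod (M n w) \<le> B \<and> cmod (dbar (M n) w) \<le> B) \<and>
    negligible S \<and> (\<forall>w\<in>L - S. (\<lambda>n. M n w) \<longlonglongrightarrow> h w \<and> (\<lambda>n. dbar (M n) w) \<longlonglongrightarrow> g w)"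
proof -
  obtain r where r: "r > 0" "(\<Union>x\<in>L. cball x r) \<subseteq> U"
    using compact_subset_open_imp_cball_epsilon_subset[OF L(1) U L(2)] by blast
  \<comment> \<open>The compact neighbourhood of \<open>L\<close> of radius \<open>r\<close>, written as a sum to make its compactness evident.\<close>
  define L' where "L' = (\<lambda>(x, y). x + y) ` (L \<times> cball 0 r)"
  have L'c: "compact L'" unfolding L'_def split_beta
    by (intro compact_continuous_image compact_Times L(1) compact_cball continuous_intros)
  have L'1: "ball x r \<subseteq> L'" if "x \<in> L" for x
  proof
    fix w assume "w \<in> ball x r"
    then have "(x, w - x) \<in> L \<times> cball 0 r" using that by (simp add: dist_norm norm_minus_commute)
    then have "x + (w - x) \<in> L'" unfolding L'_def by (rule rev_image_eqI) simp
    then show "w \<in> L'" by simp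
  qed
  have L'2: "L' \<subseteq> U"
  proof
    fix w assume "w \<in> L'"
    then obtain q where "q \<in> L \<times> cball 0 r" "w = fst q + snd q"
      unfolding L'_def split_beta by (rule imageE)
    then have "fst q \<in> L" "w \<in> cball (fst q) r" by (simp_all add: mem_Times_iff dist_norm)
    with r(2) show "w \<in> U" by blast
  qed
  have hL: "continuous_on L' h" by (rule continuous_on_subset[OF h L'2])
  obtain B where B: "\<And>w. w \<in> L' \<Longrightarrow> norm (h w) \<le> B" "0 \<le> B"
  proof -
    have "bounded (h ` L')" by (intro compact_imp_bounded compact_continuous_image hL L'c)
    then obtain b where "0 < b" "\<forall>x\<in>h ` L'. norm x \<le> b" unfolding bounded_pos by blast
    then show thesis using that[of b] by simp
  qed
  obtain H where H: "continuous_on UNIV H" "\<And>w. w \<in> L' \<Longrightarrow> H w = h w" "\<And>w. norm (H w) \<le> B"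
  proof (rule Tietze[OF hL _ B(2) B(1)])
    show "closedin (top_of_set UNIV) L'" using L'c by (simp add: compact_imp_closed)
  qed auto
  have gm: "g \<in> borel_measurable (lebesgue_on U)" and "\<exists>C. \<forall>w\<in>L'. cmod (g w) \<le> C"
    using g L'c L'2 unfolding locally_bounded_measurable_def by auto
  then obtain C where C: "\<forall>w\<in>L'. cmod (g w) \<le> C" by (elim exE)
  define G where "G w = (if w \<in> L' then g w else 0)" for w
  have Gm: "G \<in> borel_measurable lebesgue"
  proof -
    have "(\<lambda>w. if w \<in> U then g w else 0) \<in> borel_measurable lebesgue"
      by (rule borel_measurable_if_I[OF gm]) (use U in auto)
    moreover have "L' \<inter> space lebesgue \<in> sets lebesgue" using L'c by (simp add: compact_imp_closed)
    ultimately have "(\<lambda>w. if w \<in> L' then (if w \<in> U then g w else 0) else 0) \<in> borel_measurable lebesgue"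
      by (rule measurable_If_set[OF _ borel_measurable_const])
    also have "(\<lambda>w. if w \<in> L' then (if w \<in> U then g w else 0) else 0) = G"
      using L'2 by (auto simp: G_def fun_eq_iff)
    finally show ?thesis .
  qed
  have Gb: "cmod (G w) \<le> max C 0" for w using C by (auto simp: G_def le_max_iff_disj)
  note Hm = continuous_imp_lebesgue_measurable[OF H(1)]
  obtain S where S: "negligible S" "\<And>x. x \<notin> S \<Longrightarrow> (\<lambda>n. mollify (1 / real (Suc n)) H x) \<longlonglongrightarrow> H x"
    using mollify_tendsto_AE[OF Hm H(3)] by blast
  obtain S' where S': "negligible S'" "\<And>x. x \<notin> S' \<Longrightarrow> (\<lambda>n. mollify (1 / real (Suc n)) G x) \<longlonglongrightarrow> G x"
    using mollify_tendsto_AE[OF Gm Gb] by blast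
  obtain N0 where N0: "\<And>n x. n \<ge> N0 \<Longrightarrow> cbox x (x + (1 / real (Suc n)) *\<^sub>R One) \<subseteq> ball (x::complex) r"
    using eventually_square_subset[OF r(1)] unfolding eventually_sequentially by blast
  \<comment> \<open>The shift by \<open>N0\<close> keeps all kernels based at points of \<open>L\<close> supported in \<open>L'\<close>.\<close>
  define \<epsilon> where "\<epsilon> n = 1 / real (Suc (n + N0))" for n
  have \<epsilon>: "0 < \<epsilon> n" for n by (simp add: \<epsilon>_def)
  have HG: "H x = h x" "G x = g x" if "x \<in> L" for x
  proof -
    have "x \<in> L'" using L'1[OF that] r(1) by (meson centre_in_ball subsetD)
    then show "H x = h x" "G x = g x" by (simp_all add: H(2) G_def)
  qed
  have dbar: "dbar (mollify (\<epsilon> n) H) x = mollify (\<epsilon> n) G x" if "x \<in> L" for n x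
  proof -
    have sub: "cbox x (x + \<epsilon> n *\<^sub>R One) \<subseteq> L'"
      using N0[of "n + N0" x] L'1[OF that] unfolding \<epsilon>_def by (meson le_add2 order_trans)
    show ?thesis
    proof (rule dbar_mollify[OF U weak H(1) \<epsilon> subset_trans[OF sub L'2]])
      show "H w = h w" "G w = g w" if "w \<in> cbox x (x + \<epsilon> n *\<^sub>R One)" for w
        using subsetD[OF sub that] by (simp_all add: H(2) G_def)
    qed
  qed
  show ?thesis
  proof (intro exI conjI allI ballI)
    fix n
    show "mollify (\<epsilon> n) H differentiable (at w)" for w by (rule mollify_C1(1)[OF \<epsilon> H(1)])
    show "continuous_on UNIV (dir_deriv e (mollify (\<epsilon> n) H))" if "e \<in> {1, \<i>}" for e
      by (rule mollify_C1(2)[OF \<epsilon> H(1) that])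
    fix w assume w: "w \<in> L"
    have "cmod (mollify (\<epsilon> n) H w) \<le> B"
      by (rule mollify_bound[OF \<epsilon> Hm H(3)])
    then show "cmod (mollify (\<epsilon> n) H w) \<le> max B (max C 0)" by simp
    have "cmod (mollify (\<epsilon> n) G w) \<le> max C 0" by (rule mollify_bound[OF \<epsilon> Gm Gb])
    then show "cmod (dbar (mollify (\<epsilon> n) H) w) \<le> max B (max C 0)" unfolding dbar[OF w] by simp
  next
    show "negligible (S \<union> S')" using S(1) S'(1) by (rule negligible_Un)
    fix w assume w: "w \<in> L - (S \<union> S')"
    have "(\<lambda>n. mollify (\<epsilon> n) H w) \<longlonglongrightarrow> H w" "(\<lambda>n. mollify (\<epsilon> n) G w) \<longlonglongrightarrow> G w"
      unfolding \<epsilon>_def using w by (intro LIMSEQ_ignore_initial_segment S(2) S'(2); simp)+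
    then show "(\<lambda>n. mollify (\<epsilon> n) H w) \<longlonglongrightarrow> h w" "(\<lambda>n. dbar (mollify (\<epsilon> n) H) w) \<longlonglongrightarrow> g w"
      using w by (simp_all add: dbar HG)
  qed
qed

lemma integral_mult_support_tendsto:
  fixes F :: "nat \<Rightarrow> complex \<Rightarrow> complex"
  assumes U: "open U" "compact K" "K \<subseteq> U"
    and k: "continuous_on UNIV k" "\<And>z. z \<notin> K \<Longrightarrow> k z = 0"
    and F: "\<And>n. continuous_on U (F n)" "\<And>n z. z \<in> K \<Longrightarrow> cmod (F n z) \<le> C"
    and G: "G \<in> borel_measurable (lebesgue_on U)"
    and S: "negligible S" "\<And>z. z \<in> K \<Longrightarrow> z \<notin> S \<Longrightarrow> (\<lambda>n. F n z) \<longlonglongrightarrow> G z"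
  shows "(\<lambda>n. LINT z|lebesgue_on U. F n z * k z) \<longlonglongrightarrow> (LINT z|lebesgue_on U. G z * k z)"
proof (rule integral_dominated_convergence)
  note int = integrable_continuous_mult_support[OF U(1) _ U(2,3) k]
  show "(\<lambda>z. G z * k z) \<in> borel_measurable (lebesgue_on U)"
    by (rule borel_measurable_times[OF G continuous_measurable_lebesgue_on[OF k(1)]])
  show "(\<lambda>z. F n z * k z) \<in> borel_measurable (lebesgue_on U)" for n
    by (rule borel_measurable_integrable[OF int[OF F(1)]])
  show "integrable (lebesgue_on U) (\<lambda>z. norm (of_real C * k z))"
    by (rule integrable_norm[OF int[OF continuous_on_const]])
  show "AE z in lebesgue_on U. norm (F n z * k z) \<le> norm (of_real C * k z)" for n
  proof (rule AE_I2)
    fix z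
    show "norm (F n z * k z) \<le> norm (of_real C * k z)"
    proof (cases "z \<in> K")
      case True
      from F(2)[OF this, of n] have "cmod (F n z) \<le> cmod (of_real C)" by simp
      then show ?thesis unfolding norm_mult by (rule mult_right_mono) simp
    next
      case False
      then show ?thesis using k(2) by simp
    qed
  qed
  show "AE z in lebesgue_on U. (\<lambda>n. F n z * k z) \<longlonglongrightarrow> G z * k z"
  proof (rule AE_lebesgue_on_negligible[OF S(1) U(1)])
    fix z assume "z \<notin> S"
    then show "(\<lambda>n. F n z * k z) \<longlonglongrightarrow> G z * k z"
      using S(2)[of z] k(2)[of z] by (cases "z \<in> K") (auto intro: tendsto_mult)
  qed
qed

text \<open>Only the compact set \<open>\<phi> ` supp \<psi>\<close> matters for a test function \<open>\<psi>\<close>. The smooth approximants on it satisfy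
the classical chain rule and integration by parts after composition with \<open>\<phi>\<close>, and both sides
pass to the limit because \<open>\<phi>\<close> pulls the exceptional null set back to a null set.\<close>

lemma weak_dbar_compose_nonconstant:
  fixes h g :: "complex \<Rightarrow> complex"
  assumes \<phi>: "\<phi> holomorphic_on U" "open U" "connected U" "\<not> \<phi> constant_on U"
    and V: "open V" "\<phi> ` U \<subseteq> V"
    and h: "continuous_on V h" and g: "locally_bounded_measurable V g"
    and weak: "weak_dbar V h g"
  shows "weak_dbar U (\<lambda>z. h (\<phi> z)) (\<lambda>z. g (\<phi> z) * cnj (deriv \<phi> z))"
  unfolding weak_dbar_def
proof
  fix \<psi> assume \<psi>: "\<psi> \<in> test_functions U"
  note T = test_functionsD[OF \<psi>]
  have \<phi>c: "continuous_on U \<phi>" by (rule holomorphic_on_imp_continuous_on[OF \<phi>(1)])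
  have \<phi>': "(\<phi> has_field_derivative deriv \<phi> z) (at z)" if "z \<in> U" for z
    by (rule holomorphic_derivI[OF \<phi>(1,2) that])
  have \<phi>'c: "continuous_on U (deriv \<phi>)"
    by (intro holomorphic_on_imp_continuous_on holomorphic_deriv \<phi>)
  let ?L = "\<phi> ` supp \<psi>"
  have L: "compact ?L" "?L \<subseteq> V"
    using T(1,2) \<phi>c V(2) by (auto intro!: compact_continuous_image intro: continuous_on_subset)
  obtain M B S where M: "\<forall>n w. M n differentiable (at w)"
    "\<forall>n. \<forall>e\<in>{1, \<i>}. continuous_on UNIV (dir_deriv e (M n))"
    "\<forall>n. \<forall>w\<in>?L. cmod (M n w) \<le> B \<and> cmod (dbar (M n) w) \<le> B"
    "negligible S" "\<forall>w\<in>?L - S. (\<lambda>n. M n w) \<longlonglongrightarrow> h w \<and> (\<lambda>n. dbar (M n) w) \<longlonglongrightarrow> g w"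
    using weak_dbar_smooth_approximation[OF V(1) h g weak L] by (elim exE conjE)
  let ?F = "\<lambda>n z. M n (\<phi> z)"
  note Mdiff = M(1)[rule_format]
  have Fdiff: "?F n differentiable (at z)" if "z \<in> U" for n z
    by (rule dbar_compose_holomorphic(1)[OF \<phi>'[OF that] Mdiff])
  have Fdir: "continuous_on U (dir_deriv e (?F n))" for n e
  proof -
    have "continuous_on U (\<lambda>z. dir_deriv d (M n) (\<phi> z))" if "d \<in> {1, \<i>}" for d
      by (rule continuous_on_compose2[OF M(2)[rule_format, OF that] \<phi>c]) simp
    then have "continuous_on U (\<lambda>z. Re (deriv \<phi> z * e) *\<^sub>R dir_deriv 1 (M n) (\<phi> z)
        + Im (deriv \<phi> z * e) *\<^sub>R dir_deriv \<i> (M n) (\<phi> z))"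
      by (intro continuous_intros \<phi>'c) auto
    then show ?thesis
      by (rule continuous_on_eq) (rule dbar_compose_holomorphic(2)[OF \<phi>' Mdiff, symmetric])
  qed
  have dF: "continuous_on U (dbar (?F n))" for n
  proof -
    have "dbar (?F n) = (\<lambda>z. (dir_deriv 1 (?F n) z + \<i> * dir_deriv \<i> (?F n) z) / 2)"
      by (rule ext) (rule dbar_def)
    then show ?thesis by (auto intro!: continuous_intros Fdir)
  qed
  have Fdbar: "dbar (?F n) z = dbar (M n) (\<phi> z) * cnj (deriv \<phi> z)" if "z \<in> supp \<psi>" for n z
    by (rule dbar_compose_holomorphic(3)[OF \<phi>'[OF subsetD[OF T(2) that]] Mdiff])
  have off: "\<phi> z \<in> ?L - S" if "z \<in> supp \<psi>" "z \<notin> {z \<in> U. \<phi> z \<in> S}" for z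
    using that T(2) by blast
  note null = negligible_holomorphic_vimage[OF \<phi> M(4)]
  have ibp: "(LINT z|lebesgue_on U. ?F n z * dbar \<psi> z) = - (LINT z|lebesgue_on U. dbar (?F n) z * \<psi> z)" for n
    by (rule dbar_by_parts_test[OF \<phi>(2) Fdiff Fdir \<psi>])
  have "(\<lambda>n. LINT z|lebesgue_on U. ?F n z * dbar \<psi> z) \<longlonglongrightarrow> (LINT z|lebesgue_on U. h (\<phi> z) * dbar \<psi> z)"
  proof (rule integral_mult_support_tendsto[OF \<phi>(2) T(1,2) test_function_dbar(1)[OF \<psi>] _ _ _ _ null])
    show "z \<notin> supp \<psi> \<Longrightarrow> dbar \<psi> z = 0" for z by (rule test_function_dbar(2)[OF \<psi>])
    show "continuous_on U (?F n)" for n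
      by (rule continuous_at_imp_continuous_on, rule ballI, rule differentiable_imp_continuous_within)
         (rule Fdiff)
    show "cmod (?F n z) \<le> B" if "z \<in> supp \<psi>" for n z using M(3) that by blast
    show "(\<lambda>z. h (\<phi> z)) \<in> borel_measurable (lebesgue_on U)"
      by (rule continuous_on_imp_measurable[OF \<phi>(2) continuous_on_compose2[OF h \<phi>c V(2)]])
    show "(\<lambda>n. ?F n z) \<longlonglongrightarrow> h (\<phi> z)" if "z \<in> supp \<psi>" "z \<notin> {z \<in> U. \<phi> z \<in> S}" for z
      by (rule conjunct1[OF bspec[OF M(5) off[OF that]]])
  qed
  moreover have "(\<lambda>n. LINT z|lebesgue_on U. dbar (?F n) z * \<psi> z) \<longlonglongrightarrow>
      (LINT z|lebesgue_on U. g (\<phi> z) * cnj (deriv \<phi> z) * \<psi> z)"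
  proof -
    have "bounded (deriv \<phi> ` supp \<psi>)"
      using T(1,2) by (intro compact_imp_bounded compact_continuous_image continuous_on_subset[OF \<phi>'c])
    then obtain D where D: "\<forall>z\<in>supp \<psi>. cmod (deriv \<phi> z) \<le> D" by (auto simp: bounded_iff)
    show ?thesis
    proof (rule integral_mult_support_tendsto[OF \<phi>(2) T(1,2,6) _ dF _ _ null])
      show "z \<notin> supp \<psi> \<Longrightarrow> \<psi> z = 0" for z by (rule T(3))
      show "cmod (dbar (?F n) z) \<le> B * D" if z: "z \<in> supp \<psi>" for n z
      proof -
        have "cmod (dbar (M n) (\<phi> z)) \<le> B" "cmod (deriv \<phi> z) \<le> D" using M(3) D z by blast+
        then show ?thesis unfolding Fdbar[OF z] norm_mult complex_mod_cnj
          by (rule mult_mono') simp_all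
      qed
      have "g \<in> borel_measurable (lebesgue_on V)"
        using g unfolding locally_bounded_measurable_def by (rule conjunct1)
      then show "(\<lambda>z. g (\<phi> z) * cnj (deriv \<phi> z)) \<in> borel_measurable (lebesgue_on U)"
        by (intro borel_measurable_times measurable_compose_holomorphic[OF \<phi> V]
            continuous_on_imp_measurable[OF \<phi>(2)] continuous_on_cnj \<phi>'c)
      show "(\<lambda>n. dbar (?F n) z) \<longlonglongrightarrow> g (\<phi> z) * cnj (deriv \<phi> z)"
        if z: "z \<in> supp \<psi>" "z \<notin> {z \<in> U. \<phi> z \<in> S}" for z
        unfolding Fdbar[OF z(1)]
        by (rule tendsto_mult[OF conjunct2[OF bspec[OF M(5) off[OF z]]] tendsto_const])
    qed
  qed
  then have "(\<lambda>n. - (LINT z|lebesgue_on U. dbar (?F n) z * \<psi> z)) \<longlonglongrightarrow>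
      - (LINT z|lebesgue_on U. g (\<phi> z) * cnj (deriv \<phi> z) * \<psi> z)"
    by (rule tendsto_minus)
  ultimately show "(LINT z|lebesgue_on U. h (\<phi> z) * dbar \<psi> z) =
      - (LINT z|lebesgue_on U. g (\<phi> z) * cnj (deriv \<phi> z) * \<psi> z)"
    unfolding ibp by (rule LIMSEQ_unique)
qed

text \<open>For constant \<open>\<phi>\<close> both \<open>h \<circ> \<phi>\<close> is constant and the right-hand side vanishes. This case is separate
because a constant map need not pull null sets back to null sets.\<close>

lemma holomorphic_weak_dbar_compose:
  fixes h g :: "complex \<Rightarrow> complex"
  assumes \<phi>: "\<phi> holomorphic_on U" "open U" "connected U"
    and V: "open V" "\<phi> ` U \<subseteq> V"
    and h: "continuous_on V h" and g: "locally_bounded_measurable V g"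
    and weak: "weak_dbar V h g"
  shows "weak_dbar U (\<lambda>z. h (\<phi> z)) (\<lambda>z. g (\<phi> z) * cnj (deriv \<phi> z))"
    and "(\<lambda>z. g (\<phi> z) * cnj (deriv \<phi> z)) \<in> borel_measurable (lebesgue_on U)"
proof -
  have \<phi>'c: "continuous_on U (deriv \<phi>)"
    by (intro holomorphic_on_imp_continuous_on holomorphic_deriv \<phi>)
  have gm: "g \<in> borel_measurable (lebesgue_on V)"
    using g unfolding locally_bounded_measurable_def by (rule conjunct1)
  have "weak_dbar U (\<lambda>z. h (\<phi> z)) (\<lambda>z. g (\<phi> z) * cnj (deriv \<phi> z)) \<and>
    (\<lambda>z. g (\<phi> z) * cnj (deriv \<phi> z)) \<in> borel_measurable (lebesgue_on U)"
  proof (cases "\<phi> constant_on U")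
    case True
    then obtain c where c: "\<And>z. z \<in> U \<Longrightarrow> \<phi> z = c" unfolding constant_on_def by blast
    have d0: "g (\<phi> z) * cnj (deriv \<phi> z) = 0" if "z \<in> U" for z
    proof -
      have "((\<lambda>_. c) has_field_derivative 0) (at z)" by simp
      then have "(\<phi> has_field_derivative 0) (at z)"
        by (rule has_field_derivative_transform_within_open[OF _ \<phi>(2) that]) (simp add: c)
      then show ?thesis by (simp add: DERIV_imp_deriv)
    qed
    have "weak_dbar U (\<lambda>z. h (\<phi> z)) (\<lambda>z. g (\<phi> z) * cnj (deriv \<phi> z))"
      by (rule weak_dbar_compose_constant[OF \<phi>(2), of _ "h c"]) (simp only: c, rule d0)
    moreover have "continuous_on U (\<lambda>z. g (\<phi> z) * cnj (deriv \<phi> z))"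
      by (rule continuous_on_eq[of _ "\<lambda>_. 0"]) (rule continuous_on_const, rule d0[symmetric])
    ultimately show ?thesis using continuous_on_imp_measurable[OF \<phi>(2)] by blast
  next
    case False
    have "(\<lambda>z. cnj (deriv \<phi> z)) \<in> borel_measurable (lebesgue_on U)"
      by (rule continuous_on_imp_measurable[OF \<phi>(2)]) (intro continuous_intros \<phi>'c)
    then show ?thesis
      using weak_dbar_compose_nonconstant[OF \<phi> False V h g weak]
        borel_measurable_times[OF measurable_compose_holomorphic[OF \<phi> False V gm]] by blast
  qed
  then show "weak_dbar U (\<lambda>z. h (\<phi> z)) (\<lambda>z. g (\<phi> z) * cnj (deriv \<phi> z))"
    "(\<lambda>z. g (\<phi> z) * cnj (deriv \<phi> z)) \<in> borel_measurable (lebesgue_on U)" by (rule conjunct1, rule conjunct2)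
qed

section \<open>Harmonic functions and Harnack's inequality\<close>

lemma harmonic_on_C2:
  assumes "harmonic_on U u"
  shows "\<forall>z\<in>U. u differentiable (at z)"
    "e \<in> {1, \<i>} \<Longrightarrow> \<forall>z\<in>U. dir_deriv e u differentiable (at z)"
    "e \<in> {1, \<i>} \<Longrightarrow> d \<in> {1, \<i>} \<Longrightarrow> continuous_on U (dir_deriv d (dir_deriv e u))"
proof -
  have C: "C_k_on (Suc (Suc 0)) U u"
    using assms unfolding harmonic_on_def numeral_2_eq_2 by (rule conjunct1)
  then show "\<forall>z\<in>U. u differentiable (at z)" unfolding C_k_on.simps(2) by (rule conjunct1)
  have C1: "C_k_on (Suc 0) U (dir_deriv e u)" if "e \<in> {1, \<i>}" for e
  proof -
    note * = C[unfolded C_k_on.simps(2)[of "Suc 0"], THEN conjunct2]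
    from that have "e = 1 \<or> e = \<i>" by simp
    then show ?thesis using conjunct1[OF *] conjunct2[OF *] by (elim disjE) (simp_all only:)
  qed
  show "\<forall>z\<in>U. dir_deriv e u differentiable (at z)" if "e \<in> {1, \<i>}"
    using C1[OF that] unfolding C_k_on.simps(2) by (rule conjunct1)
  show "continuous_on U (dir_deriv d (dir_deriv e u))" if "e \<in> {1, \<i>}" "d \<in> {1, \<i>}"
  proof -
    note * = C1[OF that(1), unfolded C_k_on.simps, THEN conjunct2]
    from that(2) have "d = 1 \<or> d = \<i>" by simp
    then show ?thesis using conjunct1[OF *] conjunct2[OF *] by (elim disjE) (simp_all only:)
  qed
qed

lemma harmonic_onD:
  assumes "harmonic_on U u" "z \<in> U"
  shows "u differentiable (at z)" "e \<in> {1, \<i>} \<Longrightarrow> dir_deriv e u differentiable (at z)"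
    and "dir_deriv 1 (dir_deriv 1 u) z + dir_deriv \<i> (dir_deriv \<i> u) z = 0"
proof -
  show "u differentiable (at z)" by (rule bspec[OF harmonic_on_C2(1)[OF assms(1)] assms(2)])
  show "dir_deriv e u differentiable (at z)" if "e \<in> {1, \<i>}"
    by (rule bspec[OF harmonic_on_C2(2)[OF assms(1) that] assms(2)])
  show "dir_deriv 1 (dir_deriv 1 u) z + dir_deriv \<i> (dir_deriv \<i> u) z = 0"
    by (rule bspec[OF conjunct2[OF assms(1)[unfolded harmonic_on_def]] assms(2)])
qed

lemma harmonic_on_continuous:
  assumes "harmonic_on U u"
  shows "continuous_on U u" "e \<in> {1, \<i>} \<Longrightarrow> continuous_on U (dir_deriv e u)"
proof -
  show "continuous_on U u"
    by (rule continuous_at_imp_continuous_on, rule ballI, rule differentiable_imp_continuous_within)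
       (rule harmonic_onD(1)[OF assms])
  assume "e \<in> {1, \<i>}"
  then show "continuous_on U (dir_deriv e u)"
    using harmonic_onD(2)[OF assms]
    by (intro continuous_at_imp_continuous_on ballI differentiable_imp_continuous_within)
qed

text \<open>Differentiating twice by the chain rule and using that \<open>deriv \<phi>\<close> is complex linear, the Laplacian of
\<open>u \<circ> \<phi>\<close> is \<open>|deriv \<phi>|\<^sup>2\<close> times the Laplacian of \<open>u\<close> at \<open>\<phi> z\<close>; the mixed second derivatives and the
terms with \<open>deriv (deriv \<phi>)\<close> cancel.\<close>

lemma harmonic_on_compose_holomorphic:
  assumes u: "harmonic_on V u" and \<phi>: "\<phi> holomorphic_on U" "open U" "\<phi> ` U \<subseteq> V"
  shows "harmonic_on U (\<lambda>z. u (\<phi> z))"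
proof -
  let ?v = "\<lambda>z. u (\<phi> z)"
  let ?d1 = "deriv \<phi>" and ?d2 = "deriv (deriv \<phi>)"
  have \<phi>c: "continuous_on U \<phi>" by (rule holomorphic_on_imp_continuous_on[OF \<phi>(1)])
  have hd: "?d1 holomorphic_on U" by (rule holomorphic_deriv[OF \<phi>(1,2)])
  have cd: "continuous_on U ?d1" "continuous_on U ?d2"
    by (rule holomorphic_on_imp_continuous_on[OF hd],
        rule holomorphic_on_imp_continuous_on[OF holomorphic_deriv[OF hd \<phi>(2)]])
  have in2: "\<phi> z \<in> V" if "z \<in> U" for z using that \<phi>(3) by blast
  have D1: "(\<phi> has_field_derivative ?d1 z) (at z)" if "z \<in> U" for z
    by (rule holomorphic_derivI[OF \<phi>(1,2) that])
  have D2: "(?d1 has_derivative (\<lambda>d. ?d2 z * d)) (at z)" if "z \<in> U" for z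
    by (rule has_field_derivative_imp_has_derivative[OF holomorphic_derivI[OF hd \<phi>(2) that]])
  let ?P = "\<lambda>e z. Re (?d1 z * e) *\<^sub>R dir_deriv 1 u (\<phi> z) + Im (?d1 z * e) *\<^sub>R dir_deriv \<i> u (\<phi> z)"
  let ?U = "\<lambda>e d z. Re (?d1 z * d) *\<^sub>R dir_deriv 1 (dir_deriv e u) (\<phi> z)
      + Im (?d1 z * d) *\<^sub>R dir_deriv \<i> (dir_deriv e u) (\<phi> z)"
  let ?T = "\<lambda>e d z. (Re (?d1 z * e) *\<^sub>R ?U 1 d z + Re (?d2 z * d * e) *\<^sub>R dir_deriv 1 u (\<phi> z))
      + (Im (?d1 z * e) *\<^sub>R ?U \<i> d z + Im (?d2 z * d * e) *\<^sub>R dir_deriv \<i> u (\<phi> z))"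
  have v1: "(?v has_derivative (\<lambda>e. ?P e z)) (at z)" if "z \<in> U" for z
    by (rule has_derivative_compose_holomorphic[OF D1[OF that] harmonic_onD(1)[OF u in2[OF that]]])
  have de: "dir_deriv e ?v z = ?P e z" if "z \<in> U" for e z
    by (rule dir_deriv_eq[OF v1[OF that]])
  have P1: "(?P e has_derivative (\<lambda>d. ?T e d z)) (at z)" if z: "z \<in> U" for e z
  proof -
    have U: "((\<lambda>z. dir_deriv c u (\<phi> z)) has_derivative (\<lambda>d. ?U c d z)) (at z)" if "c \<in> {1, \<i>}" for c
      by (rule has_derivative_compose_holomorphic[OF D1[OF z] harmonic_onD(2)[OF u in2[OF z] that]])
    have E: "((\<lambda>z. ?d1 z * e) has_derivative (\<lambda>d. ?d2 z * d * e)) (at z)"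
      by (rule has_derivative_mult_left[OF D2[OF z]])
    show ?thesis
      by (intro has_derivative_add has_derivative_scaleR has_derivative_Re has_derivative_Im E U) auto
  qed
  have v2: "dir_deriv e ?v differentiable (at z)" "dir_deriv d (dir_deriv e ?v) z = ?T e d z"
    if z: "z \<in> U" for e d z
  proof -
    have eq: "\<And>w. w \<in> U \<Longrightarrow> ?P e w = dir_deriv e ?v w" by (rule de[symmetric])
    show "dir_deriv e ?v differentiable (at z)"
      by (rule dir_deriv_cong_open(1)[OF \<phi>(2) z eq P1[OF z]])
    show "dir_deriv d (dir_deriv e ?v) z = ?T e d z"
      by (rule dir_deriv_cong_open(2)[OF \<phi>(2) z eq P1[OF z]])
  qed
  have c1: "continuous_on U (\<lambda>z. dir_deriv c u (\<phi> z))" if "c \<in> {1, \<i>}" for c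
    by (rule continuous_on_compose2[OF harmonic_on_continuous(2)[OF u that] \<phi>c \<phi>(3)])
  have c2: "continuous_on U (\<lambda>z. dir_deriv d (dir_deriv c u) (\<phi> z))" if "c \<in> {1, \<i>}" "d \<in> {1, \<i>}" for c d
    by (rule continuous_on_compose2[OF harmonic_on_C2(3)[OF u that] \<phi>c \<phi>(3)])
  have "continuous_on U (?T e d)" for e d
    by (intro continuous_on_add continuous_on_scaleR continuous_on_Re continuous_on_Im continuous_on_mult
        continuous_on_const cd c1 c2) auto
  then have cT: "continuous_on U (dir_deriv d (dir_deriv e ?v))" for e d
    by (rule continuous_on_eq) (rule v2(2)[symmetric])
  have "?v differentiable (at z)" if "z \<in> U" for z using v1[OF that] by (rule differentiableI)
  then have "C_k_on 2 U ?v"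
    using v2(1) cT by (simp add: numeral_2_eq_2)
  moreover have "dir_deriv 1 (dir_deriv 1 ?v) z + dir_deriv \<i> (dir_deriv \<i> ?v) z = 0" if "z \<in> U" for z
  proof -
    let ?A = "dir_deriv 1 (dir_deriv 1 u) (\<phi> z)" and ?D = "dir_deriv \<i> (dir_deriv \<i> u) (\<phi> z)"
    have L: "?D = - ?A" using harmonic_onD(3)[OF u in2[OF that]] by linarith
    show ?thesis unfolding v2(2)[OF that] L by (simp add: algebra_simps)
  qed
  ultimately show ?thesis unfolding harmonic_on_def by blast
qed

text \<open>By the mean value theorem in direction \<open>d\<close>, the second difference is \<open>h\<close> times a difference of
directional derivatives at two points at distance \<open>h\<close> in direction \<open>e\<close>, and this difference is
controlled by differentiability of \<open>dir_deriv d u\<close> at \<open>z\<close>.\<close>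

lemma second_difference_estimate:
  fixes u :: "complex \<Rightarrow> real"
  assumes S: "open S" "z \<in> S" and u: "\<forall>w\<in>S. u differentiable (at w)"
    and ud: "dir_deriv d u differentiable (at z)" and de: "cmod d = 1" "cmod e = 1" and "0 < \<epsilon>"
  shows "\<exists>\<delta>>0. \<forall>h. 0 < h \<and> h < \<delta> \<longrightarrow>
    \<bar>(u (z + of_real h * d + of_real h * e) - u (z + of_real h * d) - u (z + of_real h * e) + u z) / h\<^sup>2
      - dir_deriv e (dir_deriv d u) z\<bar> \<le> 3 * \<epsilon>"
proof -
  let ?L = "\<lambda>k. dir_deriv k (dir_deriv d u) z"
  have L: "(dir_deriv d u has_derivative ?L) (at z)" by (rule has_derivative_dir_deriv[OF ud])
  interpret L: bounded_linear ?L by (rule has_derivative_bounded_linear[OF L])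
  obtain \<delta>1 where \<delta>1: "0 < \<delta>1" "\<And>w. cmod (w - z) < \<delta>1 \<Longrightarrow>
      \<bar>dir_deriv d u w - dir_deriv d u z - ?L (w - z)\<bar> \<le> \<epsilon> * cmod (w - z)"
    using L[unfolded has_derivative_at_alt] \<open>0 < \<epsilon>\<close> by (metis real_norm_def)
  obtain \<delta>2 where \<delta>2: "0 < \<delta>2" "ball z \<delta>2 \<subseteq> S" using S open_contains_ball by blast
  \<comment> \<open>Halved because increments of at most \<open>h\<close> in both directions add up to at most \<open>2 * h\<close>.\<close>
  define \<delta> where "\<delta> = min \<delta>1 \<delta>2 / 2"
  show ?thesis
  proof (intro exI conjI allI impI)
    show "0 < \<delta>" using \<delta>1(1) \<delta>2(1) by (simp add: \<delta>_def)
    fix h assume h: "0 < h \<and> h < \<delta>"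
    have near: "cmod (of_real s * d + of_real t * e) < min \<delta>1 \<delta>2"
      if "0 \<le> s" "s \<le> h" "0 \<le> t" "t \<le> h" for s t
    proof -
      have "cmod (of_real s * d + of_real t * e) \<le> cmod (of_real s * d) + cmod (of_real t * e)"
        by (rule norm_triangle_ineq)
      also have "\<dots> = s + t" using that de by (simp add: norm_mult)
      finally show ?thesis using that h by (simp add: \<delta>_def)
    qed
    have inS: "z + of_real s * d + of_real t * e \<in> S" if "0 \<le> s" "s \<le> h" "0 \<le> t" "t \<le> h" for s t
    proof -
      have "dist z (z + (of_real s * d + of_real t * e)) < \<delta>2"
        using near[OF that] by (simp only: dist_norm norm_minus_commute[of z] add_diff_cancel_left' min_less_iff_conj)
      then have "z + of_real s * d + of_real t * e \<in> ball z \<delta>2" by (simp only: mem_ball add.assoc)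
      then show ?thesis using \<delta>2(2) by blast
    qed
    define g where "g s = u (z + of_real s * d + of_real h * e) - u (z + of_real s * d + of_real 0 * e)" for s
    define g' where "g' s = dir_deriv d u (z + of_real s * d + of_real h * e)
        - dir_deriv d u (z + of_real s * d + of_real 0 * e)" for s
    have g': "(g has_real_derivative g' s) (at s)" if "0 \<le> s" "s \<le> h" for s
    proof -
      have "((\<lambda>s. u (z + of_real s * d + of_real t * e)) has_real_derivative
          dir_deriv d u (z + of_real s * d + of_real t * e)) (at s)" if "0 \<le> t" "t \<le> h" for t
      proof -
        let ?w = "z + of_real s * d + of_real t * e"
        have w: "u differentiable (at ?w)" by (rule u[rule_format, OF inS]) fact+
        have i: "((\<lambda>s. z + of_real s * d + of_real t * e) has_derivative (\<lambda>h. of_real h * d)) (at s)"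
          by (auto intro!: derivative_eq_intros)
        interpret bounded_linear "\<lambda>e. dir_deriv e u ?w"
          by (rule has_derivative_bounded_linear[OF has_derivative_dir_deriv[OF w]])
        have "((\<lambda>s. u (z + of_real s * d + of_real t * e)) has_derivative (\<lambda>h. dir_deriv (of_real h * d) u ?w)) (at s)"
          using diff_chain_at[OF i has_derivative_dir_deriv[OF w]] by (simp add: o_def)
        moreover have "(\<lambda>h. dir_deriv (of_real h * d) u ?w) = (*) (dir_deriv d u ?w)"
          using scaleR[of _ d] by (auto simp: scaleR_conv_of_real mult.commute fun_eq_iff)
        ultimately show ?thesis unfolding has_field_derivative_def by simp
      qed
      from DERIV_diff[OF this[of h] this[of 0]] show ?thesis
        using h unfolding g_def g'_def by simp
    qed
    obtain \<xi> where \<xi>: "0 < \<xi>" "\<xi> < h" "g h - g 0 = (h - 0) * g' \<xi>"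
      using MVT2[of 0 h g g'] h g' by auto
    have est: "\<bar>dir_deriv d u (z + of_real \<xi> * d + of_real t * e) - dir_deriv d u z
        - (\<xi> * ?L d + t * ?L e)\<bar> \<le> \<epsilon> * (\<xi> + t)" if "0 \<le> t" "t \<le> h" for t
    proof -
      let ?k = "of_real \<xi> * d + of_real t * e"
      have "cmod ?k < \<delta>1" using near[of \<xi> t] that \<xi> by simp
      then have "\<bar>dir_deriv d u (z + ?k) - dir_deriv d u z - ?L ?k\<bar> \<le> \<epsilon> * cmod ?k"
        using \<delta>1(2)[of "z + ?k"] by simp
      also have "?L ?k = \<xi> * ?L d + t * ?L e"
        using L.add[of "of_real \<xi> * d" "of_real t * e"] L.scaleR[of \<xi> d] L.scaleR[of t e]
        by (simp add: scaleR_conv_of_real)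
      also have "\<epsilon> * cmod ?k \<le> \<epsilon> * (\<xi> + t)"
      proof (rule mult_left_mono)
        have "cmod ?k \<le> cmod (of_real \<xi> * d) + cmod (of_real t * e)" by (rule norm_triangle_ineq)
        then show "cmod ?k \<le> \<xi> + t" using that \<xi> de by (simp add: norm_mult)
      qed (use \<open>0 < \<epsilon>\<close> in simp)
      finally show ?thesis by (simp add: add.assoc)
    qed
    have "\<bar>g' \<xi> - h * ?L e\<bar> \<le> \<epsilon> * (\<xi> + h) + \<epsilon> * (\<xi> + 0)"
      using est[of h] est[of 0] h unfolding g'_def by simp
    also have "\<dots> \<le> 3 * \<epsilon> * h"
      using \<xi> \<open>0 < \<epsilon>\<close> by (simp add: algebra_simps)
    finally have "\<bar>g' \<xi> - h * ?L e\<bar> \<le> 3 * \<epsilon> * h" .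
    moreover have "(g h - g 0) / h\<^sup>2 - ?L e = (g' \<xi> - h * ?L e) / h"
      using \<xi>(3) h by (simp add: field_simps power2_eq_square)
    ultimately have "\<bar>(g h - g 0) / h\<^sup>2 - ?L e\<bar> \<le> 3 * \<epsilon>"
      using h by (simp add: abs_divide divide_le_eq)
    moreover have "g h - g 0 = u (z + of_real h * d + of_real h * e) - u (z + of_real h * d) - u (z + of_real h * e) + u z"
      unfolding g_def by simp
    ultimately show "\<bar>(u (z + of_real h * d + of_real h * e) - u (z + of_real h * d) - u (z + of_real h * e) + u z) / h\<^sup>2
      - ?L e\<bar> \<le> 3 * \<epsilon>" by simp
  qed
qed

text \<open>Young's theorem: the second difference is symmetric in the two directions, so both iterated
derivatives are its limit.\<close>

lemma mixed_dir_derivs_commute: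
  fixes u :: "complex \<Rightarrow> real"
  assumes S: "open S" "z \<in> S" and u: "\<forall>w\<in>S. u differentiable (at w)"
    and ud: "dir_deriv d u differentiable (at z)" "dir_deriv e u differentiable (at z)"
    and de: "cmod d = 1" "cmod e = 1"
  shows "dir_deriv e (dir_deriv d u) z = dir_deriv d (dir_deriv e u) z"
proof -
  let ?a = "dir_deriv e (dir_deriv d u) z" and ?b = "dir_deriv d (dir_deriv e u) z"
  have "\<bar>?a - ?b\<bar> \<le> 0 + \<epsilon>" if "0 < \<epsilon>" for \<epsilon>
  proof -
    let ?\<Delta> = "\<lambda>h. (u (z + of_real h * d + of_real h * e) - u (z + of_real h * d) - u (z + of_real h * e) + u z) / h\<^sup>2"
    have e6: "0 < \<epsilon> / 6" using that by simp
    obtain \<delta>1 where \<delta>1: "\<delta>1 > 0" "\<And>h. 0 < h \<and> h < \<delta>1 \<Longrightarrow> \<bar>?\<Delta> h - ?a\<bar> \<le> 3 * (\<epsilon> / 6)"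
      using second_difference_estimate[OF S u ud(1) de e6] by blast
    have sym: "z + of_real h * e + of_real h * d = z + of_real h * d + of_real h * e" for h :: real by simp
    obtain \<delta>2 where \<delta>2: "\<delta>2 > 0" "\<And>h. 0 < h \<and> h < \<delta>2 \<Longrightarrow>
       \<bar>(u (z + of_real h * e + of_real h * d) - u (z + of_real h * e) - u (z + of_real h * d) + u z) / h\<^sup>2 - ?b\<bar> \<le> 3 * (\<epsilon> / 6)"
      using second_difference_estimate[OF S u ud(2) de(2,1) e6] by blast
    let ?h = "min \<delta>1 \<delta>2 / 2"
    have h: "0 < ?h \<and> ?h < \<delta>1" "0 < ?h \<and> ?h < \<delta>2" using \<delta>1(1) \<delta>2(1) by auto
    have "(u (z + of_real ?h * e + of_real ?h * d) - u (z + of_real ?h * e) - u (z + of_real ?h * d) + u z) / ?h\<^sup>2 = ?\<Delta> ?h"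
      unfolding sym by (simp add: algebra_simps)
    then show ?thesis using \<delta>1(2)[OF h(1)] \<delta>2(2)[OF h(2)] by linarith
  qed
  then have "\<bar>?a - ?b\<bar> \<le> 0" by (rule field_le_epsilon)
  then show ?thesis by simp
qed

text \<open>The function \<open>u_x - i u_y\<close> satisfies the Cauchy-Riemann equations, one of them being harmonicity and the
other the symmetry of the mixed derivatives. Its primitive on the ball has real part \<open>u\<close> up to a
constant.\<close>

lemma harmonic_on_ball_eq_Re_holomorphic:
  assumes u: "harmonic_on U u" and "open U" "ball a R \<subseteq> U"
  obtains F where "F holomorphic_on ball a R" "\<And>z. z \<in> ball a R \<Longrightarrow> Re (F z) = u z"
proof -
  \<comment> \<open>This is twice the derivative of \<open>u\<close> with respect to \<open>z\<close>, so its primitive is the function sought.\<close>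
  define g where "g z = Complex (dir_deriv 1 u z) (- dir_deriv \<i> u z)" for z
  have gd: "(g has_field_derivative Complex (dir_deriv 1 (dir_deriv 1 u) z) (- dir_deriv \<i> (dir_deriv 1 u) z)) (at z)"
    if z: "z \<in> U" for z
  proof -
    note ux = harmonic_onD(2)[OF u z, of 1, simplified] and uy = harmonic_onD(2)[OF u z, of \<i>, simplified]
    let ?p = "dir_deriv 1 (dir_deriv 1 u) z" and ?q = "dir_deriv \<i> (dir_deriv 1 u) z"
    have sym: "dir_deriv 1 (dir_deriv \<i> u) z = ?q"
      by (rule mixed_dir_derivs_commute[OF assms(2) z harmonic_on_C2(1)[OF u] uy ux]) simp_all
    have L: "dir_deriv \<i> (dir_deriv \<i> u) z = - ?p" using harmonic_onD(3)[OF u z] by linarith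
    have "g = (\<lambda>z. of_real (dir_deriv 1 u z) - \<i> * of_real (dir_deriv \<i> u z))"
      by (rule ext) (simp add: g_def complex_eq_iff)
    moreover have "((\<lambda>z. of_real (dir_deriv 1 u z) - \<i> * of_real (dir_deriv \<i> u z)) has_derivative
      (\<lambda>e. complex_of_real (dir_deriv e (dir_deriv 1 u) z) - \<i> * of_real (dir_deriv e (dir_deriv \<i> u) z))) (at z)"
      by (intro has_derivative_diff has_derivative_mult_right has_derivative_of_real has_derivative_dir_deriv ux uy)
    moreover have "(\<lambda>e. complex_of_real (dir_deriv e (dir_deriv 1 u) z) - \<i> * of_real (dir_deriv e (dir_deriv \<i> u) z))
       = (*) (Complex ?p (- ?q))"
    proof
      fix e
      show "complex_of_real (dir_deriv e (dir_deriv 1 u) z) - \<i> * of_real (dir_deriv e (dir_deriv \<i> u) z) = Complex ?p (- ?q) * e"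
        by (simp add: dir_deriv_decompose[OF ux, of e] dir_deriv_decompose[OF uy, of e] sym L complex_eq_iff algebra_simps)
    qed
    ultimately show ?thesis unfolding has_field_derivative_def by simp
  qed
  have "g holomorphic_on ball a R"
    unfolding holomorphic_on_open[OF open_ball] using gd subsetD[OF assms(3)] by fast
  then obtain F0 where F0: "\<And>z. z \<in> ball a R \<Longrightarrow> (F0 has_field_derivative g z) (at z within ball a R)"
    by (rule holomorphic_convex_primitive'[OF convex_ball open_ball]) (rule that)
  have "\<exists>c. \<forall>z\<in>ball a R. u z - Re (F0 z) = c"
  proof (rule has_derivative_zero_constant[OF convex_ball])
    fix z assume z: "z \<in> ball a R"
    then have zU: "z \<in> U" using assms(3) by blast
    note ud = harmonic_onD(1)[OF u zU]
    have "(F0 has_derivative (*) (g z)) (at z)"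
      using F0[OF z] z by (simp add: at_within_open[OF _ open_ball] has_field_derivative_def)
    then have "((\<lambda>z. u z - Re (F0 z)) has_derivative (\<lambda>e. dir_deriv e u z - Re (g z * e))) (at z)"
      by (intro has_derivative_diff has_derivative_dir_deriv ud has_derivative_Re)
    moreover have "(\<lambda>e. dir_deriv e u z - Re (g z * e)) = (\<lambda>e. 0)"
    proof
      fix e
      show "dir_deriv e u z - Re (g z * e) = 0"
        by (simp add: dir_deriv_decompose[OF ud, of e] g_def)
    qed
    ultimately show "((\<lambda>z. u z - Re (F0 z)) has_derivative (\<lambda>e. 0)) (at z within ball a R)"
      by (simp add: has_derivative_at_withinI)
  qed
  then obtain c where c: "\<And>z. z \<in> ball a R \<Longrightarrow> u z - Re (F0 z) = c" by blast
  show thesis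
  proof (rule that)
    have "F0 holomorphic_on ball a R" 
      unfolding holomorphic_on_def field_differentiable_def using F0 by fast
    then show "(\<lambda>z. F0 z + of_real c) holomorphic_on ball a R" by (intro holomorphic_intros)
    show "Re (F0 z + of_real c) = u z" if "z \<in> ball a R" for z using c[OF that] by simp
  qed
qed

lemma norm_diff_less_norm_add:
  assumes "0 < Re x" "0 < A" shows "cmod (x - of_real A) < cmod (x + of_real A)"
proof -
  have "(Re x - A)\<^sup>2 < (Re x + A)\<^sup>2" using mult_pos_pos[OF assms] by (simp add: power2_eq_square algebra_simps)
  then show ?thesis unfolding cmod_def by simp
qed

text \<open>Harnack's inequality from the Schwarz lemma: \<open>u\<close> is the real part of a holomorphic map \<open>F\<close> into the
right half-plane, and the Cayley transform centred at \<open>F a\<close> takes this half-plane to the unit disc.\<close>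

lemma harnack_ball:
  assumes u: "harmonic_on U u" "\<And>z. z \<in> U \<Longrightarrow> 0 \<le> u z" and "open U" "ball a R \<subseteq> U" "0 < R"
    and z: "cmod (z - a) \<le> R / 2"
  shows "u z \<le> 3 * u a"
proof -
  obtain F where F: "F holomorphic_on ball a R" "\<And>z. z \<in> ball a R \<Longrightarrow> Re (F z) = u z"
    by (rule harmonic_on_ball_eq_Re_holomorphic[OF u(1) assms(3,4)]) (rule that)
  have "u z \<le> 3 * u a + \<epsilon>" if "0 < \<epsilon>" for \<epsilon>
  proof -
    \<comment> \<open>Adding \<open>\<eta>\<close> makes the real part strictly positive, so that the Cayley transform has no poles.\<close>
    define \<eta> where "\<eta> = \<epsilon> / 3"
    have \<eta>: "0 < \<eta>" using that by (simp add: \<eta>_def)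
    define A where "A = u a + \<eta>"
    \<comment> \<open>Subtracting \<open>Im (F a)\<close> makes the centre value the real number \<open>A\<close>.\<close>
    define X where "X \<zeta> = F (a + of_real R * \<zeta>) + of_real \<eta> - \<i> * of_real (Im (F a))" for \<zeta>
    define W where "W \<zeta> = (X \<zeta> - of_real A) / (X \<zeta> + of_real A)" for \<zeta>
    have aR: "a \<in> ball a R" using assms(5) by simp
    have A: "0 < A" using \<eta> u(2)[of a] assms(4) aR unfolding A_def by (meson add_nonneg_pos subsetD)
    have im: "a + of_real R * \<zeta> \<in> ball a R" if "cmod \<zeta> < 1" for \<zeta>
      using that assms(5) by (simp add: dist_norm norm_mult)
    have ReX: "Re (X \<zeta>) = u (a + of_real R * \<zeta>) + \<eta>" if "cmod \<zeta> < 1" for \<zeta>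
      using F(2)[OF im[OF that]] by (simp add: X_def)
    have Xpos: "0 < Re (X \<zeta>)" if "cmod \<zeta> < 1" for \<zeta>
      using ReX[OF that] u(2)[of "a + of_real R * \<zeta>"] im[OF that] assms(4) \<eta> by (simp add: subset_iff)
    have X0: "X 0 = of_real A" using F(2)[OF aR] by (simp add: X_def A_def complex_eq_iff)
    have den: "X \<zeta> + of_real A \<noteq> 0" if "cmod \<zeta> < 1" for \<zeta>
    proof
      assume "X \<zeta> + of_real A = 0"
      then have "Re (X \<zeta> + of_real A) = 0" by simp
      then show False using Xpos[OF that] A by simp
    qed
    have holX: "X holomorphic_on ball 0 1"
    proof -
      have "(\<lambda>\<zeta>. F (a + of_real R * \<zeta>)) holomorphic_on ball 0 1"
      proof (rule holomorphic_on_compose_gen[of "\<lambda>\<zeta>. a + of_real R * \<zeta>" _ F "ball a R", unfolded o_def])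
        show "(\<lambda>\<zeta>. a + of_real R * \<zeta>) holomorphic_on ball 0 1" by (intro holomorphic_intros)
        show "(\<lambda>\<zeta>. a + of_real R * \<zeta>) ` ball 0 1 \<subseteq> ball a R" using im by auto
      qed (rule F(1))
      then show ?thesis unfolding X_def by (intro holomorphic_intros)
    qed
    have "W holomorphic_on ball 0 1"
      unfolding W_def by (intro holomorphic_intros holX) (use den in auto)
    moreover have "W 0 = 0" by (simp add: W_def X0)
    moreover have "norm (W \<zeta>) < 1" if "norm \<zeta> < 1" for \<zeta>
      using norm_diff_less_norm_add[OF Xpos[OF that] A] den[OF that] by (simp add: W_def norm_divide)
    moreover define \<zeta> where "\<zeta> = (z - a) / of_real R"
    have \<zeta>: "cmod \<zeta> \<le> 1 / 2" using z assms(5) by (simp add: \<zeta>_def norm_divide divide_le_eq)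
    then have \<zeta>1: "cmod \<zeta> < 1" by simp
    ultimately have "norm (W \<zeta>) \<le> norm \<zeta>" using Schwarz_Lemma(1) by blast
    then have "cmod (X \<zeta> - of_real A) / cmod (X \<zeta> + of_real A) \<le> 1 / 2"
      unfolding W_def norm_divide using \<zeta> by (rule order_trans)
    then have "cmod (X \<zeta> - of_real A) \<le> cmod (X \<zeta> + of_real A) / 2"
      using den[OF \<zeta>1] by (simp add: divide_le_eq)
    moreover have "cmod (X \<zeta> + of_real A) \<le> cmod (X \<zeta>) + A"
      using norm_triangle_ineq[of "X \<zeta>" "of_real A"] A by simp
    moreover have "cmod (X \<zeta>) - A \<le> cmod (X \<zeta> - of_real A)"
      using norm_triangle_ineq2[of "X \<zeta>" "of_real A"] A by simp
    ultimately have "cmod (X \<zeta>) \<le> 3 * A" by linarith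
    then have "Re (X \<zeta>) \<le> 3 * A" using complex_Re_le_cmod[of "X \<zeta>"] by linarith
    moreover have "a + of_real R * \<zeta> = z" using assms(5) by (simp add: \<zeta>_def)
    ultimately have "u z + \<eta> \<le> 3 * (u a + \<eta>)" using ReX[OF \<zeta>1] by (simp add: A_def)
    then show ?thesis using \<eta> by (simp add: \<eta>_def)
  qed
  then show ?thesis by (rule field_le_epsilon)
qed

text \<open>Comparability of the values at two points, uniformly over all nonnegative harmonic functions, is an
equivalence relation between points. By \<open>harnack_ball\<close> its classes are open, so on a connected set
there is only one.\<close>

lemma harnack_two_points:
  assumes "open U" "connected U" "a \<in> U" "b \<in> U"
  shows "\<exists>K>0. \<forall>u. harmonic_on U u \<and> (\<forall>z\<in>U. 0 \<le> u z) \<longrightarrow> u a \<le> K * u b"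
proof -
  define pos where "pos = {u. harmonic_on U u \<and> (\<forall>z\<in>U. 0 \<le> u z)}"
  define E where "E x y \<longleftrightarrow> (\<exists>K>0. \<forall>u\<in>pos. u x \<le> K * u y \<and> u y \<le> K * u x)" for x y
  have "E a b"
  proof (rule connected_equivalence_relation[OF assms(2-4)])
    show "E y x" if "E x y" for x y using that unfolding E_def by blast
    show "E x z" if "E x y" "E y z" for x y z
    proof -
      obtain K where K: "K > 0" "\<forall>u\<in>pos. u x \<le> K * u y \<and> u y \<le> K * u x" using \<open>E x y\<close> unfolding E_def by blast
      obtain L where L: "L > 0" "\<forall>u\<in>pos. u y \<le> L * u z \<and> u z \<le> L * u y" using \<open>E y z\<close> unfolding E_def by blast
      show ?thesis unfolding E_def
      proof (intro exI[of _ "K * L"] conjI ballI)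
        show "0 < K * L" using K(1) L(1) by simp
        fix u assume u: "u \<in> pos"
        have "u x \<le> K * u y" "u y \<le> L * u z" "u z \<le> L * u y" "u y \<le> K * u x" using K(2) L(2) u by blast+
        then have "u x \<le> K * u y" "K * u y \<le> K * (L * u z)" "u z \<le> L * u y" "L * u y \<le> L * (K * u x)"
          using K(1) L(1) by simp_all
        then show "u x \<le> K * L * u z" "u z \<le> K * L * u x" by (simp_all only: ac_simps)
      qed
    qed
    fix c assume c: "c \<in> U"
    obtain R where R: "0 < R" "ball c R \<subseteq> U" using assms(1) c open_contains_ball by blast
    \<comment> \<open>For \<open>x\<close> within \<open>R / 3\<close> of \<open>c\<close>, the ball of radius \<open>2 * R / 3\<close> about \<open>x\<close> stays in the domain and has \<open>c\<close> in its half, so \<open>harnack_ball\<close> applies both ways.\<close>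
    show "\<exists>T. openin (top_of_set U) T \<and> c \<in> T \<and> (\<forall>x\<in>T. E c x)"
    proof (intro exI[of _ "ball c (R/3)"] conjI ballI)
      show "openin (top_of_set U) (ball c (R/3))"
        by (rule open_subset) (use R subset_ball[of "R/3" R c] in auto)
      show "c \<in> ball c (R/3)" using R(1) by simp
      fix x assume "x \<in> ball c (R/3)"
      then have x: "cmod (x - c) < R / 3" by (simp add: dist_norm norm_minus_commute)
      have sub: "ball x (2 * R / 3) \<subseteq> U"
      proof -
        have "ball x (2 * R / 3) \<subseteq> ball c R"
        proof
          fix w assume "w \<in> ball x (2 * R / 3)"
          then have "cmod (w - x) < 2 * R / 3" by (simp add: dist_norm norm_minus_commute)
          then have "cmod (w - c) < R" using norm_triangle_ineq[of "w - x" "x - c"] x by simp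
          then show "w \<in> ball c R" by (simp add: dist_norm norm_minus_commute)
        qed
        then show ?thesis using R(2) by blast
      qed
      show "E c x" unfolding E_def
      proof (intro exI[of _ 3] conjI ballI)
        fix u assume "u \<in> pos"
        then have u: "harmonic_on U u" "\<And>z. z \<in> U \<Longrightarrow> 0 \<le> u z" unfolding pos_def by auto
        show "u x \<le> 3 * u c" by (rule harnack_ball[OF u assms(1) R(2,1)]) (use x R(1) in auto)
        show "u c \<le> 3 * u x"
          by (rule harnack_ball[OF u assms(1) sub]) (use x R(1) in \<open>auto simp: norm_minus_commute\<close>)
      qed simp
    qed
  qed
  then show ?thesis unfolding E_def pos_def by blast
qed

section \<open>Uniqueness of weak derivatives and Lipschitz functions\<close>

lemma L_infinity_bounded_representative:
  assumes "f \<in> L_infinity U"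
  obtains f' B where "f' \<in> borel_measurable (lebesgue_on U)" "\<And>z. cmod (f' z) \<le> B"
    "AE z in lebesgue_on U. f' z = f z"
proof -
  have m: "f \<in> borel_measurable (lebesgue_on U)" and "\<exists>M. AE z in lebesgue_on U. cmod (f z) \<le> M"
    using assms unfolding L_infinity_def by simp_all
  then obtain M where M: "AE z in lebesgue_on U. cmod (f z) \<le> M" by (elim exE)
  show thesis
  proof (rule that[of "\<lambda>z. if cmod (f z) \<le> M then f z else 0" "max M 0"])
    show "(\<lambda>z. if cmod (f z) \<le> M then f z else 0) \<in> borel_measurable (lebesgue_on U)"
      using m by measurable
    show "cmod (if cmod (f z) \<le> M then f z else 0) \<le> max M 0" for z by auto
    show "AE z in lebesgue_on U. (if cmod (f z) \<le> M then f z else 0) = f z"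
      using M by (rule AE_mp) simp
  qed
qed

lemma integral_mult_AE_cong:
  fixes F G \<psi> :: "complex \<Rightarrow> complex"
  assumes "F \<in> borel_measurable (lebesgue_on U)" "G \<in> borel_measurable (lebesgue_on U)"
    "AE z in lebesgue_on U. F z = G z" "continuous_on UNIV \<psi>"
  shows "(LINT z|lebesgue_on U. F z * \<psi> z) = (LINT z|lebesgue_on U. G z * \<psi> z)"
proof (rule integral_cong_AE)
  note \<psi> = continuous_measurable_lebesgue_on[OF assms(4)]
  show "(\<lambda>z. F z * \<psi> z) \<in> borel_measurable (lebesgue_on U)" by (rule borel_measurable_times[OF assms(1) \<psi>])
  show "(\<lambda>z. G z * \<psi> z) \<in> borel_measurable (lebesgue_on U)" by (rule borel_measurable_times[OF assms(2) \<psi>])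
  show "AE z in lebesgue_on U. F z * \<psi> z = G z * \<psi> z" using assms(3) by (rule AE_mp) simp
qed

lemma weak_dbar_AE_cong:
  assumes "weak_dbar U f F" "F \<in> borel_measurable (lebesgue_on U)" "G \<in> borel_measurable (lebesgue_on U)"
    "AE z in lebesgue_on U. F z = G z"
  shows "weak_dbar U f G"
  unfolding weak_dbar_def
proof
  fix \<psi> assume \<psi>: "\<psi> \<in> test_functions U"
  show "(LINT z|lebesgue_on U. f z * dbar \<psi> z) = - (LINT z|lebesgue_on U. G z * \<psi> z)"
    using bspec[OF assms(1)[unfolded weak_dbar_def] \<psi>]
      integral_mult_AE_cong[OF assms(2-4) test_functionsD(6)[OF \<psi>]] by simp
qed

lemma integrable_mult_test:
  assumes "open U" "locally_bounded_measurable U F" "\<psi> \<in> test_functions U"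
  shows "integrable (lebesgue_on U) (\<lambda>z. F z * \<psi> z)" "integrable (lebesgue_on U) (\<lambda>z. F z * dbar \<psi> z)"
    "e \<in> {1, \<i>} \<Longrightarrow> integrable (lebesgue_on U) (\<lambda>z. F z * dir_deriv e \<psi> z)"
proof -
  note T = test_functionsD[OF assms(3)] and Td = test_function_dbar[OF assms(3)]
  have m: "F \<in> borel_measurable (lebesgue_on U)"
    using assms(2) unfolding locally_bounded_measurable_def by (rule conjunct1)
  have "\<exists>B. \<forall>z\<in>supp \<psi>. cmod (F z) \<le> B"
    using assms(2) T(1,2) unfolding locally_bounded_measurable_def by blast
  then obtain B where B: "\<forall>z\<in>supp \<psi>. cmod (F z) \<le> B" by (elim exE)
  note I = integrable_mult_support[OF assms(1) m T(1,2) bspec[OF B]]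
  show "integrable (lebesgue_on U) (\<lambda>z. F z * \<psi> z)" by (rule I[OF _ T(6)]) (assumption, rule T(3))
  show "integrable (lebesgue_on U) (\<lambda>z. F z * dbar \<psi> z)" by (rule I[OF _ Td(1)]) (assumption, rule Td(2))
  show "integrable (lebesgue_on U) (\<lambda>z. F z * dir_deriv e \<psi> z)" if "e \<in> {1, \<i>}"
    by (rule I[OF _ T(7)[OF that]]) (assumption, rule T(4))
qed

lemma weak_dbar_diff:
  assumes "open U" "weak_dbar U f F" "weak_dbar U g G"
    and "continuous_on U f" "continuous_on U g" "locally_bounded_measurable U F" "locally_bounded_measurable U G"
  shows "weak_dbar U (\<lambda>z. f z - g z) (\<lambda>z. F z - G z)"
  unfolding weak_dbar_def
proof
  fix \<psi> assume \<psi>: "\<psi> \<in> test_functions U"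
  note lb = continuous_locally_bounded_measurable[OF assms(1)]
  note i = integrable_mult_test[OF assms(1) _ \<psi>]
  have "(LINT z|lebesgue_on U. (f z - g z) * dbar \<psi> z) =
      (LINT z|lebesgue_on U. f z * dbar \<psi> z) - (LINT z|lebesgue_on U. g z * dbar \<psi> z)"
    unfolding left_diff_distrib
    by (rule Bochner_Integration.integral_diff) (rule i(2)[OF lb[OF assms(4)]], rule i(2)[OF lb[OF assms(5)]])
  moreover have "(LINT z|lebesgue_on U. (F z - G z) * \<psi> z) =
      (LINT z|lebesgue_on U. F z * \<psi> z) - (LINT z|lebesgue_on U. G z * \<psi> z)"
    unfolding left_diff_distrib
    by (rule Bochner_Integration.integral_diff) (rule i(1)[OF assms(6)], rule i(1)[OF assms(7)])
  ultimately show "(LINT z|lebesgue_on U. (f z - g z) * dbar \<psi> z) = - (LINT z|lebesgue_on U. (F z - G z) * \<psi> z)"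
    using bspec[OF assms(2)[unfolded weak_dbar_def] \<psi>] bspec[OF assms(3)[unfolded weak_dbar_def] \<psi>] by simp
qed

lemma weak_dbar_unique:
  assumes "open U" "continuous_on U f" "weak_dbar U f F" "weak_dbar U f G"
    and F: "F \<in> borel_measurable (lebesgue_on U)" "\<And>z. cmod (F z) \<le> B"
    and G: "G \<in> borel_measurable (lebesgue_on U)" "\<And>z. cmod (G z) \<le> C"
  shows "AE z in lebesgue_on U. F z = G z"
proof -
  have weak: "weak_dbar U (\<lambda>z. f z - f z) (\<lambda>z. F z - G z)"
    by (rule weak_dbar_diff[OF assms(1,3,4,2,2) bounded_locally_bounded_measurable[OF F]
          bounded_locally_bounded_measurable[OF G]])
  have "AE z in lebesgue_on U. F z - G z = 0"
  proof (rule du_Bois_Reymond[OF assms(1)])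
    show "(\<lambda>z. F z - G z) \<in> borel_measurable (lebesgue_on U)" using F(1) G(1) by (rule borel_measurable_diff)
    show "cmod (F z - G z) \<le> B + C" for z
      by (rule order_trans[OF norm_triangle_ineq4 add_mono[OF F(2) G(2)]])
    show "(LINT z|lebesgue_on U. (F z - G z) * \<psi> z) = 0" if "\<psi> \<in> test_functions U" for \<psi>
      using bspec[OF weak[unfolded weak_dbar_def] that] by simp
  qed
  then show ?thesis by (rule AE_mp) simp
qed

text \<open>The classical derivative is a weak one, so it agrees almost everywhere with a bounded function, and
by continuity the bound holds everywhere. As \<open>deriv \<phi>\<close> is not yet known to be bounded, the comparison
is made on discs whose closure is contained in the domain.\<close>

lemma deriv_bounded_of_W_1_infinity:
  assumes "open U" "\<phi> holomorphic_on U" "\<phi> \<in> W_1_infinity U"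
  obtains M where "\<And>z. z \<in> U \<Longrightarrow> cmod (deriv \<phi> z) \<le> M"
proof -
  obtain g where g: "g \<in> L_infinity U" "weak_dir_deriv U 1 \<phi> g"
    using assms(3) unfolding W_1_infinity_def by blast
  obtain g' M where g': "g' \<in> borel_measurable (lebesgue_on U)" "\<And>z. cmod (g' z) \<le> M"
    "AE z in lebesgue_on U. g' z = g z"
    by (rule L_infinity_bounded_representative[OF g(1)]) (rule that)
  have gm: "g \<in> borel_measurable (lebesgue_on U)" using g(1) unfolding L_infinity_def by simp
  have c: "continuous_on U (deriv \<phi>)"
    by (intro holomorphic_on_imp_continuous_on holomorphic_deriv assms)
  have d: "(\<phi> has_derivative (*) (deriv \<phi> z)) (at z)" if "z \<in> U" for z
    using holomorphic_derivI[OF assms(2,1) that] unfolding has_field_derivative_def .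
  have d1: "dir_deriv 1 \<phi> z = deriv \<phi> z" if "z \<in> U" for z
    using dir_deriv_eq[OF d[OF that], of 1] by simp
  have "cmod (deriv \<phi> z) \<le> M" if z: "z \<in> U" for z
  proof -
    obtain r where r: "r > 0" "cball z r \<subseteq> U" using assms(1) z open_contains_cball by blast
    let ?D = "ball z r"
    have D: "?D \<subseteq> U" using r(2) ball_subset_cball by blast
    obtain b where b: "\<forall>w\<in>cball z r. cmod (deriv \<phi> w) \<le> b"
      using continuous_locally_bounded_measurable[OF assms(1) c] r(2) compact_cball
      unfolding locally_bounded_measurable_def by blast
    have mD: "F \<in> borel_measurable (lebesgue_on ?D)" if "F \<in> borel_measurable (lebesgue_on U)" for F :: "complex \<Rightarrow> complex"
    proof -
      have "lebesgue_on ?D = restrict_space (lebesgue_on U) ?D"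
        using restrict_restrict_space[of U lebesgue ?D] assms(1) D by (simp add: Int_absorb1)
      then show ?thesis using measurable_restrict_space1[OF that] by simp
    qed
    have "AE w in lebesgue_on ?D. deriv \<phi> w - g' w = 0"
    proof (rule du_Bois_Reymond[OF open_ball])
      show "(\<lambda>w. deriv \<phi> w - g' w) \<in> borel_measurable (lebesgue_on ?D)"
        by (intro borel_measurable_diff mD g'(1) continuous_on_imp_measurable[OF assms(1) c])
      show "cmod (deriv \<phi> w - g' w) \<le> b + M" if "w \<in> ?D" for w
        by (rule order_trans[OF norm_triangle_ineq4 add_mono[OF _ g'(2)]]) (use b that in auto)
      fix \<psi> assume \<psi>D: "\<psi> \<in> test_functions ?D"
      have \<psi>: "\<psi> \<in> test_functions U" using \<psi>D D unfolding test_functions_def by auto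
      note T = test_functionsD[OF \<psi>D]
      have z0: "F w * \<psi> w = 0" if "w \<notin> ?D" for F w
        unfolding T(3)[OF contra_subsetD[OF T(2) that]] by simp
      note i = integrable_mult_test(1)[OF assms(1) _ \<psi>]
      have "(LINT w|lebesgue_on ?D. (deriv \<phi> w - g' w) * \<psi> w) = (LINT w|lebesgue. (deriv \<phi> w - g' w) * \<psi> w)"
        by (rule integral_lebesgue_on_support[OF open_ball]) (rule z0)
      also have "\<dots> = (LINT w|lebesgue_on U. (deriv \<phi> w - g' w) * \<psi> w)"
        by (rule integral_lebesgue_on_support[OF assms(1), symmetric]) (rule z0, rule contra_subsetD[OF D])
      also have "\<dots> = (LINT w|lebesgue_on U. deriv \<phi> w * \<psi> w) - (LINT w|lebesgue_on U. g' w * \<psi> w)"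
        unfolding left_diff_distrib
        by (rule Bochner_Integration.integral_diff)
           (rule i[OF continuous_locally_bounded_measurable[OF assms(1) c]],
            rule i[OF bounded_locally_bounded_measurable[OF g'(1,2)]])
      also have "(LINT w|lebesgue_on U. g' w * \<psi> w) = (LINT w|lebesgue_on U. g w * \<psi> w)"
        by (rule integral_mult_AE_cong[OF g'(1) gm g'(3) T(6)])
      also have "\<dots> = - (LINT w|lebesgue_on U. \<phi> w * dir_deriv 1 \<psi> w)"
        using bspec[OF g(2)[unfolded weak_dir_deriv_def] \<psi>] by simp
      also have "(LINT w|lebesgue_on U. \<phi> w * dir_deriv 1 \<psi> w) = - (LINT w|lebesgue_on U. dir_deriv 1 \<phi> w * \<psi> w)"
      proof (rule integral_by_parts_test[OF assms(1) _ _ _ \<psi>])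
        show "continuous_on U (dir_deriv 1 \<phi>)"
          by (rule continuous_on_eq[OF c]) (rule d1[symmetric])
        show "\<phi> differentiable at w" if "w \<in> U" for w by (rule differentiableI[OF d[OF that]])
      qed simp
      also have "(LINT w|lebesgue_on U. dir_deriv 1 \<phi> w * \<psi> w) = (LINT w|lebesgue_on U. deriv \<phi> w * \<psi> w)"
        by (rule Bochner_Integration.integral_cong) (simp_all add: d1)
      finally show "(LINT w|lebesgue_on ?D. (deriv \<phi> w - g' w) * \<psi> w) = 0" by simp
    qed
    then have ae: "AE w in lebesgue_on ?D. cmod (deriv \<phi> w) \<le> M"
      by (rule AE_mp) (auto intro!: AE_I2 simp: g'(2))
    show ?thesis
      by (rule continuous_le_of_AE_le[OF open_ball _ continuous_on_const ae])
         (use r(1) in \<open>auto intro!: continuous_intros continuous_on_subset[OF c D]\<close>)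
  qed
  then show thesis by (rule that)
qed

lemma test_functions_cnj:
  assumes "\<psi> \<in> test_functions U"
  shows "(\<lambda>z. cnj (\<psi> z)) \<in> test_functions U" "dir_deriv e (\<lambda>z. cnj (\<psi> z)) z = cnj (dir_deriv e \<psi> z)"
proof -
  have "C_k_on k UNIV (\<lambda>z. cnj (\<psi> z))" for k
    using assms unfolding test_functions_def by (intro C_k_on_bounded_linear[OF bounded_linear_cnj]) simp
  then show "(\<lambda>z. cnj (\<psi> z)) \<in> test_functions U"
    using assms unfolding test_functions_def by simp
  show "dir_deriv e (\<lambda>z. cnj (\<psi> z)) z = cnj (dir_deriv e \<psi> z)"
    by (rule dir_deriv_eq[OF bounded_linear.has_derivative[OF bounded_linear_cnj
          has_derivative_dir_deriv[OF test_functionsD(5)[OF assms]]]])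
qed

text \<open>For real-valued \<open>\<nu>\<close>, testing with \<open>\<psi>\<close> and with \<open>cnj \<psi>\<close> separates the two real directional
derivatives, which are \<open>2 * Re N\<close> and \<open>2 * Im N\<close>.\<close>

lemma W_1_infinity_of_real_weak_dbar:
  fixes \<nu> :: "complex \<Rightarrow> real"
  assumes "open U" "continuous_on U \<nu>" "\<And>z. z \<in> U \<Longrightarrow> \<bar>\<nu> z\<bar> \<le> \<kappa>"
    and N: "N \<in> borel_measurable (lebesgue_on U)" "\<And>z. z \<in> U \<Longrightarrow> cmod (N z) \<le> B"
    and weak: "weak_dbar U (\<lambda>z. of_real (\<nu> z)) N"
  shows "(\<lambda>z. complex_of_real (\<nu> z)) \<in> W_1_infinity U"
proof -
  let ?v = "\<lambda>z. complex_of_real (\<nu> z)"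
  have vc: "continuous_on U ?v" by (intro continuous_intros assms)
  note vl = continuous_locally_bounded_measurable[OF assms(1) vc]
  have cN: "(\<lambda>z. cnj (N z)) \<in> borel_measurable (lebesgue_on U)"
    by (rule measurable_compose[OF N(1)])
       (intro borel_measurable_continuous_onI continuous_on_cnj continuous_on_id)
  have Nl: "locally_bounded_measurable U N" "locally_bounded_measurable U (\<lambda>z. cnj (N z))"
    using bounded_locally_bounded_measurable[OF N] bounded_locally_bounded_measurable[OF cN, of B] N(2) by simp_all
  have key: "(LINT z|lebesgue_on U. ?v z * dir_deriv 1 \<psi> z) =
       - ((LINT z|lebesgue_on U. N z * \<psi> z) + (LINT z|lebesgue_on U. cnj (N z) * \<psi> z))"
     "(LINT z|lebesgue_on U. ?v z * dir_deriv \<i> \<psi> z) =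
       \<i> * ((LINT z|lebesgue_on U. N z * \<psi> z) - (LINT z|lebesgue_on U. cnj (N z) * \<psi> z))"
    if \<psi>: "\<psi> \<in> test_functions U" for \<psi>
  proof -
    let ?A1 = "LINT z|lebesgue_on U. ?v z * dir_deriv 1 \<psi> z" and ?Ai = "LINT z|lebesgue_on U. ?v z * dir_deriv \<i> \<psi> z"
    let ?J = "LINT z|lebesgue_on U. N z * \<psi> z" and ?J' = "LINT z|lebesgue_on U. cnj (N z) * \<psi> z"
    note i1 = integrable_mult_test(3)[OF assms(1) vl \<psi>, of 1, simplified]
      and i2 = integrable_mult_test(3)[OF assms(1) vl \<psi>, of \<i>, simplified]
    have "(LINT z|lebesgue_on U. ?v z * dbar \<psi> z) =
       (LINT z|lebesgue_on U. (?v z * dir_deriv 1 \<psi> z + \<i> * (?v z * dir_deriv \<i> \<psi> z)) / 2)"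
      by (rule Bochner_Integration.integral_cong) (simp_all add: dbar_def algebra_simps)
    also have "\<dots> = (?A1 + \<i> * ?Ai) / 2" using i1 i2 by simp
    finally have 1: "(?A1 + \<i> * ?Ai) / 2 = - ?J"
      using bspec[OF weak[unfolded weak_dbar_def] \<psi>] by simp
    have "(LINT z|lebesgue_on U. ?v z * dbar (\<lambda>z. cnj (\<psi> z)) z) =
       (LINT z|lebesgue_on U. cnj ((?v z * dir_deriv 1 \<psi> z - \<i> * (?v z * dir_deriv \<i> \<psi> z)) / 2))"
      by (rule Bochner_Integration.integral_cong)
         (simp_all add: dbar_def test_functions_cnj(2)[OF \<psi>] algebra_simps)
    also have "\<dots> = cnj (LINT z|lebesgue_on U. (?v z * dir_deriv 1 \<psi> z - \<i> * (?v z * dir_deriv \<i> \<psi> z)) / 2)"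
      by (rule integral_bounded_linear[OF bounded_linear_cnj]) (simp add: i1 i2)
    also have "\<dots> = cnj ((?A1 - \<i> * ?Ai) / 2)" using i1 i2 by simp
    finally have "cnj ((?A1 - \<i> * ?Ai) / 2) = - (LINT z|lebesgue_on U. N z * cnj (\<psi> z))"
      using bspec[OF weak[unfolded weak_dbar_def] test_functions_cnj(1)[OF \<psi>]] by simp
    also have "(LINT z|lebesgue_on U. N z * cnj (\<psi> z)) = (LINT z|lebesgue_on U. cnj (cnj (N z) * \<psi> z))"
      by (rule Bochner_Integration.integral_cong) simp_all
    also have "\<dots> = cnj ?J'"
      by (rule integral_bounded_linear[OF bounded_linear_cnj integrable_mult_test(1)[OF assms(1) Nl(2) \<psi>]])
    finally have "cnj ((?A1 - \<i> * ?Ai) / 2) = cnj (- ?J')" by simp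
    then have 2: "(?A1 - \<i> * ?Ai) / 2 = - ?J'" by (simp only: complex_cnj_cancel_iff)
    have "?A1 = (?A1 + \<i> * ?Ai) / 2 + (?A1 - \<i> * ?Ai) / 2" by (simp add: field_simps)
    then show "?A1 = - (?J + ?J')" unfolding 1 2 by simp
    have "?Ai = - \<i> * ((?A1 + \<i> * ?Ai) / 2 - (?A1 - \<i> * ?Ai) / 2)" by (simp add: field_simps)
    then show "?Ai = \<i> * (?J - ?J')" unfolding 1 2 by (simp add: algebra_simps)
  qed
  have Linf: "F \<in> L_infinity U" if "F \<in> borel_measurable (lebesgue_on U)" "\<And>z. z \<in> U \<Longrightarrow> cmod (F z) \<le> b" for F b
    using that unfolding L_infinity_def by (auto intro!: exI[of _ b] AE_I2)
  have "\<exists>g\<in>L_infinity U. weak_dir_deriv U e ?v g" if "e \<in> {1, \<i>}" for e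
  proof -
    \<comment> \<open>These are \<open>2 * Re N\<close> and \<open>2 * Im N\<close>.\<close>
    define g where "g = (if e = 1 then (\<lambda>z. N z + cnj (N z)) else (\<lambda>z. - \<i> * (N z - cnj (N z))))"
    have "g \<in> L_infinity U"
    proof (rule Linf)
      show "g \<in> borel_measurable (lebesgue_on U)" unfolding g_def using N(1) cN by simp
      show "cmod (g z) \<le> B + B" if "z \<in> U" for z
        using N(2)[OF that] norm_triangle_ineq[of "N z" "cnj (N z)"] norm_triangle_ineq4[of "N z" "cnj (N z)"]
        by (simp add: g_def norm_mult)
    qed
    moreover have "weak_dir_deriv U e ?v g" unfolding weak_dir_deriv_def
    proof
      fix \<psi> assume \<psi>: "\<psi> \<in> test_functions U"
      note n = integrable_mult_test(1)[OF assms(1) Nl(1) \<psi>] integrable_mult_test(1)[OF assms(1) Nl(2) \<psi>]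
      show "(LINT z|lebesgue_on U. ?v z * dir_deriv e \<psi> z) = - (LINT z|lebesgue_on U. g z * \<psi> z)"
      proof (cases "e = 1")
        case True
        have "(LINT z|lebesgue_on U. g z * \<psi> z) = (LINT z|lebesgue_on U. N z * \<psi> z + cnj (N z) * \<psi> z)"
          by (rule Bochner_Integration.integral_cong) (simp_all add: g_def True algebra_simps)
        then show ?thesis using key(1)[OF \<psi>] n True by simp
      next
        case False
        then have e: "e = \<i>" using that by simp
        have "(LINT z|lebesgue_on U. g z * \<psi> z) = (LINT z|lebesgue_on U. - \<i> * (N z * \<psi> z - cnj (N z) * \<psi> z))"
          by (rule Bochner_Integration.integral_cong) (simp_all add: g_def False algebra_simps)
        also have "\<dots> = - \<i> * ((LINT z|lebesgue_on U. N z * \<psi> z) - (LINT z|lebesgue_on U. cnj (N z) * \<psi> z))"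
          using n by simp
        finally show ?thesis using key(2)[OF \<psi>] unfolding e by simp
      qed
    qed
    ultimately show ?thesis by blast
  qed
  moreover have "?v \<in> L_infinity U"
    by (rule Linf[OF continuous_on_imp_measurable[OF assms(1) vc], of \<kappa>]) (simp add: assms(3))
  ultimately show ?thesis unfolding W_1_infinity_def by blast
qed

section \<open>Solutions of the conjugate Beltrami equation\<close>

text \<open>The equation in divergence form. Collecting the terms with \<open>dbar \<psi>\<close> shows that the defining identity
is a statement about the weak derivative of \<open>f - \<nu> * cnj f\<close>, to which the chain rule applies.\<close>

lemma CB_identity_iff:
  fixes f N :: "complex \<Rightarrow> complex" and \<nu> :: "complex \<Rightarrow> real"
  assumes "open U" "continuous_on U f" "continuous_on U \<nu>" "locally_bounded_measurable U N"
    and \<psi>: "\<psi> \<in> test_functions U"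
  shows "(LINT z|lebesgue_on U. f z * dbar \<psi> z) =
      (LINT z|lebesgue_on U. cnj (f z) * (of_real (\<nu> z) * dbar \<psi> z + N z * \<psi> z)) \<longleftrightarrow>
    (LINT z|lebesgue_on U. (f z - of_real (\<nu> z) * cnj (f z)) * dbar \<psi> z) =
      - (LINT z|lebesgue_on U. (- (N z * cnj (f z))) * \<psi> z)"
proof -
  note lb = continuous_locally_bounded_measurable[OF assms(1)]
  have fc: "continuous_on U (\<lambda>z. of_real (\<nu> z) * cnj (f z))" "continuous_on U (\<lambda>z. cnj (f z))"
    by (intro continuous_intros assms)+
  note i1 = integrable_mult_test(2)[OF assms(1) lb[OF assms(2)] \<psi>]
    and i2 = integrable_mult_test(2)[OF assms(1) lb[OF fc(1)] \<psi>]
    and i3 = integrable_mult_test(1)[OF assms(1) locally_bounded_measurable_mult[OF assms(4) lb[OF fc(2)]] \<psi>]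
  have "(LINT z|lebesgue_on U. cnj (f z) * (of_real (\<nu> z) * dbar \<psi> z + N z * \<psi> z)) =
      (LINT z|lebesgue_on U. of_real (\<nu> z) * cnj (f z) * dbar \<psi> z + N z * cnj (f z) * \<psi> z)"
    by (rule Bochner_Integration.integral_cong) (simp_all add: algebra_simps)
  also have "\<dots> = (LINT z|lebesgue_on U. of_real (\<nu> z) * cnj (f z) * dbar \<psi> z) + (LINT z|lebesgue_on U. N z * cnj (f z) * \<psi> z)"
    by (rule Bochner_Integration.integral_add[OF i2 i3])
  finally have R: "(LINT z|lebesgue_on U. cnj (f z) * (of_real (\<nu> z) * dbar \<psi> z + N z * \<psi> z)) = \<dots>" .
  have L: "(LINT z|lebesgue_on U. (f z - of_real (\<nu> z) * cnj (f z)) * dbar \<psi> z) =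
     (LINT z|lebesgue_on U. f z * dbar \<psi> z) - (LINT z|lebesgue_on U. of_real (\<nu> z) * cnj (f z) * dbar \<psi> z)"
    unfolding left_diff_distrib by (rule Bochner_Integration.integral_diff[OF i1 i2])
  have M: "(LINT z|lebesgue_on U. (- (N z * cnj (f z))) * \<psi> z) = - (LINT z|lebesgue_on U. N z * cnj (f z) * \<psi> z)"
    unfolding minus_mult_left[symmetric] by (rule integral_minus)
  show ?thesis unfolding R L M by (auto simp: algebra_simps)
qed

lemma CB_solutionsE:
  fixes \<nu> :: "complex \<Rightarrow> real"
  assumes "open U" "continuous_on U \<nu>" "f \<in> CB_solutions U \<nu>"
  obtains N B where "N \<in> borel_measurable (lebesgue_on U)" "\<And>z. cmod (N z) \<le> B"
    "weak_dbar U (\<lambda>z. of_real (\<nu> z)) N"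
    "weak_dbar U (\<lambda>z. f z - of_real (\<nu> z) * cnj (f z)) (\<lambda>z. - (N z * cnj (f z)))"
proof -
  let ?rhs = "\<lambda>N \<psi> z. cnj (f z) * (of_real (\<nu> z) * dbar \<psi> z + N z * \<psi> z)"
  have fc: "continuous_on U f" using assms(3) unfolding CB_solutions_def by simp
  obtain N0 where N0: "N0 \<in> L_infinity U" "weak_dbar U (\<lambda>z. of_real (\<nu> z)) N0"
    "\<forall>\<psi>\<in>test_functions U. (LINT z|lebesgue_on U. f z * dbar \<psi> z) = (LINT z|lebesgue_on U. ?rhs N0 \<psi> z)"
    using assms(3) unfolding CB_solutions_def by (elim CollectE conjE bexE)
  obtain N B where N: "N \<in> borel_measurable (lebesgue_on U)" "\<And>z. cmod (N z) \<le> B"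
    "AE z in lebesgue_on U. N z = N0 z"
    by (rule L_infinity_bounded_representative[OF N0(1)]) (rule that)
  have N0m: "N0 \<in> borel_measurable (lebesgue_on U)" using N0(1) unfolding L_infinity_def by simp
  have N': "AE z in lebesgue_on U. N0 z = N z" using N(3) by (rule AE_mp) simp
  show thesis
  proof (rule that[OF N(1,2) weak_dbar_AE_cong[OF N0(2) N0m N(1) N']])
    show "weak_dbar U (\<lambda>z. f z - of_real (\<nu> z) * cnj (f z)) (\<lambda>z. - (N z * cnj (f z)))"
      unfolding weak_dbar_def
    proof
      fix \<psi> assume \<psi>: "\<psi> \<in> test_functions U"
      have "(LINT z|lebesgue_on U. f z * dbar \<psi> z) =
          (LINT z|lebesgue_on U. ?rhs N0 \<psi> z)"
        by (rule bspec[OF N0(3) \<psi>])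
      also have "\<dots> = (LINT z|lebesgue_on U. ?rhs N \<psi> z)"
      proof (rule integral_cong_AE)
        have m: "(\<lambda>z. cnj (f z)) \<in> borel_measurable (lebesgue_on U)"
          "(\<lambda>z. complex_of_real (\<nu> z)) \<in> borel_measurable (lebesgue_on U)"
          by (intro continuous_on_imp_measurable[OF assms(1)] continuous_intros fc assms(2))+
        note m' = continuous_measurable_lebesgue_on[OF test_function_dbar(1)[OF \<psi>]]
          continuous_measurable_lebesgue_on[OF test_functionsD(6)[OF \<psi>]]
        show "?rhs N0 \<psi> \<in> borel_measurable (lebesgue_on U)"
          by (intro borel_measurable_times borel_measurable_add m m' N0m)
        show "?rhs N \<psi> \<in> borel_measurable (lebesgue_on U)"
          by (intro borel_measurable_times borel_measurable_add m m' N(1))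
        show "AE z in lebesgue_on U. ?rhs N0 \<psi> z = ?rhs N \<psi> z"
          using N' by (rule AE_mp) simp
      qed
      finally show "(LINT z|lebesgue_on U. (f z - of_real (\<nu> z) * cnj (f z)) * dbar \<psi> z) =
          - (LINT z|lebesgue_on U. (- (N z * cnj (f z))) * \<psi> z)"
        unfolding CB_identity_iff[OF assms(1) fc assms(2) bounded_locally_bounded_measurable[OF N(1,2)] \<psi>] .
    qed
  qed
qed

lemma CB_solutionsI:
  fixes \<nu> :: "complex \<Rightarrow> real"
  assumes "open U" "continuous_on U \<nu>" "continuous_on U f"
    and N: "N \<in> borel_measurable (lebesgue_on U)" "\<And>z. z \<in> U \<Longrightarrow> cmod (N z) \<le> B"
    and weak: "weak_dbar U (\<lambda>z. of_real (\<nu> z)) N"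
      "weak_dbar U (\<lambda>z. f z - of_real (\<nu> z) * cnj (f z)) (\<lambda>z. - (N z * cnj (f z)))"
  shows "f \<in> CB_solutions U \<nu>"
proof -
  have Nl: "locally_bounded_measurable U N"
    by (rule bounded_locally_bounded_measurable[OF N(1)]) (rule N(2))
  have "N \<in> L_infinity U"
    using N unfolding L_infinity_def by (auto intro!: exI[of _ B] AE_I2)
  moreover have "\<forall>\<psi>\<in>test_functions U. (LINT z|lebesgue_on U. f z * dbar \<psi> z) =
       (LINT z|lebesgue_on U. cnj (f z) * (of_real (\<nu> z) * dbar \<psi> z + N z * \<psi> z))"
    by (rule ballI, rule iffD2[OF CB_identity_iff[OF assms(1,3,2) Nl]], assumption)
       (rule bspec[OF weak(2)[unfolded weak_dbar_def]])
  ultimately show ?thesis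
    using weak(1) assms(3) unfolding CB_solutions_def by blast
qed

lemma CB_solutions_continuous: "f \<in> CB_solutions U \<nu> \<Longrightarrow> continuous_on U f"
  unfolding CB_solutions_def by simp

text \<open>The weak derivatives of \<open>\<nu>\<close> that witness the two equations may differ on a null set; by
\<open>weak_dbar_unique\<close> one of them serves both.\<close>

lemma CB_solutions_diff:
  fixes \<nu> :: "complex \<Rightarrow> real"
  assumes "open U" "continuous_on U \<nu>" "f \<in> CB_solutions U \<nu>" "g \<in> CB_solutions U \<nu>"
  shows "(\<lambda>z. g z - f z) \<in> CB_solutions U \<nu>"
proof -
  note fc = CB_solutions_continuous[OF assms(3)] and gc = CB_solutions_continuous[OF assms(4)]
  obtain N B where N: "N \<in> borel_measurable (lebesgue_on U)" "\<And>z. cmod (N z) \<le> B"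
    "weak_dbar U (\<lambda>z. of_real (\<nu> z)) N"
    "weak_dbar U (\<lambda>z. f z - of_real (\<nu> z) * cnj (f z)) (\<lambda>z. - (N z * cnj (f z)))"
    by (rule CB_solutionsE[OF assms(1-3)]) (rule that)
  obtain N' B' where N': "N' \<in> borel_measurable (lebesgue_on U)" "\<And>z. cmod (N' z) \<le> B'"
    "weak_dbar U (\<lambda>z. of_real (\<nu> z)) N'"
    "weak_dbar U (\<lambda>z. g z - of_real (\<nu> z) * cnj (g z)) (\<lambda>z. - (N' z * cnj (g z)))"
    by (rule CB_solutionsE[OF assms(1,2,4)]) (rule that)
  have eq: "AE z in lebesgue_on U. N' z = N z"
    by (rule weak_dbar_unique[OF assms(1) continuous_on_of_real[OF assms(2)] N'(3) N(3) N'(1,2) N(1,2)])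
  have c: "continuous_on U (\<lambda>z. cnj (f z))" "continuous_on U (\<lambda>z. cnj (g z))"
    "continuous_on U (\<lambda>z. f z - of_real (\<nu> z) * cnj (f z))" "continuous_on U (\<lambda>z. g z - of_real (\<nu> z) * cnj (g z))"
    by (intro continuous_intros fc gc assms(2))+
  have mc: "(\<lambda>z. cnj (g z)) \<in> borel_measurable (lebesgue_on U)"
    by (rule continuous_on_imp_measurable[OF assms(1) c(2)])
  have Ng: "weak_dbar U (\<lambda>z. g z - of_real (\<nu> z) * cnj (g z)) (\<lambda>z. - (N z * cnj (g z)))"
  proof (rule weak_dbar_AE_cong[OF N'(4)])
    show "AE z in lebesgue_on U. - (N' z * cnj (g z)) = - (N z * cnj (g z))" using eq by (rule AE_mp) simp
  qed (intro borel_measurable_uminus borel_measurable_times N(1) N'(1) mc)+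
  note lb = continuous_locally_bounded_measurable[OF assms(1)]
  note Nl = bounded_locally_bounded_measurable[OF N(1,2)]
  have l: "locally_bounded_measurable U (\<lambda>z. - (N z * k z))" if "continuous_on U k" for k
    using locally_bounded_measurable_mult[OF Nl lb[OF continuous_on_minus[OF that]]] by simp
  have "weak_dbar U (\<lambda>z. (g z - of_real (\<nu> z) * cnj (g z)) - (f z - of_real (\<nu> z) * cnj (f z)))
     (\<lambda>z. - (N z * cnj (g z)) - - (N z * cnj (f z)))"
    by (rule weak_dbar_diff[OF assms(1) Ng N(4) c(4,3) l[OF c(2)] l[OF c(1)]])
  also have "(\<lambda>z. (g z - of_real (\<nu> z) * cnj (g z)) - (f z - of_real (\<nu> z) * cnj (f z))) =
      (\<lambda>z. (g z - f z) - of_real (\<nu> z) * cnj (g z - f z))"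
    by (rule ext) (simp add: algebra_simps)
  also have "(\<lambda>z. - (N z * cnj (g z)) - - (N z * cnj (f z))) = (\<lambda>z. - (N z * cnj (g z - f z)))"
    by (rule ext) (simp add: algebra_simps)
  finally show ?thesis
    by (intro CB_solutionsI[OF assms(1,2) continuous_on_diff[OF gc fc] N(1,2,3)])
qed

text \<open>Apply the chain rule to \<open>\<nu>\<close> and to \<open>f - \<nu> * cnj f\<close>: both produce the same new coefficient
\<open>(N \<circ> \<phi>) * cnj (deriv \<phi>)\<close>, which is bounded because \<open>deriv \<phi>\<close> is.\<close>

lemma CB_solutions_compose:
  fixes \<nu> :: "complex \<Rightarrow> real"
  assumes \<phi>: "\<phi> holomorphic_on U" "open U" "connected U" "\<phi> ` U \<subseteq> V"
    and \<phi>': "\<phi> \<in> W_1_infinity U" and "open V" "continuous_on V \<nu>"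
    and bd: "\<forall>z\<in>V. \<bar>\<nu> z\<bar> \<le> \<kappa>" and f: "f \<in> CB_solutions V \<nu>"
  shows "f \<circ> \<phi> \<in> CB_solutions U (\<nu> \<circ> \<phi>)"
    and "(\<lambda>z. complex_of_real ((\<nu> \<circ> \<phi>) z)) \<in> W_1_infinity U"
proof -
  note fc = CB_solutions_continuous[OF f]
  note \<phi>c = holomorphic_on_imp_continuous_on[OF \<phi>(1)]
  obtain N B where N: "N \<in> borel_measurable (lebesgue_on V)" "\<And>z. cmod (N z) \<le> B"
    "weak_dbar V (\<lambda>z. of_real (\<nu> z)) N"
    "weak_dbar V (\<lambda>z. f z - of_real (\<nu> z) * cnj (f z)) (\<lambda>z. - (N z * cnj (f z)))"
    by (rule CB_solutionsE[OF assms(6,7) f]) (rule that)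
  obtain M where M: "\<And>z. z \<in> U \<Longrightarrow> cmod (deriv \<phi> z) \<le> M"
    by (rule deriv_bounded_of_W_1_infinity[OF \<phi>(2,1) \<phi>']) (rule that)
  let ?N = "\<lambda>z. N (\<phi> z) * cnj (deriv \<phi> z)"
  have c: "continuous_on V (\<lambda>z. complex_of_real (\<nu> z))"
    "continuous_on V (\<lambda>z. f z - of_real (\<nu> z) * cnj (f z))" "continuous_on V (\<lambda>z. - cnj (f z))"
    by (intro continuous_intros fc assms(7))+
  note Nl = bounded_locally_bounded_measurable[OF N(1,2)]
  have Nl2: "locally_bounded_measurable V (\<lambda>z. - (N z * cnj (f z)))"
    using locally_bounded_measurable_mult[OF Nl continuous_locally_bounded_measurable[OF assms(6) c(3)]] by simp
  note comp = holomorphic_weak_dbar_compose[OF \<phi>(1-3) assms(6) \<phi>(4)]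
  have w1: "weak_dbar U (\<lambda>z. of_real ((\<nu> \<circ> \<phi>) z)) ?N"
    unfolding o_def by (rule comp(1)[OF c(1) Nl N(3)])
  have m: "?N \<in> borel_measurable (lebesgue_on U)"
    by (rule comp(2)[OF c(1) Nl N(3)])
  have w2: "weak_dbar U (\<lambda>z. (f \<circ> \<phi>) z - of_real ((\<nu> \<circ> \<phi>) z) * cnj ((f \<circ> \<phi>) z)) (\<lambda>z. - (?N z * cnj ((f \<circ> \<phi>) z)))"
  proof -
    have "(\<lambda>z. - (?N z * cnj ((f \<circ> \<phi>) z))) = (\<lambda>z. - (N (\<phi> z) * cnj (f (\<phi> z))) * cnj (deriv \<phi> z))"
      by (rule ext) simp
    then show ?thesis using comp(1)[OF c(2) Nl2 N(4)] by (simp only: o_def)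
  qed
  have Nb: "cmod (?N z) \<le> B * M" if "z \<in> U" for z
    unfolding norm_mult complex_mod_cnj
    by (rule mult_mono[OF N(2) M[OF that] order_trans[OF norm_ge_zero N(2)] norm_ge_zero])
  have \<nu>c: "continuous_on U (\<nu> \<circ> \<phi>)" and fc1: "continuous_on U (f \<circ> \<phi>)"
    by (rule continuous_on_compose[OF \<phi>c continuous_on_subset[OF assms(7) \<phi>(4)]],
        rule continuous_on_compose[OF \<phi>c continuous_on_subset[OF fc \<phi>(4)]])
  show "f \<circ> \<phi> \<in> CB_solutions U (\<nu> \<circ> \<phi>)"
    by (rule CB_solutionsI[OF \<phi>(2) \<nu>c fc1 m _ w1 w2]) (rule Nb)
  show "(\<lambda>z. complex_of_real ((\<nu> \<circ> \<phi>) z)) \<in> W_1_infinity U"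
  proof (rule W_1_infinity_of_real_weak_dbar[OF \<phi>(2) \<nu>c _ m _ w1])
    show "\<bar>(\<nu> \<circ> \<phi>) z\<bar> \<le> \<kappa>" if "z \<in> U" for z using bd \<phi>(4) that by auto
  qed (rule Nb)
qed

section \<open>Harmonic majorants\<close>

lemma harmonic_on_add_scale:
  fixes u v :: "complex \<Rightarrow> real"
  assumes u: "harmonic_on U u" and v: "harmonic_on U v" and "open U"
  shows "harmonic_on U (\<lambda>z. c * (u z + v z))"
proof -
  let ?w = "\<lambda>z. c * (u z + v z)"
  have w1: "(?w has_derivative (\<lambda>e. c * (dir_deriv e u z + dir_deriv e v z))) (at z)" if "z \<in> U" for z
    by (intro has_derivative_mult_right has_derivative_add has_derivative_dir_deriv harmonic_onD(1)[OF u that] harmonic_onD(1)[OF v that])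
  have d1: "c * (dir_deriv e u z + dir_deriv e v z) = dir_deriv e ?w z" if "z \<in> U" for e z
    by (rule dir_deriv_eq[OF w1[OF that], symmetric])
  have w2: "((\<lambda>z. c * (dir_deriv e u z + dir_deriv e v z)) has_derivative
     (\<lambda>d. c * (dir_deriv d (dir_deriv e u) z + dir_deriv d (dir_deriv e v) z))) (at z)"
    if "z \<in> U" "e \<in> {1, \<i>}" for e z
    by (intro has_derivative_mult_right has_derivative_add has_derivative_dir_deriv
        harmonic_onD(2)[OF u that] harmonic_onD(2)[OF v that])
  have d2: "dir_deriv e ?w differentiable (at z)"
    "dir_deriv d (dir_deriv e ?w) z = c * (dir_deriv d (dir_deriv e u) z + dir_deriv d (dir_deriv e v) z)"
    if "z \<in> U" "e \<in> {1, \<i>}" for e d z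
    by (rule dir_deriv_cong_open[OF assms(3) that(1) _ w2[OF that]], rule d1, assumption)+
  have "continuous_on U (\<lambda>z. c * (dir_deriv d (dir_deriv e u) z + dir_deriv d (dir_deriv e v) z))"
    if "e \<in> {1, \<i>}" "d \<in> {1, \<i>}" for e d
    by (intro continuous_intros harmonic_on_C2(3)[OF u that] harmonic_on_C2(3)[OF v that])
  then have c: "continuous_on U (dir_deriv d (dir_deriv e ?w))" if "e \<in> {1, \<i>}" "d \<in> {1, \<i>}" for e d
    by (rule continuous_on_eq[OF _ d2(2)[symmetric]]) (use that in auto)
  have "?w differentiable (at z)" if "z \<in> U" for z using w1[OF that] by (rule differentiableI)
  then have "C_k_on 2 U ?w"
    using d2(1) c by (simp add: numeral_2_eq_2)
  moreover have "dir_deriv 1 (dir_deriv 1 ?w) z + dir_deriv \<i> (dir_deriv \<i> ?w) z = 0" if z: "z \<in> U" for z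
  proof -
    have "dir_deriv 1 (dir_deriv 1 ?w) z + dir_deriv \<i> (dir_deriv \<i> ?w) z =
      c * ((dir_deriv 1 (dir_deriv 1 u) z + dir_deriv \<i> (dir_deriv \<i> u) z) +
           (dir_deriv 1 (dir_deriv 1 v) z + dir_deriv \<i> (dir_deriv \<i> v) z))"
      using d2(2)[OF z, of 1 1] d2(2)[OF z, of \<i> \<i>] by (simp add: algebra_simps)
    then show ?thesis by (simp only: harmonic_onD(3)[OF u z] harmonic_onD(3)[OF v z]) simp
  qed
  ultimately show ?thesis unfolding harmonic_on_def by blast
qed

text \<open>Both sides of the majorant inequality are continuous, so it holds everywhere. Only then can it be
composed with \<open>\<phi>\<close>, which might be constant.\<close>

lemma harmonic_majorants_iff:
  assumes "open U" "continuous_on U f" "0 < p"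
  shows "u \<in> harmonic_majorants p U f \<longleftrightarrow> harmonic_on U u \<and> (\<forall>z\<in>U. 0 \<le> u z \<and> cmod (f z) powr p \<le> u z)"
    (is "?L \<longleftrightarrow> ?R")
proof
  assume ?L
  then have u: "harmonic_on U u" "\<forall>z\<in>U. 0 \<le> u z" "AE z in lebesgue_on U. cmod (f z) powr p \<le> u z"
    unfolding harmonic_majorants_def by auto
  have "continuous_on U (\<lambda>z. cmod (f z) powr p)"
    using assms(3) by (intro continuous_on_powr' continuous_intros assms(2)) auto
  from continuous_le_of_AE_le[OF assms(1) this harmonic_on_continuous(1)[OF u(1)] u(3)]
  show ?R using u(1,2) by blast
next
  assume ?R
  then show ?L unfolding harmonic_majorants_def by (auto intro!: AE_I2)
qed

lemma harmonic_majorants_compose: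
  assumes \<phi>: "\<phi> holomorphic_on U" "open U" "\<phi> ` U \<subseteq> V" and "open V" "continuous_on V f" "0 < p"
    and u: "u \<in> harmonic_majorants p V f"
  shows "u \<circ> \<phi> \<in> harmonic_majorants p U (f \<circ> \<phi>)"
proof -
  have c: "continuous_on U (f \<circ> \<phi>)"
    by (rule continuous_on_compose[OF holomorphic_on_imp_continuous_on[OF \<phi>(1)]
          continuous_on_subset[OF assms(5) \<phi>(3)]])
  note u' = u[unfolded harmonic_majorants_iff[OF assms(4-6)]]
  have "harmonic_on U (\<lambda>z. u (\<phi> z))"
    by (rule harmonic_on_compose_holomorphic[OF conjunct1[OF u'] \<phi>])
  moreover have "0 \<le> u (\<phi> z) \<and> cmod (f (\<phi> z)) powr p \<le> u (\<phi> z)" if "z \<in> U" for z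
    using bspec[OF conjunct2[OF u'] subsetD[OF \<phi>(3) imageI[OF that]]] .
  ultimately show ?thesis
    unfolding harmonic_majorants_iff[OF \<phi>(2) c assms(6)] by (simp add: o_def)
qed

lemma powr_diff_le:
  assumes "0 < p" shows "cmod (x - y) powr p \<le> 2 powr p * (cmod x powr p + cmod y powr p)"
proof -
  let ?m = "max (cmod x) (cmod y)"
  have "cmod (x - y) \<le> 2 * ?m" using norm_triangle_ineq4[of x y] by linarith
  then have "cmod (x - y) powr p \<le> (2 * ?m) powr p" using assms by (intro powr_mono2) auto
  also have "\<dots> = 2 powr p * ?m powr p" by (simp add: powr_mult)
  also have "?m powr p \<le> cmod x powr p + cmod y powr p" by (auto simp: max_def)
  finally show ?thesis by simp
qed

text \<open>From \<open>|a - b| \<le> 2 * max |a| |b|\<close>; the factor \<open>2 powr p\<close> is harmless, because only existence of a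
majorant of the difference is needed.\<close>

lemma harmonic_majorants_diff:
  assumes "open U" "continuous_on U f" "continuous_on U g" "0 < p"
    and "u \<in> harmonic_majorants p U f" "v \<in> harmonic_majorants p U g"
  shows "(\<lambda>z. 2 powr p * (v z + u z)) \<in> harmonic_majorants p U (\<lambda>z. g z - f z)"
proof -
  note u = assms(5)[unfolded harmonic_majorants_iff[OF assms(1,2,4)]]
    and v = assms(6)[unfolded harmonic_majorants_iff[OF assms(1,3,4)]]
  show ?thesis
    unfolding harmonic_majorants_iff[OF assms(1) continuous_on_diff[OF assms(3,2)] assms(4)]
  proof (intro conjI ballI)
    show "harmonic_on U (\<lambda>z. 2 powr p * (v z + u z))"
      by (rule harmonic_on_add_scale[OF conjunct1[OF v] conjunct1[OF u] assms(1)])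
    fix z assume z: "z \<in> U"
    have uz: "0 \<le> u z" "cmod (f z) powr p \<le> u z" and vz: "0 \<le> v z" "cmod (g z) powr p \<le> v z"
      using u v z by blast+
    show "0 \<le> 2 powr p * (v z + u z)" using uz vz by simp
    have "cmod (g z - f z) powr p \<le> 2 powr p * (cmod (g z) powr p + cmod (f z) powr p)"
      by (rule powr_diff_le[OF assms(4)])
    also have "\<dots> \<le> 2 powr p * (v z + u z)" using uz vz by (intro mult_left_mono add_mono) auto
    finally show "cmod (g z - f z) powr p \<le> 2 powr p * (v z + u z)" .
  qed
qed

text \<open>Every majorant \<open>u\<close> of \<open>f\<close> yields the majorant \<open>u \<circ> \<phi>\<close> of \<open>f \<circ> \<phi>\<close>, whose value at \<open>z1\<close> is at most
the Harnack constant of the points \<open>\<phi> z1\<close> and \<open>z2\<close> times \<open>u z2\<close>.\<close>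

lemma majorant_norm_compose_le:
  assumes \<phi>: "\<phi> holomorphic_on U" "open U" "\<phi> ` U \<subseteq> V"
    and V: "open V" "connected V" "z1 \<in> U" "z2 \<in> V" and "0 < p"
  shows "\<exists>K>0. \<forall>f. continuous_on V f \<and> harmonic_majorants p V f \<noteq> {} \<longrightarrow>
    majorant_norm p U z1 (f \<circ> \<phi>) \<le> K * majorant_norm p V z2 f"
proof -
  have "\<phi> z1 \<in> V" using \<phi>(3) V(3) by blast
  then obtain K where K: "0 < K"
    "\<forall>u. harmonic_on V u \<and> (\<forall>z\<in>V. 0 \<le> u z) \<longrightarrow> u (\<phi> z1) \<le> K * u z2"
    using harnack_two_points[OF V(1,2) _ V(4)] by blast
  show ?thesis
  proof (intro exI conjI allI impI)
    show K': "0 < K powr (1 / p)" using K(1) by simp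
    fix f assume "continuous_on V f \<and> harmonic_majorants p V f \<noteq> {}"
    then have f: "continuous_on V f" "harmonic_majorants p V f \<noteq> {}" by blast+
    have "majorant_norm p U z1 (f \<circ> \<phi>) / K powr (1 / p) \<le> u z2 powr (1 / p)"
      if u: "u \<in> harmonic_majorants p V f" for u
    proof -
      note u' = u[unfolded harmonic_majorants_iff[OF V(1) f(1) \<open>0 < p\<close>]]
      have pos: "0 \<le> u z" if "z \<in> V" for z using u' that by blast
      have "majorant_norm p U z1 (f \<circ> \<phi>) \<le> (u \<circ> \<phi>) z1 powr (1 / p)"
        unfolding majorant_norm_def
        by (rule cINF_lower[OF _ harmonic_majorants_compose[OF \<phi> V(1) f(1) \<open>0 < p\<close> u]])
           (auto intro: bdd_belowI2[of _ 0])
      also have "\<dots> \<le> (K * u z2) powr (1 / p)"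
      proof (rule powr_mono2)
        show "(u \<circ> \<phi>) z1 \<le> K * u z2" using K(2) u' by simp
      qed (use pos[OF \<open>\<phi> z1 \<in> V\<close>] \<open>0 < p\<close> in auto)
      also have "\<dots> = K powr (1 / p) * u z2 powr (1 / p)"
        by (simp add: powr_mult)
      finally show ?thesis using K' by (simp add: divide_le_eq mult.commute)
    qed
    then have "majorant_norm p U z1 (f \<circ> \<phi>) / K powr (1 / p) \<le> majorant_norm p V z2 f"
      unfolding majorant_norm_def[of p V] by (rule cINF_greatest[OF f(2)])
    then show "majorant_norm p U z1 (f \<circ> \<phi>) \<le> K powr (1 / p) * majorant_norm p V z2 f"
      using K' by (simp add: divide_le_eq mult.commute)
  qed
qed

theorem proposition3:
  fixes p \<kappa> :: real
    and \<Omega>1 \<Omega>2 :: "complex set"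
    and \<Delta>1 \<Delta>2 :: "nat \<Rightarrow> complex set"
    and \<nu> :: "complex \<Rightarrow> real"
    and \<phi> :: "complex \<Rightarrow> complex"
  assumes "1 < p"
    and "bounded_Dini_smooth_domain \<Omega>1" and "bounded_Dini_smooth_domain \<Omega>2"
    and "exhaustion \<Omega>1 \<Delta>1" and "exhaustion \<Omega>2 \<Delta>2"
    and "majorant_characterization p \<Omega>1 \<Delta>1" and "majorant_characterization p \<Omega>2 \<Delta>2"
    and "(\<lambda>z. complex_of_real (\<nu> z)) \<in> W_1_infinity \<Omega>2" and "continuous_on \<Omega>2 \<nu>"
    and "0 < \<kappa>" and "\<kappa> < 1" and "AE z in lebesgue_on \<Omega>2. \<bar>\<nu> z\<bar> \<le> \<kappa>"
    and "\<phi> holomorphic_on \<Omega>1" and "\<phi> ` \<Omega>1 \<subseteq> \<Omega>2" and "\<phi> \<in> W_1_infinity \<Omega>1"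
  shows "(\<forall>f\<in>hardy_space p \<Omega>2 \<Delta>2 \<nu>. f \<circ> \<phi> \<in> hardy_space p \<Omega>1 \<Delta>1 (\<nu> \<circ> \<phi>)) \<and>
         (\<forall>f\<in>hardy_space p \<Omega>2 \<Delta>2 \<nu>. \<forall>\<epsilon>>0. \<exists>\<delta>>0. \<forall>g\<in>hardy_space p \<Omega>2 \<Delta>2 \<nu>.
            hardy_norm p \<Delta>2 (\<lambda>z. g z - f z) < \<delta> \<longrightarrow>
            hardy_norm p \<Delta>1 (\<lambda>z. (g \<circ> \<phi>) z - (f \<circ> \<phi>) z) < \<epsilon>)"
proof -
  let ?H1 = "hardy_space p \<Omega>1 \<Delta>1 (\<nu> \<circ> \<phi>)" and ?H2 = "hardy_space p \<Omega>2 \<Delta>2 \<nu>"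
  have p: "0 < p" using assms(1) by simp
  have dom: "open \<Omega>1" "connected \<Omega>1" "open \<Omega>2" "connected \<Omega>2"
    using assms(2,3) unfolding bounded_Dini_smooth_domain_def domain_in_plane_def by blast+
  let ?char = "\<lambda>\<Omega> \<Delta> z0. \<forall>\<nu> \<kappa>. (\<lambda>z. complex_of_real (\<nu> z)) \<in> W_1_infinity \<Omega> \<and> continuous_on \<Omega> \<nu> \<and>
      \<kappa> < 1 \<and> (AE z in lebesgue_on \<Omega>. \<bar>\<nu> z\<bar> \<le> \<kappa>) \<longrightarrow>
        (\<forall>f\<in>CB_solutions \<Omega> \<nu>. f \<in> hardy_space p \<Omega> \<Delta> \<nu> \<longleftrightarrow> harmonic_majorants p \<Omega> f \<noteq> {}) \<and>
        (\<exists>C>0. \<forall>f\<in>hardy_space p \<Omega> \<Delta> \<nu>. hardy_norm p \<Delta> f \<le> C * majorant_norm p \<Omega> z0 f \<and>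
           majorant_norm p \<Omega> z0 f \<le> C * hardy_norm p \<Delta> f)"
  obtain z1 where z1: "z1 \<in> \<Omega>1" and char1: "?char \<Omega>1 \<Delta>1 z1"
    using assms(6) unfolding majorant_characterization_def by (elim bexE)
  obtain z2 where z2: "z2 \<in> \<Omega>2" and char2: "?char \<Omega>2 \<Delta>2 z2"
    using assms(7) unfolding majorant_characterization_def by (elim bexE)
  have bd: "\<forall>z\<in>\<Omega>2. \<bar>\<nu> z\<bar> \<le> \<kappa>"
    by (intro ballI continuous_le_of_AE_le[OF dom(3) _ continuous_on_const assms(12)]
        continuous_on_rabs assms(9))
  note comp = CB_solutions_compose[OF assms(13) dom(1,2) assms(14,15) dom(3) assms(9) bd]
  have \<nu>1: "continuous_on \<Omega>1 (\<nu> \<circ> \<phi>)"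
    by (rule continuous_on_compose[OF holomorphic_on_imp_continuous_on[OF assms(13)]
          continuous_on_subset[OF assms(9,14)]])
  have bd1: "AE z in lebesgue_on \<Omega>1. \<bar>(\<nu> \<circ> \<phi>) z\<bar> \<le> \<kappa>"
    using bd assms(14) by (intro AE_I2) auto
  have char2: "\<forall>f\<in>CB_solutions \<Omega>2 \<nu>. f \<in> ?H2 \<longleftrightarrow> harmonic_majorants p \<Omega>2 f \<noteq> {}"
    "\<exists>C>0. \<forall>f\<in>?H2. hardy_norm p \<Delta>2 f \<le> C * majorant_norm p \<Omega>2 z2 f \<and>
       majorant_norm p \<Omega>2 z2 f \<le> C * hardy_norm p \<Delta>2 f"
    using char2[THEN spec[of _ \<nu>], THEN spec[of _ \<kappa>], THEN mp, OF conjI[OF assms(8) conjI[OF assms(9) conjI[OF assms(11,12)]]]]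
    by (rule conjunct1, rule conjunct2)
  have char1: "\<forall>f\<in>CB_solutions \<Omega>1 (\<nu> \<circ> \<phi>). f \<in> ?H1 \<longleftrightarrow> harmonic_majorants p \<Omega>1 f \<noteq> {}"
    "\<exists>C>0. \<forall>f\<in>?H1. hardy_norm p \<Delta>1 f \<le> C * majorant_norm p \<Omega>1 z1 f \<and>
       majorant_norm p \<Omega>1 z1 f \<le> C * hardy_norm p \<Delta>1 f"
    if "f \<in> CB_solutions \<Omega>2 \<nu>" for f
    using char1[THEN spec[of _ "\<nu> \<circ> \<phi>"], THEN spec[of _ \<kappa>], THEN mp, OF conjI[OF comp(2)[OF that] conjI[OF \<nu>1 conjI[OF assms(11) bd1]]]]
    by (rule conjunct1, rule conjunct2)
  have CB: "f \<in> CB_solutions \<Omega>2 \<nu>" if "f \<in> ?H2" for f using that unfolding hardy_space_def by blast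
  note cont = CB_solutions_continuous[OF CB]
  have maj: "harmonic_majorants p \<Omega>2 f \<noteq> {}" if "f \<in> ?H2" for f
    using char2(1) CB[OF that] that by blast
  have H1: "f \<circ> \<phi> \<in> ?H1" if f: "f \<in> ?H2" for f
  proof -
    have "harmonic_majorants p \<Omega>1 (f \<circ> \<phi>) \<noteq> {}"
      using maj[OF f] harmonic_majorants_compose[OF assms(13) dom(1) assms(14) dom(3) cont[OF f] p] by blast
    then show ?thesis using char1(1)[OF CB[OF f]] comp(1)[OF CB[OF f]] by blast
  qed
  have diff: "(\<lambda>z. g z - f z) \<in> ?H2" if "f \<in> ?H2" "g \<in> ?H2" for f g
  proof -
    have "harmonic_majorants p \<Omega>2 (\<lambda>z. g z - f z) \<noteq> {}"
      using maj[OF that(1)] maj[OF that(2)] harmonic_majorants_diff[OF dom(3) cont[OF that(1)] cont[OF that(2)] p] by blast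
    then show ?thesis
      using char2(1) CB_solutions_diff[OF dom(3) assms(9) CB[OF that(1)] CB[OF that(2)]] by blast
  qed
  obtain K where K: "0 < K" "\<forall>f. continuous_on \<Omega>2 f \<and> harmonic_majorants p \<Omega>2 f \<noteq> {} \<longrightarrow>
    majorant_norm p \<Omega>1 z1 (f \<circ> \<phi>) \<le> K * majorant_norm p \<Omega>2 z2 f"
    using majorant_norm_compose_le[OF assms(13) dom(1) assms(14) dom(3,4) z1 z2 p] by (elim exE conjE)
  obtain C2 where C2: "C2 > 0" "\<And>f. f \<in> ?H2 \<Longrightarrow> majorant_norm p \<Omega>2 z2 f \<le> C2 * hardy_norm p \<Delta>2 f"
    using char2(2) by blast
  have bound: "\<exists>C>0. \<forall>d\<in>?H2. hardy_norm p \<Delta>1 (d \<circ> \<phi>) \<le> C * hardy_norm p \<Delta>2 d" if f: "f \<in> ?H2" for f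
  proof -
    obtain C1 where C1: "C1 > 0" "\<And>f. f \<in> ?H1 \<Longrightarrow> hardy_norm p \<Delta>1 f \<le> C1 * majorant_norm p \<Omega>1 z1 f"
      using char1(2)[OF CB[OF f]] by blast
    show ?thesis
    proof (intro exI[of _ "C1 * (K * C2)"] conjI ballI)
      show "0 < C1 * (K * C2)" using C1(1) C2(1) K(1) by simp
      fix d assume d: "d \<in> ?H2"
      have "hardy_norm p \<Delta>1 (d \<circ> \<phi>) \<le> C1 * majorant_norm p \<Omega>1 z1 (d \<circ> \<phi>)" by (rule C1(2)[OF H1[OF d]])
      also have "\<dots> \<le> C1 * (K * majorant_norm p \<Omega>2 z2 d)"
        using K(2)[rule_format, OF conjI[OF cont[OF d] maj[OF d]]] C1(1) by simp
      also have "\<dots> \<le> C1 * (K * (C2 * hardy_norm p \<Delta>2 d))"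
        using C2(2)[OF d] C1(1) K(1) by simp
      finally show "hardy_norm p \<Delta>1 (d \<circ> \<phi>) \<le> C1 * (K * C2) * hardy_norm p \<Delta>2 d"
        by (simp only: mult.assoc)
    qed
  qed
  show ?thesis
  proof (intro conjI ballI allI impI)
    show "f \<circ> \<phi> \<in> ?H1" if "f \<in> ?H2" for f by (rule H1[OF that])
    fix f and \<epsilon> :: real assume f: "f \<in> ?H2" and \<epsilon>: "0 < \<epsilon>"
    obtain C where C: "C > 0" "\<forall>d\<in>?H2. hardy_norm p \<Delta>1 (d \<circ> \<phi>) \<le> C * hardy_norm p \<Delta>2 d"
      using bound[OF f] by blast
    show "\<exists>\<delta>>0. \<forall>g\<in>?H2. hardy_norm p \<Delta>2 (\<lambda>z. g z - f z) < \<delta> \<longrightarrow>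
            hardy_norm p \<Delta>1 (\<lambda>z. (g \<circ> \<phi>) z - (f \<circ> \<phi>) z) < \<epsilon>"
    proof (intro exI[of _ "\<epsilon> / C"] conjI ballI impI)
      show "0 < \<epsilon> / C" using \<epsilon> C(1) by simp
      fix g assume g: "g \<in> ?H2" and lt: "hardy_norm p \<Delta>2 (\<lambda>z. g z - f z) < \<epsilon> / C"
      have "(\<lambda>z. (g \<circ> \<phi>) z - (f \<circ> \<phi>) z) = (\<lambda>z. g z - f z) \<circ> \<phi>" by (simp add: fun_eq_iff)
      then have "hardy_norm p \<Delta>1 (\<lambda>z. (g \<circ> \<phi>) z - (f \<circ> \<phi>) z) \<le> C * hardy_norm p \<Delta>2 (\<lambda>z. g z - f z)"
        using bspec[OF C(2) diff[OF f g]] by simp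
      also have "\<dots> < \<epsilon>" using lt C(1) by (simp add: field_simps)
      finally show "hardy_norm p \<Delta>1 (\<lambda>z. (g \<circ> \<phi>) z - (f \<circ> \<phi>) z) < \<epsilon>" .
    qed
  qed
qed

end
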